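(* For every $F\in\mathbb{N}$ and $L\in[1,\infty)$ there are real constants $E,E',E'',E''',D,D',D''>0$ such that the following holds. Let $R$ be a commutative ring, let $(X,w)$ be a properly weighted $R$-oriented $d$-poset ($d\ge2$) such that $L(X)\le L$ and $F^{\max}_{0,2}(X),F^{\max}_{1,2}(X)\le F$, and let $\mathcal{F}$ be an $R$-sheaf on $X$. Let $\varepsilon,\varepsilon'\in\mathbb{R}_+$, $\alpha_0,\beta_0,\alpha_{-1},\beta_{-1},\alpha_{||},\beta_{||}\in[0,\infty)$ and suppose that: (1a) $\mathrm{cbe}_{-1}(X_v,w_v,\mathcal{F}_v)\ge\varepsilon$ for every $v\in X(0)$; (1b) $\mathrm{cbe}_{-1}(X_e,w_e,\mathcal{F}_e)\ge\varepsilon'$ for every $e\in X(1)$; (1c) $\mathrm{cbe}_0(X_v,w_v,\mathcal{F}_v)\ge\varepsilon'$ for every $v\in X(0)$; (2a) $\mathrm{Gr}(X_v,w_v)$ is an $(\alpha_0,\beta_0)$-skeleton expander for all $v\in X(0)$; (2b) $\mathrm{Gr}(X,w)$ is an $(\alpha_{-1},\beta_{-1})$-skeleton expander; (2c) $\mathrm{NIH}^{1,1,2}(X,w)$ is an $(\alpha_{||},\beta_{||})$-skeleton expander. Suppose further that $\alpha_{-1}<E\varepsilon$ and that there are $h_{-1},h_0,h_{||}\in(0,1]$ with $$(\alpha_0+\beta_0h_0)+(\alpha_{||}+\beta_{||}h_{||})+\frac{\alpha_{-1}+\beta_{-1}h_{-1}}{h_0}\le E'\varepsilon'.$$ Then $$\mathrm{cse}_0(X,w,\mathcal{F})\ge\frac{E''}{h_0^{-1}h_{-1}^{-1}+h_{||}^{-1}}\qquad\text{and}\qquad\mathrm{ccd}_0(X,w,\mathcal{F})\ge\frac{E'''(E\varepsilon-\alpha_{-1})}{\beta_{-1}}$$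 (the last quotient is read as $+\infty$ if $\beta_{-1}=0$). Moreover, if $f\in C^0=C^0(X,\mathcal{F})$ satisfies $\mathrm{dist}_w(f,Z^0)<\frac{D}{h_0^{-1}h_{-1}^{-1}+h_{||}^{-1}}$, then applying the Correction Algorithm (with $k=0$) to $f$ with parameter $q=D'h_0$ returns $f'\in Z^0$ such that $\mathrm{dist}_w(f,f')\le\frac{1}{D''h_0}\mathrm{dist}_w(f,Z^0)$. Furthermore, the constants $(E,E',E'',E''',D,D',D'')$ for which these hypotheses on $(X,w,\mathcal{F})$ imply the two lower bounds on $\mathrm{cse}_0(X,w,\mathcal{F})$ and $\mathrm{ccd}_0(X,w,\mathcal{F})$ and the assertion on the output of the Correction Algorithm can be taken to have the following explicit values: - with no further assumption on $X$: $\big(L^{-8},\frac14L^{-18}F^{-5},\frac12L^{-13}F^{-2},L^{-3},L^{-15}F^{-1},\frac14L^{-12}F^{-2},\frac14L^{-16}F^{-3}\big)$; - if $X$ is lower-regular: $\big(1,\frac14F^{-2},\frac12F^{-1},1,F^{-1},\frac14F^{-1},\frac14F^{-2}\big)$; - if $X$ is a simplicial complex: $\big(1,\frac1{12},\frac12,1,\frac12,\frac14,\frac18\big)$; - if $X$ is a cube complex: $\big(1,\frac1{16},\frac12,1,\frac12,\frac14,\frac18\big)$; - if $X(-1)\cup X(0)\cup X(1)\cup X(2)$ is an $m$-gon complex: $\big(L^{-8},\frac1{4m}L^{-18},\frac12L^{-13},L^{-3},\frac12L^{-15},\frac14L^{-12},\frac18L^{-16}\big)$.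
   Context: **Posets.** All posets are finite; $x\lhd y$ means $x<y$ with no element strictly between. A graded poset is a poset $X$ with $\dim:X\to\mathbb{Z}$ such that $x\le y$ implies $\dim x\le\dim y$ and $x\lhd y$ implies $\dim y=\dim x+1$. Put $X(i)=\{x\in X:\dim x=i\}$ ($i$-faces), $x(i)=\{y\in X(i):y\le x\}$, and $A_x=\{a\in A:a\ge x\}$ for $A\subseteq X$. A $d$-poset ($d\ge 0$) is a nonempty graded poset in which every face is $\le$ some $d$-face and which has a face $\emptyset_X$ with $\dim\emptyset_X=-1$ and $\emptyset_X\le x$ for all $x$. For a subset $A$ of a $d$-poset, $\mathrm{Inf}\,A$ is the set of maximal lower bounds of $A$. Simplicial complexes, cube complexes, and more generally regular cell complexes are identified with their face posets, including one empty face of dimension $-1$; an $m$-gon complex is a $2$-dimensional regular cell complex all of whose $2$-faces are $m$-gons. **Face counts.** For $i\le j\le k$, $F^{\max}_{i,j,k}(X)$ (resp. $F^{\min}_{i,j,k}(X)$) is the maximal (resp. minimal) number of $y\in X(j)$ with $x\le y\le z$, over all $x\in X(i)$, $z\in X(k)$ with $x\le z$. Write $F^{\max}_{j,k}=F^{\max}_{-1,j,k}$, $L_{i,j,k}=F^{\max}_{i,j,k}/F^{\min}_{i,j,k}$ and $L(X)=\max_{-1\le i\le j\le k\le d}L_{i,j,k}$ (lower irregularity). $X$ is lower-regular if $L(X)=1$. **Weights and links.** A proper weight function on a $d$-poset $X$ is $w:X\to\mathbb{R}_+$ (positive reals) with $\sum_{y\in X(d)}w(y)=1$ and $w(x)=\sum_{y\in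 X(d),\,y\ge x}w(y)/|y(i)|$ for all $x\in X(i)$ and all $i$. For $A\subseteq X$, $w(A)=\sum_{a\in A}w(a)$. For $z\in X$ the link is $X_z=\{x\in X:x\ge z\}$ with $\dim_{X_z}x=\dim x-\dim z-1$, given the proper weight function $w_z(x)=\frac{1}{w(X(d)_z)}\sum_{y\in X(d)_x}\frac{w(y)}{\#\{x'\in X(\dim x):z\le x'\le y\}}$. **Orientation, sheaves, cohomology.** An $R$-orientation on $X$ assigns $[y:x]\in R^\times$ to each $x\lhd y$ so that $\sum_{y:x<y<z}[z:y][y:x]=0$ whenever $x\le z$ and $\dim z=\dim x+2$; links carry the restricted orientation. An $R$-sheaf $\mathcal{F}$ on $X$ consists of $R$-modules $\mathcal{F}(x)$ ($x\in X$) and $R$-linear maps $\mathrm{res}_{y\leftarrow x}:\mathcal{F}(x)\to\mathcal{F}(y)$ ($x<y$) with $\mathrm{res}_{z\leftarrow y}\circ\mathrm{res}_{y\leftarrow x}=\mathrm{res}_{z\leftarrow x}$ for $x<y<z$. $\mathcal{F}_z$ is the restriction of $\mathcal{F}$ to $X_z$. $C^i=C^i(X,\mathcal{F})=\prod_{x\in X(i)}\mathcal{F}(x)$; $d=d_i:C^i\to C^{i+1}$ is $(d_if)(y)=\sum_{x\in y(i)}[y:x]\,\mathrm{res}_{y\leftarrow x}f(x)$; $Z^i=\ker d_i$, $B^i=\mathrm{im}\,d_{i-1}$. **Expansion.** For $f,g\in C^i$: $\|f\|_w=w(\{x:f(x)\ne0\})$, $\mathrm{dist}_w(f,g)=\|f-g\|_w$.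 $\mathrm{cse}_i(X,w,\mathcal{F})$ is the supremum of the $\mu\ge0$ with $\|df\|_w\ge\mu\,\mathrm{dist}_w(f,Z^i)$ for all $f\in C^i$; $\mathrm{cbe}_i(X,w,\mathcal{F})$ is the supremum of the $\mu\ge 0$ with $\|df\|_w\ge\mu\,\mathrm{dist}_w(f,B^i)$ for all $f\in C^i$; $\mathrm{ccd}_i(X,w,\mathcal{F})=\inf\{\|f\|_w:f\in Z^i\setminus B^i\}$. **Hypergraphs, skeleton expansion.** $\mathrm{Gr}(X,w)$ is the weighted hypergraph with vertices $X(0)$, hyperedges $X(1)$ and weights from $w$; it is an $(\alpha,\beta)$-skeleton expander if for all $A\subseteq X(0)$ the total weight of the $e\in X(1)$ having at least two distinct vertices in $A$ is at most $\alpha w(A)+\beta w(A)^2$. $\mathrm{NIH}^{1,1,2}(X,w)$ has vertices $X(1)$, hyperedges $X(2)$ and weights from $w$; it is an $(\alpha,\beta)$-skeleton expander if for all $A\subseteq X(1)$ the total weight of the $z\in X(2)$ for which there are distinct $x,y\in A$ with $x,y<z$ and $\mathrm{Inf}\{x,y\}=\{\emptyset_X\}$ is at most $\alpha w(A)+\beta w(A)^2$. **Correction Algorithm.** For $u\in X$ and $g\in C^{k-\dim u-1}(X_u,\mathcal{F}_u)$, let $g^u\in C^k(X,\mathcal{F})$ be $g^u(x)=g(x)$ if $x\ge u$ and $0$ otherwise. Input: $f\in C^k(X,\mathcal{F})$ and a real $q\ge0$. Set $f_0=f$, $i=0$. While there exist $u\in X(0)\cup\dots\cup X(k)$ and $g\in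 C^{k-\dim u-1}(X_u,\mathcal{F}_u)$ with $\|df_i+d(g^u)\|_w<\|df_i\|_w-q\,w(u)$, choose such a pair, set $f_{i+1}=f_i+g^u$ and increase $i$ by $1$. Output the last $f_i$. *)

theory Defs
  imports
    "HOL-Analysis.Abstract_Euclidean_Space"
    "HOL-Algebra.Module"
    "HOL-Library.Extended_Real"
begin

section \<open>Graded posets\<close>

text \<open>The order of a graded poset is that of the ambient type; the poset itself is a finite subset
  of that type together with a dimension function. Only the values of \<open>gdim\<close> on \<open>faces\<close> matter.\<close>

record 'a gposet =
  faces :: "'a set"
  gdim :: "'a \<Rightarrow> int"

definition cells :: "'a gposet \<Rightarrow> int \<Rightarrow> 'a set" where
  "cells X i = {x \<in> faces X. gdim X x = i}"

definition subfaces :: "('a::order) gposet \<Rightarrow> 'a \<Rightarrow> int \<Rightarrow> 'a set" where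
  "subfaces X x i = {y \<in> cells X i. y \<le> x}"

definition covered :: "('a::order) gposet \<Rightarrow> 'a \<Rightarrow> 'a \<Rightarrow> bool" where
  "covered X x y \<longleftrightarrow> x \<in> faces X \<and> y \<in> faces X \<and> x < y \<and> \<not> (\<exists>z \<in> faces X. x < z \<and> z < y)"

definition graded_poset :: "('a::order) gposet \<Rightarrow> bool" where
  "graded_poset X \<longleftrightarrow> finite (faces X)
    \<and> (\<forall>x \<in> faces X. \<forall>y \<in> faces X. x \<le> y \<longrightarrow> gdim X x \<le> gdim X y)
    \<and> (\<forall>x y. covered X x y \<longrightarrow> gdim X y = gdim X x + 1)"

definition d_poset :: "nat \<Rightarrow> ('a::order) gposet \<Rightarrow> bool" where
  "d_poset d X \<longleftrightarrow> graded_poset X \<and> faces X \<noteq> {}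
    \<and> (\<forall>x \<in> faces X. \<exists>y \<in> cells X (int d). x \<le> y)
    \<and> (\<exists>b \<in> cells X (-1). \<forall>x \<in> faces X. b \<le> x)"

definition empty_face :: "('a::order) gposet \<Rightarrow> 'a" where
  "empty_face X = (THE b. b \<in> faces X \<and> (\<forall>x \<in> faces X. b \<le> x))"

definition lower_bounds :: "('a::order) gposet \<Rightarrow> 'a set \<Rightarrow> 'a set" where
  "lower_bounds X A = {b \<in> faces X. \<forall>a \<in> A. b \<le> a}"

text \<open>\<open>max_lower_bounds X A\<close> is $\mathrm{Inf}\,A$.\<close>

definition max_lower_bounds :: "('a::order) gposet \<Rightarrow> 'a set \<Rightarrow> 'a set" where
  "max_lower_bounds X A = {b \<in> lower_bounds X A. \<not> (\<exists>c \<in> lower_bounds X A. b < c)}"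

section \<open>Simplicial, cube and polygon complexes\<close>

definition poset_iso :: "('a::order \<Rightarrow> 'b::order) \<Rightarrow> 'a set \<Rightarrow> 'b set \<Rightarrow> bool" where
  "poset_iso \<phi> A B \<longleftrightarrow> bij_betw \<phi> A B \<and> (\<forall>x \<in> A. \<forall>y \<in> A. x \<le> y \<longleftrightarrow> \<phi> x \<le> \<phi> y)"

definition abstract_simplicial_complex :: "'v set set \<Rightarrow> bool" where
  "abstract_simplicial_complex \<Delta> \<longleftrightarrow>
    {} \<in> \<Delta> \<and> (\<forall>\<sigma> \<in> \<Delta>. finite \<sigma>) \<and> (\<forall>\<sigma> \<in> \<Delta>. \<forall>\<tau>. \<tau> \<subseteq> \<sigma> \<longrightarrow> \<tau> \<in> \<Delta>)"

text \<open>Taking the vertices in the type \<open>'a\<close> is no restriction, since every vertex of the complex can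
  be renamed to the corresponding $0$-face of \<open>X\<close>.\<close>

definition is_simplicial_complex :: "('a::order) gposet \<Rightarrow> bool" where
  "is_simplicial_complex X \<longleftrightarrow> (\<exists>(\<Delta> :: 'a set set) \<phi>.
      abstract_simplicial_complex \<Delta> \<and> poset_iso \<phi> (faces X) \<Delta>
      \<and> (\<forall>x \<in> faces X. gdim X x = int (card (\<phi> x)) - 1))"

definition closed_unit_ball :: "nat \<Rightarrow> (nat \<Rightarrow> real) topology" where
  "closed_unit_ball n = subtopology (Euclidean_space n) {x. (\<Sum>i<n. (x i)\<^sup>2) \<le> 1}"

definition open_unit_ball :: "nat \<Rightarrow> (nat \<Rightarrow> real) set" where
  "open_unit_ball n = {x \<in> topspace (Euclidean_space n). (\<Sum>i<n. (x i)\<^sup>2) < 1}"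

text \<open>A finite regular cell complex: a Hausdorff space \<open>T\<close> partitioned into open cells \<open>c x\<close>, such
  that the closure of each $n$-cell is a closed $n$-ball whose interior is the cell, and the boundary
  of the cell lies in the union of the cells of smaller dimension. Cells are indexed by the faces
  other than the empty one, and the order of \<open>X\<close> is that of inclusion of closed cells. For finitely
  many cells this coincides with the usual notion of a regular CW complex. The point type
  \<open>'a \<Rightarrow> real\<close> is no restriction: it contains the geometric realization of the order complex of the
  nonempty faces, which is homeomorphic to the space of the complex.\<close>

definition regular_cell_structure ::
    "('a::order) gposet \<Rightarrow> 'p topology \<Rightarrow> ('a \<Rightarrow> 'p set) \<Rightarrow> bool" where
  "regular_cell_structure X T c \<longleftrightarrow>
    (let N = {x \<in> faces X. 0 \<le> gdim X x} in
      Hausdorff_space T \<and> topspace T = (\<Union>x \<in> N. c x)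
      \<and> (\<forall>x \<in> N. \<forall>y \<in> N. x \<noteq> y \<longrightarrow> c x \<inter> c y = {})
      \<and> (\<forall>x \<in> N. \<exists>h. homeomorphic_map (closed_unit_ball (nat (gdim X x)))
                                       (subtopology T (T closure_of c x)) h
                      \<and> h ` open_unit_ball (nat (gdim X x)) = c x)
      \<and> (\<forall>x \<in> N. T closure_of c x - c x \<subseteq> (\<Union>y \<in> {y \<in> N. gdim X y < gdim X x}. c y))
      \<and> (\<forall>x \<in> N. \<forall>y \<in> N. x \<le> y \<longleftrightarrow> T closure_of c x \<subseteq> T closure_of c y))"

definition is_regular_cell_complex :: "('a::order) gposet \<Rightarrow> bool" where
  "is_regular_cell_complex X \<longleftrightarrow> finite (faces X)
    \<and> (\<exists>b \<in> cells X (-1). \<forall>x \<in> faces X. b \<le> x \<and> (x \<noteq> b \<longrightarrow> 0 \<le> gdim X x))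
    \<and> (\<exists>(T :: ('a \<Rightarrow> real) topology) c. regular_cell_structure X T c)"

text \<open>Faces of a polytope are represented by their vertex sets, the empty face included. The vertices
  of the $n$-cube are the subsets of \<open>{..<n}\<close>; its nonempty faces are the intervals \<open>{A..B}\<close> of the
  Boolean lattice.\<close>

definition cube_faces :: "nat \<Rightarrow> nat set set set" where
  "cube_faces n = insert {} {{A..B} | A B. A \<subseteq> B \<and> B \<subseteq> {..<n}}"

definition polygon_faces :: "nat \<Rightarrow> nat set set" where
  "polygon_faces m = {{}, {..<m}} \<union> {{i} | i. i < m} \<union> {{i, (i + 1) mod m} | i. i < m}"

definition is_cube_complex :: "('a::order) gposet \<Rightarrow> bool" where
  "is_cube_complex X \<longleftrightarrow> is_regular_cell_complex X
    \<and> (\<forall>x \<in> faces X. 0 \<le> gdim X x \<longrightarrow>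
          (\<exists>\<phi>. poset_iso \<phi> {y \<in> faces X. y \<le> x} (cube_faces (nat (gdim X x)))))"

definition is_polygon_complex :: "nat \<Rightarrow> ('a::order) gposet \<Rightarrow> bool" where
  "is_polygon_complex m X \<longleftrightarrow> 3 \<le> m \<and> is_regular_cell_complex X
    \<and> (\<forall>x \<in> faces X. gdim X x \<le> 2) \<and> cells X 2 \<noteq> {}
    \<and> (\<forall>z \<in> cells X 2. \<exists>\<phi>. poset_iso \<phi> {y \<in> faces X. y \<le> z} (polygon_faces m))"

definition skeleton2 :: "('a::order) gposet \<Rightarrow> 'a gposet" where
  "skeleton2 X = X\<lparr>faces := cells X (-1) \<union> cells X 0 \<union> cells X 1 \<union> cells X 2\<rparr>"

section \<open>Face counts and lower irregularity\<close>

definition between_counts :: "('a::order) gposet \<Rightarrow> int \<Rightarrow> int \<Rightarrow> int \<Rightarrow> nat set" where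
  "between_counts X i j k =
    {card {y \<in> cells X j. x \<le> y \<and> y \<le> z} | x z. x \<in> cells X i \<and> z \<in> cells X k \<and> x \<le> z}"

definition F_max :: "('a::order) gposet \<Rightarrow> int \<Rightarrow> int \<Rightarrow> int \<Rightarrow> nat" where
  "F_max X i j k = Max (between_counts X i j k)"

definition F_min :: "('a::order) gposet \<Rightarrow> int \<Rightarrow> int \<Rightarrow> int \<Rightarrow> nat" where
  "F_min X i j k = Min (between_counts X i j k)"

definition lower_irregularity :: "nat \<Rightarrow> ('a::order) gposet \<Rightarrow> real" where
  "lower_irregularity d X = Max {real (F_max X i j k) / real (F_min X i j k) | i j k.
      -1 \<le> i \<and> i \<le> j \<and> j \<le> k \<and> k \<le> int d}"

definition lower_regular :: "nat \<Rightarrow> ('a::order) gposet \<Rightarrow> bool" where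
  "lower_regular d X \<longleftrightarrow> lower_irregularity d X = 1"

section \<open>Weights and links\<close>

definition proper_weight :: "nat \<Rightarrow> ('a::order) gposet \<Rightarrow> ('a \<Rightarrow> real) \<Rightarrow> bool" where
  "proper_weight d X w \<longleftrightarrow> (\<forall>x \<in> faces X. 0 < w x) \<and> sum w (cells X (int d)) = 1
    \<and> (\<forall>i. \<forall>x \<in> cells X i.
          w x = (\<Sum>y \<in> {y \<in> cells X (int d). x \<le> y}. w y / real (card (subfaces X y i))))"

definition link :: "('a::order) gposet \<Rightarrow> 'a \<Rightarrow> 'a gposet" where
  "link X z = \<lparr>faces = {x \<in> faces X. z \<le> x}, gdim = (\<lambda>x. gdim X x - gdim X z - 1)\<rparr>"

definition link_weight :: "nat \<Rightarrow> ('a::order) gposet \<Rightarrow> ('a \<Rightarrow> real) \<Rightarrow> 'a \<Rightarrow> 'a \<Rightarrow> real" where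
  "link_weight d X w z x =
    1 / sum w {y \<in> cells X (int d). z \<le> y} *
    (\<Sum>y \<in> {y \<in> cells X (int d). x \<le> y}.
        w y / real (card {x' \<in> cells X (gdim X x). z \<le> x' \<and> x' \<le> y}))"

section \<open>Orientations, sheaves and cohomology\<close>

text \<open>The value \<open>\<sigma> y x\<close> is $[y:x]$.\<close>

definition is_orientation ::
    "'r ring \<Rightarrow> ('a::order) gposet \<Rightarrow> ('a \<Rightarrow> 'a \<Rightarrow> 'r) \<Rightarrow> bool" where
  "is_orientation R X \<sigma> \<longleftrightarrow> (\<forall>x y. covered X x y \<longrightarrow> \<sigma> y x \<in> Units R)
    \<and> (\<forall>x \<in> faces X. \<forall>z \<in> faces X. x \<le> z \<and> gdim X z = gdim X x + 2 \<longrightarrow>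
          (\<Oplus>\<^bsub>R\<^esub> y \<in> {y \<in> faces X. x < y \<and> y < z}. \<sigma> z y \<otimes>\<^bsub>R\<^esub> \<sigma> y x) = \<zero>\<^bsub>R\<^esub>)"

definition linear_maps :: "'r ring \<Rightarrow> ('r, 'm) module \<Rightarrow> ('r, 'm) module \<Rightarrow> ('m \<Rightarrow> 'm) set" where
  "linear_maps R M N = {h \<in> carrier M \<rightarrow> carrier N.
      (\<forall>u \<in> carrier M. \<forall>v \<in> carrier M. h (u \<oplus>\<^bsub>M\<^esub> v) = h u \<oplus>\<^bsub>N\<^esub> h v)
      \<and> (\<forall>a \<in> carrier R. \<forall>u \<in> carrier M. h (a \<odot>\<^bsub>M\<^esub> u) = a \<odot>\<^bsub>N\<^esub> h u)}"

text \<open>\<open>res \<F> y x\<close> is the restriction map from the stalk at \<open>x\<close> to the stalk at \<open>y\<close>. The stalks are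
  arbitrary modules with carriers inside a common type; since only finitely many occur, this is
  no restriction. The sheaf that \<open>\<F>\<close> induces on a link, like the orientation, is given by the same
  data, of which only the part over the faces of the link is used.\<close>

record ('a, 'r, 'm) sheaf =
  stalk :: "'a \<Rightarrow> ('r, 'm) module"
  res :: "'a \<Rightarrow> 'a \<Rightarrow> 'm \<Rightarrow> 'm"

definition is_sheaf :: "'r ring \<Rightarrow> ('a::order) gposet \<Rightarrow> ('a, 'r, 'm) sheaf \<Rightarrow> bool" where
  "is_sheaf R X \<F> \<longleftrightarrow> (\<forall>x \<in> faces X. Module.module R (stalk \<F> x))
    \<and> (\<forall>x \<in> faces X. \<forall>y \<in> faces X. x < y \<longrightarrow> res \<F> y x \<in> linear_maps R (stalk \<F> x) (stalk \<F> y))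
    \<and> (\<forall>x \<in> faces X. \<forall>y \<in> faces X. \<forall>z \<in> faces X. x < y \<and> y < z \<longrightarrow>
          (\<forall>u \<in> carrier (stalk \<F> x). res \<F> z y (res \<F> y x u) = res \<F> z x u))"

definition cochains :: "'a gposet \<Rightarrow> ('a, 'r, 'm) sheaf \<Rightarrow> int \<Rightarrow> ('a \<Rightarrow> 'm) set" where
  "cochains X \<F> i = (\<Pi>\<^sub>E x \<in> cells X i. carrier (stalk \<F> x))"

definition cochain_add ::
    "'a gposet \<Rightarrow> ('a, 'r, 'm) sheaf \<Rightarrow> int \<Rightarrow> ('a \<Rightarrow> 'm) \<Rightarrow> ('a \<Rightarrow> 'm) \<Rightarrow> 'a \<Rightarrow> 'm" where
  "cochain_add X \<F> i f g = (\<lambda>x \<in> cells X i. f x \<oplus>\<^bsub>stalk \<F> x\<^esub> g x)"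

definition cochain_diff ::
    "'a gposet \<Rightarrow> ('a, 'r, 'm) sheaf \<Rightarrow> int \<Rightarrow> ('a \<Rightarrow> 'm) \<Rightarrow> ('a \<Rightarrow> 'm) \<Rightarrow> 'a \<Rightarrow> 'm" where
  "cochain_diff X \<F> i f g = (\<lambda>x \<in> cells X i. f x \<ominus>\<^bsub>stalk \<F> x\<^esub> g x)"

definition cobd :: "('a::order) gposet \<Rightarrow> ('a \<Rightarrow> 'a \<Rightarrow> 'r) \<Rightarrow> ('a, 'r, 'm) sheaf \<Rightarrow> int \<Rightarrow>
    ('a \<Rightarrow> 'm) \<Rightarrow> 'a \<Rightarrow> 'm" where
  "cobd X \<sigma> \<F> i f = (\<lambda>y \<in> cells X (i + 1).
      \<Oplus>\<^bsub>stalk \<F> y\<^esub> x \<in> subfaces X y i. \<sigma> y x \<odot>\<^bsub>stalk \<F> y\<^esub> res \<F> y x (f x))"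

definition cocycles :: "('a::order) gposet \<Rightarrow> ('a \<Rightarrow> 'a \<Rightarrow> 'r) \<Rightarrow> ('a, 'r, 'm) sheaf \<Rightarrow> int \<Rightarrow>
    ('a \<Rightarrow> 'm) set" where
  "cocycles X \<sigma> \<F> i =
    {f \<in> cochains X \<F> i. \<forall>y \<in> cells X (i + 1). cobd X \<sigma> \<F> i f y = \<zero>\<^bsub>stalk \<F> y\<^esub>}"

definition coboundaries :: "('a::order) gposet \<Rightarrow> ('a \<Rightarrow> 'a \<Rightarrow> 'r) \<Rightarrow> ('a, 'r, 'm) sheaf \<Rightarrow> int \<Rightarrow>
    ('a \<Rightarrow> 'm) set" where
  "coboundaries X \<sigma> \<F> i = cobd X \<sigma> \<F> (i - 1) ` cochains X \<F> (i - 1)"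

section \<open>Expansion\<close>

definition wnorm :: "'a gposet \<Rightarrow> ('a \<Rightarrow> real) \<Rightarrow> ('a, 'r, 'm) sheaf \<Rightarrow> int \<Rightarrow> ('a \<Rightarrow> 'm) \<Rightarrow> real" where
  "wnorm X w \<F> i f = sum w {x \<in> cells X i. f x \<noteq> \<zero>\<^bsub>stalk \<F> x\<^esub>}"

definition wdist :: "'a gposet \<Rightarrow> ('a \<Rightarrow> real) \<Rightarrow> ('a, 'r, 'm) sheaf \<Rightarrow> int \<Rightarrow>
    ('a \<Rightarrow> 'm) \<Rightarrow> ('a \<Rightarrow> 'm) \<Rightarrow> real" where
  "wdist X w \<F> i f g = wnorm X w \<F> i (cochain_diff X \<F> i f g)"

definition wdist_set :: "'a gposet \<Rightarrow> ('a \<Rightarrow> real) \<Rightarrow> ('a, 'r, 'm) sheaf \<Rightarrow> int \<Rightarrow>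
    ('a \<Rightarrow> 'm) \<Rightarrow> ('a \<Rightarrow> 'm) set \<Rightarrow> real" where
  "wdist_set X w \<F> i f S = (INF g \<in> S. wdist X w \<F> i f g)"

definition cse :: "('a::order) gposet \<Rightarrow> ('a \<Rightarrow> real) \<Rightarrow> ('a \<Rightarrow> 'a \<Rightarrow> 'r) \<Rightarrow> ('a, 'r, 'm) sheaf \<Rightarrow>
    int \<Rightarrow> ereal" where
  "cse X w \<sigma> \<F> i = Sup {ereal \<mu> | \<mu>. 0 \<le> \<mu> \<and> (\<forall>f \<in> cochains X \<F> i.
      wnorm X w \<F> (i + 1) (cobd X \<sigma> \<F> i f) \<ge> \<mu> * wdist_set X w \<F> i f (cocycles X \<sigma> \<F> i))}"

definition cbe :: "('a::order) gposet \<Rightarrow> ('a \<Rightarrow> real) \<Rightarrow> ('a \<Rightarrow> 'a \<Rightarrow> 'r) \<Rightarrow> ('a, 'r, 'm) sheaf \<Rightarrow>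
    int \<Rightarrow> ereal" where
  "cbe X w \<sigma> \<F> i = Sup {ereal \<mu> | \<mu>. 0 \<le> \<mu> \<and> (\<forall>f \<in> cochains X \<F> i.
      wnorm X w \<F> (i + 1) (cobd X \<sigma> \<F> i f) \<ge> \<mu> * wdist_set X w \<F> i f (coboundaries X \<sigma> \<F> i))}"

definition ccd :: "('a::order) gposet \<Rightarrow> ('a \<Rightarrow> real) \<Rightarrow> ('a \<Rightarrow> 'a \<Rightarrow> 'r) \<Rightarrow> ('a, 'r, 'm) sheaf \<Rightarrow>
    int \<Rightarrow> ereal" where
  "ccd X w \<sigma> \<F> i = (INF f \<in> cocycles X \<sigma> \<F> i - coboundaries X \<sigma> \<F> i. ereal (wnorm X w \<F> i f))"

definition Gr_skeleton_expander ::
    "('a::order) gposet \<Rightarrow> ('a \<Rightarrow> real) \<Rightarrow> real \<Rightarrow> real \<Rightarrow> bool" where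
  "Gr_skeleton_expander X w \<alpha> \<beta> \<longleftrightarrow> (\<forall>A \<subseteq> cells X 0.
      sum w {e \<in> cells X 1. \<exists>x \<in> A. \<exists>y \<in> A. x \<noteq> y \<and> x < e \<and> y < e}
        \<le> \<alpha> * sum w A + \<beta> * (sum w A)\<^sup>2)"

definition NIH112_skeleton_expander ::
    "('a::order) gposet \<Rightarrow> ('a \<Rightarrow> real) \<Rightarrow> real \<Rightarrow> real \<Rightarrow> bool" where
  "NIH112_skeleton_expander X w \<alpha> \<beta> \<longleftrightarrow> (\<forall>A \<subseteq> cells X 1.
      sum w {z \<in> cells X 2. \<exists>x \<in> A. \<exists>y \<in> A. x \<noteq> y \<and> x < z \<and> y < z
                              \<and> max_lower_bounds X {x, y} = {empty_face X}}
        \<le> \<alpha> * sum w A + \<beta> * (sum w A)\<^sup>2)"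

section \<open>The Correction Algorithm\<close>

definition extend_by_zero ::
    "('a::order) gposet \<Rightarrow> ('a, 'r, 'm) sheaf \<Rightarrow> int \<Rightarrow> 'a \<Rightarrow> ('a \<Rightarrow> 'm) \<Rightarrow> 'a \<Rightarrow> 'm" where
  "extend_by_zero X \<F> k u g = (\<lambda>x \<in> cells X k. if u \<le> x then g x else \<zero>\<^bsub>stalk \<F> x\<^esub>)"

definition correction_step :: "('a::order) gposet \<Rightarrow> ('a \<Rightarrow> real) \<Rightarrow> ('a \<Rightarrow> 'a \<Rightarrow> 'r) \<Rightarrow>
    ('a, 'r, 'm) sheaf \<Rightarrow> int \<Rightarrow> real \<Rightarrow> ('a \<Rightarrow> 'm) \<Rightarrow> ('a \<Rightarrow> 'm) \<Rightarrow> bool" where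
  "correction_step X w \<sigma> \<F> k q f f' \<longleftrightarrow>
    (\<exists>u \<in> faces X. 0 \<le> gdim X u \<and> gdim X u \<le> k \<and>
      (\<exists>g \<in> cochains (link X u) \<F> (k - gdim X u - 1).
         wnorm X w \<F> (k + 1) (cochain_add X \<F> (k + 1) (cobd X \<sigma> \<F> k f)
             (cobd X \<sigma> \<F> k (extend_by_zero X \<F> k u g)))
           < wnorm X w \<F> (k + 1) (cobd X \<sigma> \<F> k f) - q * w u
         \<and> f' = cochain_add X \<F> k f (extend_by_zero X \<F> k u g)))"

text \<open>The algorithm makes arbitrary choices, so its outputs form a relation; termination is the
  absence of infinite runs.\<close>

definition correction_terminates :: "('a::order) gposet \<Rightarrow> ('a \<Rightarrow> real) \<Rightarrow> ('a \<Rightarrow> 'a \<Rightarrow> 'r) \<Rightarrow>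
    ('a, 'r, 'm) sheaf \<Rightarrow> int \<Rightarrow> real \<Rightarrow> ('a \<Rightarrow> 'm) \<Rightarrow> bool" where
  "correction_terminates X w \<sigma> \<F> k q f \<longleftrightarrow>
    \<not> (\<exists>s :: nat \<Rightarrow> 'a \<Rightarrow> 'm. s 0 = f \<and> (\<forall>i. correction_step X w \<sigma> \<F> k q (s i) (s (Suc i))))"

definition correction_output :: "('a::order) gposet \<Rightarrow> ('a \<Rightarrow> real) \<Rightarrow> ('a \<Rightarrow> 'a \<Rightarrow> 'r) \<Rightarrow>
    ('a, 'r, 'm) sheaf \<Rightarrow> int \<Rightarrow> real \<Rightarrow> ('a \<Rightarrow> 'm) \<Rightarrow> ('a \<Rightarrow> 'm) \<Rightarrow> bool" where
  "correction_output X w \<sigma> \<F> k q f f' \<longleftrightarrow>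
    (correction_step X w \<sigma> \<F> k q)\<^sup>*\<^sup>* f f' \<and> \<not> (\<exists>f''. correction_step X w \<sigma> \<F> k q f' f'')"

section \<open>The local-to-global criterion\<close>

definition admissible :: "nat \<Rightarrow> real \<Rightarrow> 'r ring \<Rightarrow> nat \<Rightarrow> ('a::order) gposet \<Rightarrow> ('a \<Rightarrow> real) \<Rightarrow>
    ('a \<Rightarrow> 'a \<Rightarrow> 'r) \<Rightarrow> ('a, 'r, 'm) sheaf \<Rightarrow> bool" where
  "admissible F L R d X w \<sigma> \<F> \<longleftrightarrow> cring R \<and> 2 \<le> d \<and> d_poset d X \<and> proper_weight d X w
    \<and> is_orientation R X \<sigma> \<and> is_sheaf R X \<F> \<and> lower_irregularity d X \<le> L
    \<and> F_max X (-1) 0 2 \<le> F \<and> F_max X (-1) 1 2 \<le> F"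

text \<open>The indices \<open>m\<close> and \<open>p\<close> stand for $-1$ and $||$.\<close>

definition local_expansion :: "nat \<Rightarrow> ('a::order) gposet \<Rightarrow> ('a \<Rightarrow> real) \<Rightarrow> ('a \<Rightarrow> 'a \<Rightarrow> 'r) \<Rightarrow>
    ('a, 'r, 'm) sheaf \<Rightarrow> real \<Rightarrow> real \<Rightarrow> bool" where
  "local_expansion d X w \<sigma> \<F> \<epsilon> \<epsilon>' \<longleftrightarrow>
    (\<forall>v \<in> cells X 0. cbe (link X v) (link_weight d X w v) \<sigma> \<F> (-1) \<ge> ereal \<epsilon>)
    \<and> (\<forall>e \<in> cells X 1. cbe (link X e) (link_weight d X w e) \<sigma> \<F> (-1) \<ge> ereal \<epsilon>')
    \<and> (\<forall>v \<in> cells X 0. cbe (link X v) (link_weight d X w v) \<sigma> \<F> 0 \<ge> ereal \<epsilon>')"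

definition skeleton_expansion :: "nat \<Rightarrow> ('a::order) gposet \<Rightarrow> ('a \<Rightarrow> real) \<Rightarrow>
    real \<Rightarrow> real \<Rightarrow> real \<Rightarrow> real \<Rightarrow> real \<Rightarrow> real \<Rightarrow> bool" where
  "skeleton_expansion d X w \<alpha>\<^sub>0 \<beta>\<^sub>0 \<alpha>\<^sub>m \<beta>\<^sub>m \<alpha>\<^sub>p \<beta>\<^sub>p \<longleftrightarrow>
    (\<forall>v \<in> cells X 0. Gr_skeleton_expander (link X v) (link_weight d X w v) \<alpha>\<^sub>0 \<beta>\<^sub>0)
    \<and> Gr_skeleton_expander X w \<alpha>\<^sub>m \<beta>\<^sub>m
    \<and> NIH112_skeleton_expander X w \<alpha>\<^sub>p \<beta>\<^sub>p"

text \<open>\<open>criterion E E' E'' E''' D D' D'' d X w \<sigma> \<F>\<close>: with these constants, the hypotheses on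
  \<open>(X, w, \<F>)\<close> imply the bounds on \<open>cse\<close> and \<open>ccd\<close> and the assertion on the Correction Algorithm.\<close>

definition criterion :: "real \<Rightarrow> real \<Rightarrow> real \<Rightarrow> real \<Rightarrow> real \<Rightarrow> real \<Rightarrow> real \<Rightarrow>
    nat \<Rightarrow> ('a::order) gposet \<Rightarrow> ('a \<Rightarrow> real) \<Rightarrow> ('a \<Rightarrow> 'a \<Rightarrow> 'r) \<Rightarrow> ('a, 'r, 'm) sheaf \<Rightarrow> bool" where
  "criterion E E' E'' E''' D D' D'' d X w \<sigma> \<F> \<longleftrightarrow>
    (\<forall>\<epsilon> \<epsilon>' \<alpha>\<^sub>0 \<beta>\<^sub>0 \<alpha>\<^sub>m \<beta>\<^sub>m \<alpha>\<^sub>p \<beta>\<^sub>p h\<^sub>m h\<^sub>0 h\<^sub>p.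
      0 < \<epsilon> \<and> 0 < \<epsilon>' \<and> 0 \<le> \<alpha>\<^sub>0 \<and> 0 \<le> \<beta>\<^sub>0 \<and> 0 \<le> \<alpha>\<^sub>m \<and> 0 \<le> \<beta>\<^sub>m \<and> 0 \<le> \<alpha>\<^sub>p \<and> 0 \<le> \<beta>\<^sub>p
      \<and> local_expansion d X w \<sigma> \<F> \<epsilon> \<epsilon>'
      \<and> skeleton_expansion d X w \<alpha>\<^sub>0 \<beta>\<^sub>0 \<alpha>\<^sub>m \<beta>\<^sub>m \<alpha>\<^sub>p \<beta>\<^sub>p
      \<and> \<alpha>\<^sub>m < E * \<epsilon>
      \<and> h\<^sub>m \<in> {0<..1} \<and> h\<^sub>0 \<in> {0<..1} \<and> h\<^sub>p \<in> {0<..1}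
      \<and> (\<alpha>\<^sub>0 + \<beta>\<^sub>0 * h\<^sub>0) + (\<alpha>\<^sub>p + \<beta>\<^sub>p * h\<^sub>p) + (\<alpha>\<^sub>m + \<beta>\<^sub>m * h\<^sub>m) / h\<^sub>0 \<le> E' * \<epsilon>'
      \<longrightarrow>
      cse X w \<sigma> \<F> 0 \<ge> ereal (E'' / (1 / h\<^sub>0 * (1 / h\<^sub>m) + 1 / h\<^sub>p))
      \<and> ccd X w \<sigma> \<F> 0 \<ge> (if \<beta>\<^sub>m = 0 then \<infinity> else ereal (E''' * (E * \<epsilon> - \<alpha>\<^sub>m) / \<beta>\<^sub>m))
      \<and> (\<forall>f \<in> cochains X \<F> 0.
           wdist_set X w \<F> 0 f (cocycles X \<sigma> \<F> 0) < D / (1 / h\<^sub>0 * (1 / h\<^sub>m) + 1 / h\<^sub>p) \<longrightarrow>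
           correction_terminates X w \<sigma> \<F> 0 (D' * h\<^sub>0) f
           \<and> (\<forall>f'. correction_output X w \<sigma> \<F> 0 (D' * h\<^sub>0) f f' \<longrightarrow>
                f' \<in> cocycles X \<sigma> \<F> 0
                \<and> wdist X w \<F> 0 f f' \<le> 1 / (D'' * h\<^sub>0) * wdist_set X w \<F> 0 f (cocycles X \<sigma> \<F> 0))))"

end

(* Let f be a 0-cochain at which the Correction Algorithm is stuck, and A the support of df. Call a
   vertex v heavy if A has relative weight at least h_0 in the link of v; the heavy vertices have
   total weight at most L^4 w(A) / h_0. A triangle is bad if it contains two edges of A meeting in a
   light vertex, or an edge of A with two heavy vertices, or two edges of A with no common vertex.
   Skeleton expansion of the links, of X and of NIH bounds the weight of the bad triangles by a small
   multiple of epsilon' w(A). On the other hand, since ddf = 0, the local expansion at an edge of A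
   without heavy vertices (1b), and at the star of a heavy vertex (1c, where being stuck means that
   df is nearly minimal modulo coboundaries of the link), produces many triangles in which a second
   edge of A has to cancel the first, and these are bad. So A is empty once w(A) is small. Both the
   cosystolic expansion and the statement on the algorithm follow, as each correction of weight w(u)
   lowers the norm of df by at least q w(u). The cocycle distance only needs (1a): most edges
   at a vertex of the support of a cocycle have a second vertex in the support. *)

theory Submission
  imports Defs
begin

section \<open>Intervals, the empty face and common vertices in a d-poset\<close>

section \<open>Graded posets and face counts\<close>

text \<open>The obstacle is that expansion is assumed in links, while all sets are weighed by
  \<open>w\<close>, and in an irregular poset the two weights are not proportional. For
  \<open>x\<close> of dimension \<open>i\<close> above \<open>u\<close> of dimension
  \<open>p\<close>, \<open>link_weight d X w u x * w u\<close> is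
  \<open>link_scale p i * w x\<close> up to a factor between 1 and L^3, and
  \<open>link_scale p i\<close> is the reciprocal of a face number only up to powers of L. Bounding
  the bad triangles from above costs L^7, bounding the witnesses from below costs L^9; hence the
  exponent 16 in the condition on E'. The other constants are face counts: K from the bad triangles,
  M for how often one triangle is charged, \<rho> for the scales that remain in the lower bound. The
  argument closes when \<open>2 * M * K * L ^ 16 * E' \<le> \<rho>\<close>. The factor 2 pays for
  the slack of the algorithm: df is minimal at a heavy vertex only up to q w(v), which still leaves
  a share \<tau> > 1/2 of its star. The thresholds h make the quadratic term of skeleton expansion
  linear, so w(A) has to be small against both h_0 h_{-1} and h_||; the harmonic expression in the
  conclusion lies below both.\<close>

locale dposet =
  fixes d :: nat and X :: "('a::order) gposet"
  assumes d_poset: "d_poset d X"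
begin

lemma finite_faces: "finite (faces X)"
  using d_poset by (simp add: d_poset_def graded_poset_def)

lemma finite_cells [simp]: "finite (cells X i)"
  using finite_faces by (simp add: cells_def)

lemma cells_faces: "x \<in> cells X i \<Longrightarrow> x \<in> faces X"
  by (simp add: cells_def)

lemma cells_gdim: "x \<in> cells X i \<Longrightarrow> gdim X x = i"
  by (simp add: cells_def)

lemma in_cells_gdim: "x \<in> faces X \<Longrightarrow> x \<in> cells X (gdim X x)"
  by (simp add: cells_def)

lemma gdim_mono: "x \<in> faces X \<Longrightarrow> y \<in> faces X \<Longrightarrow> x \<le> y \<Longrightarrow> gdim X x \<le> gdim X y"
  using d_poset by (simp add: d_poset_def graded_poset_def)

text \<open>A minimal element of the finite set of faces above \<open>x\<close> and below or equal
  to \<open>y\<close> covers \<open>x\<close>. This is where the covering axiom of the grading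
  enters.\<close>

lemma covered_below:
  assumes "x \<in> faces X" "y \<in> faces X" "x < y"
  obtains c where "c \<in> cells X (gdim X x + 1)" "x < c" "c \<le> y"
proof -
  let ?S = "{z \<in> faces X. x < z \<and> z \<le> y}"
  have "finite ?S" "?S \<noteq> {}"
    using assms finite_faces by auto
  then obtain c where c: "c \<in> ?S" "\<forall>z \<in> ?S. z \<le> c \<longrightarrow> c = z"
    using finite_has_minimal[of ?S] by blast
  have "covered X x c"
    unfolding covered_def using c assms(1) by fastforce
  then have "gdim X c = gdim X x + 1"
    using d_poset by (simp add: d_poset_def graded_poset_def)
  then show ?thesis
    using c(1) by (intro that[of c]) (auto simp: cells_def)
qed

lemma gdim_strict:
  assumes "x \<in> faces X" "y \<in> faces X" "x < y"
  shows "gdim X x < gdim X y"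
proof -
  obtain c where c: "c \<in> cells X (gdim X x + 1)" "x < c" "c \<le> y"
    using covered_below assms by blast
  then have "gdim X c \<le> gdim X y"
    using gdim_mono assms cells_faces by blast
  then show ?thesis
    using c(1) by (simp add: cells_def)
qed

lemma eq_of_same_gdim:
  "x \<in> cells X i \<Longrightarrow> y \<in> cells X i \<Longrightarrow> x \<le> y \<Longrightarrow> x = y"
  using gdim_strict by (metis cells_faces cells_gdim order_le_less order_less_irrefl)

text \<open>Climbing from \<open>x\<close> by covers raises the dimension by one at a time, so no
  intermediate dimension is skipped. The positivity of all face counts rests on this.\<close>

lemma exists_between:
  assumes "x \<in> faces X" "z \<in> faces X" "x \<le> z" "gdim X x \<le> j" "j \<le> gdim X z"
  shows "\<exists>y \<in> cells X j. x \<le> y \<and> y \<le> z"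
  using assms
proof (induction "nat (j - gdim X x)" arbitrary: x)
  case 0
  then show ?case
    using in_cells_gdim[of x] by auto
next
  case (Suc n)
  have "gdim X x < j"
    using Suc.hyps(2) by linarith
  then have "x < z"
    using Suc.prems by (auto simp: order_le_less)
  then obtain c where c: "c \<in> cells X (gdim X x + 1)" "x < c" "c \<le> z"
    using covered_below[OF Suc.prems(1,2)] by blast
  have "gdim X c = gdim X x + 1" "c \<in> faces X"
    using c by (auto simp: cells_def)
  with Suc.hyps(2) have "n = nat (j - gdim X c)" "gdim X c \<le> j"
    by auto
  then have "\<exists>y \<in> cells X j. c \<le> y \<and> y \<le> z"
    using Suc.hyps(1)[of c] Suc.prems c \<open>c \<in> faces X\<close> by auto
  then show ?case
    using c(2) by (meson order.strict_implies_order order_trans)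
qed

lemma empty_face_props:
  "empty_face X \<in> cells X (-1)" "x \<in> faces X \<Longrightarrow> empty_face X \<le> x"
proof -
  obtain b where b: "b \<in> cells X (-1)" "\<forall>x \<in> faces X. b \<le> x"
    using d_poset by (auto simp: d_poset_def)
  have "empty_face X = b"
    unfolding empty_face_def using b by (intro the_equality) (auto simp: cells_def intro: order_antisym)
  then show "empty_face X \<in> cells X (-1)" "x \<in> faces X \<Longrightarrow> empty_face X \<le> x"
    using b by auto
qed

lemma empty_face_in_faces: "empty_face X \<in> faces X"
  using empty_face_props(1) cells_faces by blast

lemma gdim_ge: "x \<in> faces X \<Longrightarrow> -1 \<le> gdim X x"
  using gdim_mono[OF empty_face_in_faces _ empty_face_props(2)] cells_gdim[OF empty_face_props(1)]
  by simp

lemma ex_top_face: "x \<in> faces X \<Longrightarrow> \<exists>y \<in> cells X (int d). x \<le> y"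
  using d_poset by (simp add: d_poset_def)

lemma gdim_le: "x \<in> faces X \<Longrightarrow> gdim X x \<le> int d"
  using ex_top_face gdim_mono cells_faces cells_gdim by metis

lemma cells_minus_one: "cells X (-1) = {empty_face X}"
  using eq_of_same_gdim[OF empty_face_props(1)] empty_face_props cells_faces by blast

lemma strictly_below_cells:
  "x \<in> cells X i \<Longrightarrow> y \<in> cells X j \<Longrightarrow> i < j \<Longrightarrow> x < y \<longleftrightarrow> x \<le> y"
  by (metis cells_gdim order_le_less order_less_irrefl)

text \<open>If the empty face is the only lower bound, it is also the only maximal one, and the
  infimum is the one singled out in NIH. Any other lower bound has a vertex below it.\<close>

lemma common_vertex:
  assumes "x \<in> cells X 1" "y \<in> cells X 1" "x \<noteq> y"
    "max_lower_bounds X {x, y} \<noteq> {empty_face X}"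
  obtains u where "u \<in> cells X 0" "u \<le> x" "u \<le> y"
proof -
  have "\<exists>b \<in> lower_bounds X {x, y}. b \<noteq> empty_face X"
  proof (rule ccontr)
    assume "\<not> ?thesis"
    moreover have "empty_face X \<in> lower_bounds X {x, y}"
      using assms empty_face_props empty_face_in_faces cells_faces
      by (auto simp: lower_bounds_def)
    ultimately have "lower_bounds X {x, y} = {empty_face X}"
      by blast
    then have "max_lower_bounds X {x, y} = {empty_face X}"
      by (auto simp: max_lower_bounds_def)
    with assms show False by simp
  qed
  then obtain b where b: "b \<in> faces X" "b \<le> x" "b \<le> y" "b \<noteq> empty_face X"
    by (auto simp: lower_bounds_def)
  then have "gdim X b \<ge> 0"
    using gdim_strict[OF empty_face_in_faces b(1)] empty_face_props(2)[OF b(1)]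
      cells_gdim[OF empty_face_props(1)] by (auto simp: order_le_less)
  then obtain u where "u \<in> cells X 0" "u \<le> b"
    using exists_between[OF empty_face_in_faces b(1) empty_face_props(2)[OF b(1)], of 0]
      cells_gdim[OF empty_face_props(1)] by auto
  then show ?thesis
    using that b order_trans by blast
qed

section \<open>Extremal face counts and lower irregularity\<close>

lemma between_counts_finite: "finite (between_counts X i j k)"
proof -
  have "between_counts X i j k \<subseteq>
      (\<lambda>(x, z). card {y \<in> cells X j. x \<le> y \<and> y \<le> z}) ` (cells X i \<times> cells X k)"
    by (auto simp: between_counts_def)
  then show ?thesis
    by (rule finite_subset) auto
qed

lemma between_counts_nonempty:
  assumes "-1 \<le> i" "i \<le> k" "k \<le> int d"
  shows "between_counts X i j k \<noteq> {}"
proof -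
  have "\<exists>y \<in> cells X (int d). empty_face X \<le> y"
    using ex_top_face empty_face_in_faces by blast
  then obtain y where y: "y \<in> cells X (int d)" by blast
  then obtain z where z: "z \<in> cells X k" "z \<le> y"
    using exists_between[OF empty_face_in_faces cells_faces[OF y] empty_face_props(2)[OF cells_faces[OF y]], of k]
      cells_gdim[OF empty_face_props(1)] cells_gdim[OF y] assms by auto
  then obtain x where x: "x \<in> cells X i" "x \<le> z"
    using exists_between[OF empty_face_in_faces cells_faces[OF z(1)] empty_face_props(2)[OF cells_faces[OF z(1)]], of i]
      cells_gdim[OF empty_face_props(1)] cells_gdim[OF z(1)] assms by auto
  then show ?thesis
    using z by (auto simp: between_counts_def)
qed

lemma between_count_in:
  "x \<in> cells X i \<Longrightarrow> z \<in> cells X k \<Longrightarrow> x \<le> z \<Longrightarrow>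
    card {y \<in> cells X j. x \<le> y \<and> y \<le> z} \<in> between_counts X i j k"
  by (auto simp: between_counts_def)

lemma count_le_F_max:
  "x \<in> cells X i \<Longrightarrow> z \<in> cells X k \<Longrightarrow> x \<le> z \<Longrightarrow>
    card {y \<in> cells X j. x \<le> y \<and> y \<le> z} \<le> F_max X i j k"
  unfolding F_max_def by (intro Max_ge between_counts_finite between_count_in)

lemma F_min_le_count:
  "x \<in> cells X i \<Longrightarrow> z \<in> cells X k \<Longrightarrow> x \<le> z \<Longrightarrow>
    F_min X i j k \<le> card {y \<in> cells X j. x \<le> y \<and> y \<le> z}"
  unfolding F_min_def by (intro Min_le between_counts_finite between_count_in)

lemma subfaces_eq:
  "x \<in> faces X \<Longrightarrow> subfaces X x i = {y \<in> cells X i. empty_face X \<le> y \<and> y \<le> x}"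
  using empty_face_props(2) cells_faces by (auto simp: subfaces_def)

lemma card_subfaces_le: "z \<in> cells X k \<Longrightarrow> card (subfaces X z j) \<le> F_max X (-1) j k"
  using count_le_F_max[OF empty_face_props(1), of z k j]
  by (simp add: subfaces_eq cells_faces empty_face_props(2))

lemma card_subfaces_ge: "z \<in> cells X k \<Longrightarrow> F_min X (-1) j k \<le> card (subfaces X z j)"
  using F_min_le_count[OF empty_face_props(1), of z k j]
  by (simp add: subfaces_eq cells_faces empty_face_props(2))

lemma F_min_pos:
  assumes "-1 \<le> i" "i \<le> j" "j \<le> k" "k \<le> int d"
  shows "0 < F_min X i j k"
proof -
  have "F_min X i j k \<in> between_counts X i j k"
    unfolding F_min_def using assms
    by (intro Min_in between_counts_finite between_counts_nonempty) auto
  then obtain x z where xz: "x \<in> cells X i" "z \<in> cells X k" "x \<le> z"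
    and F: "F_min X i j k = card {y \<in> cells X j. x \<le> y \<and> y \<le> z}"
    by (auto simp: between_counts_def)
  have "{y \<in> cells X j. x \<le> y \<and> y \<le> z} \<noteq> {}"
    using exists_between[of x z j] xz assms cells_faces cells_gdim by fastforce
  then show ?thesis
    unfolding F by (simp add: card_gt_0_iff)
qed

lemma F_min_le_F_max:
  assumes "-1 \<le> i" "i \<le> j" "j \<le> k" "k \<le> int d"
  shows "F_min X i j k \<le> F_max X i j k"
  unfolding F_min_def F_max_def using between_counts_nonempty[of i k j] assms
  by (intro Min_le Max_in between_counts_finite) auto

lemma lower_irregularity_set_finite:
  "finite {real (F_max X i j k) / real (F_min X i j k) | i j k.
      -1 \<le> i \<and> i \<le> j \<and> j \<le> k \<and> k \<le> int d}" (is "finite ?S")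
proof -
  have "?S \<subseteq> (\<lambda>(i, j, k). real (F_max X i j k) / real (F_min X i j k)) `
      ({-1..int d} \<times> {-1..int d} \<times> {-1..int d})"
  proof
    fix r assume "r \<in> ?S"
    then obtain i j k where "r = real (F_max X i j k) / real (F_min X i j k)"
      "-1 \<le> i" "i \<le> j" "j \<le> k" "k \<le> int d" by blast
    then show "r \<in> (\<lambda>(i, j, k). real (F_max X i j k) / real (F_min X i j k)) `
      ({-1..int d} \<times> {-1..int d} \<times> {-1..int d})"
      by (intro image_eqI[of _ _ "(i, j, k)"]) auto
  qed
  then show ?thesis
    by (rule finite_subset) auto
qed

lemma F_max_le_lower_irregularity:
  assumes "-1 \<le> i" "i \<le> j" "j \<le> k" "k \<le> int d"
  shows "real (F_max X i j k) \<le> lower_irregularity d X * real (F_min X i j k)"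
proof -
  have "real (F_max X i j k) / real (F_min X i j k) \<le> lower_irregularity d X"
    unfolding lower_irregularity_def
    by (intro Max_ge lower_irregularity_set_finite) (use assms in blast)
  then show ?thesis
    using F_min_pos[OF assms] by (simp add: divide_le_eq)
qed

text \<open>When the number of intermediate faces depends on the three dimensions only, maximum and
  minimum coincide. Simplicial and cube complexes are shown to be lower-regular in this way.\<close>

lemma lower_regularI:
  assumes "\<And>i j k x z x' z'. -1 \<le> i \<Longrightarrow> i \<le> j \<Longrightarrow> j \<le> k \<Longrightarrow> x \<in> cells X i \<Longrightarrow> x' \<in> cells X i \<Longrightarrow>
      z \<in> cells X k \<Longrightarrow> z' \<in> cells X k \<Longrightarrow> x \<le> z \<Longrightarrow> x' \<le> z' \<Longrightarrow>
      card {y \<in> cells X j. x \<le> y \<and> y \<le> z} = card {y \<in> cells X j. x' \<le> y \<and> y \<le> z'}"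
  shows "lower_regular d X"
proof -
  have eq1: "real (F_max X i j k) / real (F_min X i j k) = 1"
    if ijk: "-1 \<le> i" "i \<le> j" "j \<le> k" "k \<le> int d" for i j k
  proof -
    have "F_max X i j k \<in> between_counts X i j k" "F_min X i j k \<in> between_counts X i j k"
      unfolding F_max_def F_min_def using ijk
      using between_counts_nonempty[of i k j] by (auto intro!: Max_in Min_in between_counts_finite)
    then have "F_max X i j k = F_min X i j k"
      unfolding between_counts_def
    proof (elim CollectE exE conjE)
      fix x z x' z'
      assume "F_max X i j k = card {y \<in> cells X j. x \<le> y \<and> y \<le> z}"
        "F_min X i j k = card {y \<in> cells X j. x' \<le> y \<and> y \<le> z'}"
        "x \<in> cells X i" "z \<in> cells X k" "x \<le> z" "x' \<in> cells X i" "z' \<in> cells X k" "x' \<le> z'"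
      then show ?thesis
        using assms[OF ijk(1-3), of x x' z z'] by simp
    qed
    then show ?thesis
      using F_min_pos[OF ijk] by simp
  qed
  have "{real (F_max X i j k) / real (F_min X i j k) | i j k.
      -1 \<le> i \<and> i \<le> j \<and> j \<le> k \<and> k \<le> int d} = {1}" (is "?S = _")
  proof (intro equalityI subsetI)
    fix r :: real assume "r \<in> {1}"
    then have "r = real (F_max X (-1) (-1) (-1)) / real (F_min X (-1) (-1) (-1))"
      using eq1[of "-1" "-1" "-1"] by simp
    then show "r \<in> ?S"
      by (intro CollectI exI[of _ "-1"]) simp
  qed (use eq1 in blast)
  then show ?thesis
    by (simp add: lower_regular_def lower_irregularity_def)
qed

text \<open>Both sides count the pairs \<open>v \<le> x\<close> below \<open>y\<close>. The identity
  later ties \<open>link_scale\<close> to face numbers.\<close>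

lemma double_count_subfaces:
  assumes "y \<in> faces X"
  shows "(\<Sum>x \<in> subfaces X y i. card (subfaces X x p)) =
    (\<Sum>v \<in> subfaces X y p. card {x \<in> cells X i. v \<le> x \<and> x \<le> y})"
proof -
  have fin: "finite (subfaces X y p)" "finite (subfaces X y i)"
    by (auto simp: subfaces_def)
  have "(\<Sum>x \<in> subfaces X y i. card (subfaces X x p)) =
      (\<Sum>x \<in> subfaces X y i. \<Sum>v \<in> {v \<in> subfaces X y p. v \<le> x}. 1)"
    by (intro sum.cong) (auto simp: subfaces_def intro!: arg_cong[of _ _ card] intro: order_trans)
  also have "\<dots> = (\<Sum>v \<in> subfaces X y p. \<Sum>x \<in> {x \<in> subfaces X y i. v \<le> x}. 1)"
    by (rule sum.swap_restrict[OF fin(2,1)])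
  also have "\<dots> = (\<Sum>v \<in> subfaces X y p. card {x \<in> cells X i. v \<le> x \<and> x \<le> y})"
    by (intro sum.cong) (auto simp: subfaces_def intro!: arg_cong[of _ _ card])
  finally show ?thesis .
qed

end

section \<open>Comparison of link weights with weights of the complex\<close>

section \<open>Weights of links\<close>

locale weighted_dposet = dposet d X for d and X :: "('a::order) gposet" +
  fixes w :: "'a \<Rightarrow> real" and L :: real
  assumes proper: "proper_weight d X w"
    and irregularity: "lower_irregularity d X \<le> L"
begin

lemma w_pos: "x \<in> faces X \<Longrightarrow> 0 < w x"
  using proper by (simp add: proper_weight_def)

lemma w_cells_nonneg: "x \<in> cells X i \<Longrightarrow> 0 \<le> w x"
  using w_pos cells_faces by (metis order_less_imp_le)

lemma sum_w_nonneg: "B \<subseteq> cells X i \<Longrightarrow> 0 \<le> sum w B"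
  using w_cells_nonneg by (intro sum_nonneg) blast

lemma w_eq: "x \<in> cells X i \<Longrightarrow>
    w x = (\<Sum>y \<in> {y \<in> cells X (int d). x \<le> y}. w y / real (card (subfaces X y i)))"
  using proper by (simp add: proper_weight_def)

lemma F_max_le:
  assumes "-1 \<le> i" "i \<le> j" "j \<le> k" "k \<le> int d"
  shows "real (F_max X i j k) \<le> L * real (F_min X i j k)"
  using F_max_le_lower_irregularity[OF assms] irregularity
    mult_right_mono[OF irregularity, of "real (F_min X i j k)"] by simp

lemma L_ge_1: "1 \<le> L"
proof -
  have "real (F_min X (-1) (-1) (-1)) \<le> L * real (F_min X (-1) (-1) (-1))"
    using F_max_le[of "-1" "-1" "-1"] F_min_le_F_max[of "-1" "-1" "-1"] by simp
  then show ?thesis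
    using F_min_pos[of "-1" "-1" "-1"] by simp
qed

text \<open>Common core of the weight estimates: \<open>w\<close> and the link weights both divide
  the weight of each top face by a number of faces, of which only bounds are known.\<close>

lemma sum_tops_bounds:
  fixes N :: "'a \<Rightarrow> nat"
  assumes "\<And>y. y \<in> cells X (int d) \<Longrightarrow> x \<le> y \<Longrightarrow> m \<le> N y \<and> N y \<le> M" "0 < m"
  defines "S \<equiv> sum w {y \<in> cells X (int d). x \<le> y}"
  defines "T \<equiv> (\<Sum>y \<in> {y \<in> cells X (int d). x \<le> y}. w y / real (N y))"
  shows "S / real M \<le> T" "T \<le> S / real m"
proof -
  show "S / real M \<le> T"
    unfolding S_def T_def sum_divide_distrib using assms(1,2) w_cells_nonneg
    by (intro sum_mono divide_left_mono mult_pos_pos) fastforce+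
  show "T \<le> S / real m"
    unfolding S_def T_def sum_divide_distrib using assms(1,2) w_cells_nonneg
    by (intro sum_mono divide_left_mono mult_pos_pos) fastforce+
qed

lemma w_bounds:
  assumes "x \<in> cells X i" "-1 \<le> i" "i \<le> int d"
  defines "S \<equiv> sum w {y \<in> cells X (int d). x \<le> y}"
  shows "S / real (F_max X (-1) i (int d)) \<le> w x" "w x \<le> S / real (F_min X (-1) i (int d))"
  using sum_tops_bounds[of x "F_min X (-1) i (int d)" "\<lambda>y. card (subfaces X y i)"
      "F_max X (-1) i (int d)"]
    F_min_pos[of "-1" i "int d"] card_subfaces_le[of _ "int d" i] card_subfaces_ge[of _ "int d" i]
    assms w_eq[OF assms(1)] by auto

lemma tops_pos:
  assumes "u \<in> faces X"
  shows "0 < sum w {y \<in> cells X (int d). u \<le> y}"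
  using ex_top_face[OF assms] w_pos cells_faces by (intro sum_pos) auto

text \<open>Conversion factor between weights in \<open>X\<close> and in the link of a
  \<open>p\<close>-face. In a lower-regular poset it is the reciprocal of the number of
  \<open>p\<close>-faces of an \<open>i\<close>-face. Minima and maxima are placed so that the lower
  bound on link weights has no loss and the upper bound carries all of it.\<close>

definition link_scale :: "int \<Rightarrow> int \<Rightarrow> real" where
  "link_scale p i = real (F_min X (-1) i (int d)) /
    (real (F_max X (-1) p (int d)) * real (F_max X p i (int d)))"

lemma link_scale_pos:
  assumes "-1 \<le> p" "p \<le> i" "i \<le> int d"
  shows "0 < link_scale p i"
  using F_min_pos[of "-1" i "int d"] F_min_pos[of "-1" p "int d"] F_min_pos[of p i "int d"]
    F_min_le_F_max[of "-1" p "int d"] F_min_le_F_max[of p i "int d"] assms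
  by (auto simp: link_scale_def)

text \<open>The link weight is \<open>T / U\<close>, and each of \<open>T\<close>,
  \<open>w x\<close> and \<open>w u\<close> lies between a weight of top faces divided by a maximal
  count and the same weight divided by the minimal count. Three quotients of counts remain in the
  upper bound, each at most \<open>L\<close>.\<close>

lemma link_weight_bounds:
  assumes u: "u \<in> cells X p" and x: "x \<in> cells X i" "u \<le> x"
    and pi: "-1 \<le> p" "p \<le> i" "i \<le> int d"
  shows "link_scale p i * w x \<le> link_weight d X w u x * w u"
    "link_weight d X w u x * w u \<le> link_scale p i * L ^ 3 * w x"
proof -
  define U where "U = sum w {y \<in> cells X (int d). u \<le> y}"
  define S where "S = sum w {y \<in> cells X (int d). x \<le> y}"
  define T where "T = (\<Sum>y \<in> {y \<in> cells X (int d). x \<le> y}.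
      w y / real (card {x' \<in> cells X i. u \<le> x' \<and> x' \<le> y}))"
  define mi Mi mp Mp m M where "mi = real (F_min X (-1) i (int d))"
    and "Mi = real (F_max X (-1) i (int d))" and "mp = real (F_min X (-1) p (int d))"
    and "Mp = real (F_max X (-1) p (int d))" and "m = real (F_min X p i (int d))"
    and "M = real (F_max X p i (int d))"
  note defs = mi_def Mi_def mp_def Mp_def m_def M_def
  have U: "0 < U" and S: "0 < S"
    unfolding U_def S_def using tops_pos u x cells_faces by blast+
  have pos: "0 < mi" "0 < mp" "0 < m" "mi \<le> Mi" "mp \<le> Mp" "m \<le> M"
    unfolding defs using F_min_pos[of "-1" i "int d"] F_min_pos[of "-1" p "int d"]
      F_min_pos[of p i "int d"] F_min_le_F_max[of "-1" i "int d"] F_min_le_F_max[of "-1" p "int d"]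
      F_min_le_F_max[of p i "int d"] pi by auto
  have ratio: "Mi \<le> L * mi" "Mp \<le> L * mp" "M \<le> L * m"
    unfolding defs using F_max_le pi by auto
  have lw: "link_weight d X w u x = T / U"
    using cells_gdim[OF x(1)] by (simp add: link_weight_def T_def U_def)
  have T: "S / M \<le> T" "T \<le> S / m"
    unfolding S_def T_def m_def M_def
    using sum_tops_bounds[of x "F_min X p i (int d)"
        "\<lambda>y. card {x' \<in> cells X i. u \<le> x' \<and> x' \<le> y}" "F_max X p i (int d)"]
      F_min_pos[of p i "int d"] F_min_le_count[OF u] count_le_F_max[OF u] x(2) pi
    by (auto intro: order_trans)
  have wx: "S / Mi \<le> w x" "w x \<le> S / mi"
    unfolding S_def mi_def Mi_def using w_bounds[OF x(1)] pi by auto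
  have wu: "U / Mp \<le> w u" "w u \<le> U / mp"
    unfolding U_def mp_def Mp_def using w_bounds[OF u] pi by auto
  have T0: "0 \<le> T"
    by (rule order_trans[OF _ T(1)]) (use S pos in auto)
  have "link_scale p i * w x \<le> mi / (Mp * M) * (S / mi)"
    unfolding link_scale_def defs[symmetric] using wx(2) pos by (intro mult_left_mono) auto
  also have "\<dots> = S / M * ((U / Mp) / U)"
    using pos U by simp
  also have "\<dots> \<le> T * (w u / U)"
    using T(1) T0 wu(1) pos S U by (intro mult_mono divide_right_mono) auto
  finally show "link_scale p i * w x \<le> link_weight d X w u x * w u"
    unfolding lw by simp
  have wu0: "0 \<le> w u"
    using w_cells_nonneg[OF u] .
  have "link_weight d X w u x * w u = T * (w u / U)"
    unfolding lw by simp
  also have "\<dots> \<le> S / m * ((U / mp) / U)"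
    using T wu S U pos T0 wu0 by (intro mult_mono divide_right_mono) auto
  also have "\<dots> = S / (m * mp)"
    using U by simp
  also have "\<dots> \<le> (Mi * w x) / (m * mp)"
    using wx(1) pos by (intro divide_right_mono) (auto simp: field_simps)
  also have "\<dots> \<le> (L * mi * w x) / (m * mp)"
    using ratio(1) pos w_cells_nonneg[OF x(1)] by (intro divide_right_mono mult_right_mono) auto
  \<comment> \<open>The fraction is expanded by \<open>L ^ 2\<close>, so that
    \<open>M \<le> L * m\<close> and \<open>Mp \<le> L * mp\<close> can put the maxima of
    \<open>link_scale\<close> into the denominator.\<close>
  also have "\<dots> = (L * mi * w x * L ^ 2) / ((L * m) * (L * mp))"
    using pos L_ge_1 by (simp add: field_simps power2_eq_square)
  also have "\<dots> \<le> (L * mi * w x * L ^ 2) / (M * Mp)"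
    using ratio pos w_cells_nonneg[OF x(1)] L_ge_1
    by (intro divide_left_mono mult_mono mult_pos_pos mult_nonneg_nonneg) auto
  also have "\<dots> = link_scale p i * L ^ 3 * w x"
    unfolding link_scale_def defs[symmetric] by (simp add: power2_eq_square power3_eq_cube field_simps)
  finally show "link_weight d X w u x * w u \<le> link_scale p i * L ^ 3 * w x" .
qed

text \<open>Pairs of a \<open>p\<close>-face and an \<open>i\<close>-face above it, both below one
  fixed top face, are counted by either member. The result compares the product of the numbers of
  \<open>i\<close>-faces of a top face and of \<open>p\<close>-faces of an \<open>i\<close>-face
  with the product in the denominator of \<open>link_scale\<close>.\<close>

lemma link_scale_le:
  assumes "-1 \<le> p" "p \<le> i" "i \<le> int d"
  shows "link_scale p i * real (F_min X (-1) p i) \<le> 1"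
    "1 \<le> link_scale p i * L ^ 3 * real (F_max X (-1) p i)"
proof -
  define mi Mi mp Mp m M where "mi = real (F_min X (-1) i (int d))"
    and "Mi = real (F_max X (-1) i (int d))" and "mp = real (F_min X (-1) p (int d))"
    and "Mp = real (F_max X (-1) p (int d))" and "m = real (F_min X p i (int d))"
    and "M = real (F_max X p i (int d))"
  note defs = mi_def Mi_def mp_def Mp_def m_def M_def
  have pos: "0 < mi" "0 < mp" "0 < m" "mi \<le> Mi" "mp \<le> Mp" "m \<le> M"
    unfolding defs using F_min_pos[of "-1" i "int d"] F_min_pos[of "-1" p "int d"]
      F_min_pos[of p i "int d"] F_min_le_F_max[of "-1" i "int d"] F_min_le_F_max[of "-1" p "int d"]
      F_min_le_F_max[of p i "int d"] assms by auto
  have ratio: "Mi \<le> L * mi" "Mp \<le> L * mp" "M \<le> L * m"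
    unfolding defs using F_max_le assms by auto
  obtain y where y: "y \<in> cells X (int d)"
    using ex_top_face[OF empty_face_in_faces] by blast
  let ?A = "\<Sum>x \<in> subfaces X y i. card (subfaces X x p)"
  let ?B = "\<Sum>v \<in> subfaces X y p. card {x \<in> cells X i. v \<le> x \<and> x \<le> y}"
  have AB: "?A = ?B"
    using double_count_subfaces[OF cells_faces[OF y]] .
  have xi: "x \<in> cells X i" if "x \<in> subfaces X y i" for x i
    using that by (simp add: subfaces_def)
  have vy: "v \<le> y" if "v \<in> subfaces X y p" for v
    using that by (simp add: subfaces_def)
  have "card (subfaces X y i) * F_min X (-1) p i \<le> ?A"
    using sum_bounded_below[of "subfaces X y i" "F_min X (-1) p i"] card_subfaces_ge[OF xi] by simp
  then have "F_min X (-1) i (int d) * F_min X (-1) p i \<le> ?A"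
    using card_subfaces_ge[OF y, of i] by (meson mult_le_mono1 order_trans)
  moreover have "?B \<le> card (subfaces X y p) * F_max X p i (int d)"
    using sum_bounded_above[of "subfaces X y p" _ "F_max X p i (int d)"]
      count_le_F_max[OF xi y vy] by simp
  then have "?B \<le> F_max X (-1) p (int d) * F_max X p i (int d)"
    using card_subfaces_le[OF y, of p] by (meson mult_le_mono1 order_trans)
  ultimately have "F_min X (-1) i (int d) * F_min X (-1) p i \<le>
      F_max X (-1) p (int d) * F_max X p i (int d)"
    using AB by linarith
  then have "mi * real (F_min X (-1) p i) \<le> Mp * M"
    unfolding defs by (metis of_nat_le_iff of_nat_mult)
  then show "link_scale p i * real (F_min X (-1) p i) \<le> 1"
    unfolding link_scale_def defs[symmetric] using pos by (simp add: divide_le_eq)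
  have "card (subfaces X y p) * F_min X p i (int d) \<le> ?B"
    using sum_bounded_below[of "subfaces X y p" "F_min X p i (int d)"]
      F_min_le_count[OF xi y vy] by simp
  then have "F_min X (-1) p (int d) * F_min X p i (int d) \<le> ?B"
    using card_subfaces_ge[OF y, of p] by (meson mult_le_mono1 order_trans)
  moreover have "?A \<le> card (subfaces X y i) * F_max X (-1) p i"
    using sum_bounded_above[of "subfaces X y i" _ "F_max X (-1) p i"] card_subfaces_le[OF xi]
    by simp
  then have "?A \<le> F_max X (-1) i (int d) * F_max X (-1) p i"
    using card_subfaces_le[OF y, of i] by (meson mult_le_mono1 order_trans)
  ultimately have "F_min X (-1) p (int d) * F_min X p i (int d) \<le>
      F_max X (-1) i (int d) * F_max X (-1) p i"
    using AB by linarith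
  then have F: "mp * m \<le> Mi * real (F_max X (-1) p i)"
    unfolding defs by (metis of_nat_le_iff of_nat_mult)
  have "Mp * M \<le> (L * mp) * (L * m)"
    using ratio pos L_ge_1 by (intro mult_mono) auto
  also have "\<dots> = L ^ 2 * (mp * m)"
    by (simp add: power2_eq_square)
  also have "\<dots> \<le> L ^ 2 * (Mi * real (F_max X (-1) p i))"
    using F by (intro mult_left_mono) auto
  also have "\<dots> \<le> L ^ 2 * (L * mi * real (F_max X (-1) p i))"
    using ratio by (intro mult_left_mono mult_right_mono) auto
  also have "\<dots> = mi * L ^ 3 * real (F_max X (-1) p i)"
    by (simp add: power2_eq_square power3_eq_cube)
  finally show "1 \<le> link_scale p i * L ^ 3 * real (F_max X (-1) p i)"
    unfolding link_scale_def defs[symmetric] using pos by (simp add: le_divide_eq)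
qed

text \<open>Each top face above \<open>u\<close> spreads its weight evenly over its
  \<open>i\<close>-faces above \<open>u\<close>. Interchanging the sums recovers the total weight of
  these top faces, by which the link weight is normalised.\<close>

lemma link_weight_sum:
  assumes u: "u \<in> cells X p" and pi: "-1 \<le> p" "p \<le> i" "i \<le> int d"
  shows "(\<Sum>x \<in> {x \<in> cells X i. u \<le> x}. link_weight d X w u x) = 1"
proof -
  let ?Y = "{y \<in> cells X (int d). u \<le> y}"
  let ?N = "\<lambda>y. card {x' \<in> cells X i. u \<le> x' \<and> x' \<le> y}"
  have "(\<Sum>x \<in> {x \<in> cells X i. u \<le> x}. link_weight d X w u x)
      = (\<Sum>x \<in> {x \<in> cells X i. u \<le> x}.
          1 / sum w ?Y * (\<Sum>y \<in> {y \<in> ?Y. x \<le> y}. w y / real (?N y)))"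
    using cells_gdim
    by (intro sum.cong refl) (auto simp: link_weight_def intro!: sum.cong intro: order_trans)
  also have "\<dots> = 1 / sum w ?Y * (\<Sum>y \<in> ?Y. \<Sum>x \<in> {x \<in> {x \<in> cells X i. u \<le> x}. x \<le> y}.
      w y / real (?N y))"
    unfolding sum_distrib_left[symmetric]
    by (subst sum.swap_restrict) auto
  also have "\<dots> = 1 / sum w ?Y * sum w ?Y"
  proof (intro arg_cong2[of _ _ _ _ "(*)"] sum.cong refl)
    fix y assume y: "y \<in> ?Y"
    then have "0 < ?N y"
      using F_min_pos[of p i "int d"] F_min_le_count[OF u, of y "int d" i] pi by auto
    moreover have "{x \<in> {x \<in> cells X i. u \<le> x}. x \<le> y} = {x \<in> cells X i. u \<le> x \<and> x \<le> y}"
      by auto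
    ultimately show "(\<Sum>x \<in> {x \<in> {x \<in> cells X i. u \<le> x}. x \<le> y}. w y / real (?N y)) = w y"
      by (auto simp: card_gt_0_iff)
  qed
  also have "\<dots> = 1"
    using tops_pos[of u] u cells_faces by simp
  finally show ?thesis .
qed

text \<open>In the dimension of \<open>u\<close> the link consists of \<open>u\<close> alone, which
  therefore carries the total weight 1. A nonzero (-1)-cochain of the link thus has norm 1.\<close>

lemma link_weight_self:
  assumes u: "u \<in> cells X p"
  shows "link_weight d X w u u = 1"
proof -
  have p: "-1 \<le> p" "p \<le> int d"
    using u gdim_ge gdim_le cells_faces cells_gdim by metis+
  have "{x \<in> cells X p. u \<le> x} = {u}"
    using eq_of_same_gdim[OF u] u by auto
  then show ?thesis
    using link_weight_sum[OF u p(1) order_refl p(2)] by simp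
qed

lemma sum_w_cells:
  assumes "-1 \<le> i" "i \<le> int d"
  shows "sum w (cells X i) = 1"
proof -
  have "sum w (cells X i) = (\<Sum>x \<in> cells X i. \<Sum>y \<in> {y \<in> cells X (int d). x \<le> y}.
      w y / real (card (subfaces X y i)))"
    using w_eq by (intro sum.cong) auto
  also have "\<dots> = (\<Sum>y \<in> cells X (int d). \<Sum>x \<in> {x \<in> cells X i. x \<le> y}.
      w y / real (card (subfaces X y i)))"
    by (subst sum.swap_restrict) auto
  also have "\<dots> = sum w (cells X (int d))"
  proof (intro sum.cong refl)
    fix y assume y: "y \<in> cells X (int d)"
    then have "0 < card (subfaces X y i)"
      using F_min_pos[of "-1" i "int d"] card_subfaces_ge[OF y, of i] assms by auto
    then show "(\<Sum>x \<in> {x \<in> cells X i. x \<le> y}. w y / real (card (subfaces X y i))) = w y"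
      by (auto simp: subfaces_def card_gt_0_iff)
  qed
  also have "\<dots> = 1"
    using proper unfolding proper_weight_def by blast
  finally show ?thesis .
qed

lemma link_weight_nonneg: "0 \<le> link_weight d X w u x"
  unfolding link_weight_def using w_cells_nonneg
  by (intro mult_nonneg_nonneg sum_nonneg divide_nonneg_nonneg) auto

lemma link_weight_sum_le:
  assumes u: "u \<in> cells X p" and pi: "-1 \<le> p" "p \<le> i" "i \<le> int d"
    and S: "S \<subseteq> {x \<in> cells X i. u \<le> x}"
  shows "sum (link_weight d X w u) S * w u \<le> link_scale p i * L ^ 3 * sum w S"
    "link_scale p i * sum w S \<le> sum (link_weight d X w u) S * w u"
  unfolding sum_distrib_right sum_distrib_left
  using S link_weight_bounds[OF u _ _ pi] by (auto intro!: sum_mono)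

text \<open>Dividing by \<open>link_scale\<close> costs \<open>L ^ 3\<close> and a face count, by
  the lower bound on it.\<close>

lemma sum_w_le_of_scaled:
  assumes "-1 \<le> p" "p \<le> i" "i \<le> int d" "S \<subseteq> cells X i" "link_scale p i * sum w S \<le> c"
  shows "sum w S \<le> L ^ 3 * real (F_max X (-1) p i) * c"
proof -
  have "1 * sum w S \<le> link_scale p i * L ^ 3 * real (F_max X (-1) p i) * sum w S"
    using link_scale_le(2)[OF assms(1-3)] sum_w_nonneg[OF assms(4)] by (intro mult_right_mono)
  also have "\<dots> = L ^ 3 * real (F_max X (-1) p i) * (link_scale p i * sum w S)"
    by simp
  also have "\<dots> \<le> L ^ 3 * real (F_max X (-1) p i) * c"
    using assms(5) L_ge_1 by (intro mult_left_mono) auto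
  finally show ?thesis by simp
qed

lemma sum_w_link_swap:
  assumes fin: "finite A" "A \<subseteq> cells X i" and V: "V \<subseteq> cells X p"
  shows "(\<Sum>v \<in> V. sum w {e \<in> A. v \<le> e}) = (\<Sum>e \<in> A. real (card {v \<in> V. v \<le> e}) * w e)"
proof -
  have "finite V"
    using V finite_cells finite_subset by blast
  then show ?thesis
    using sum.swap_restrict[of V A "\<lambda>_ e. w e" "\<lambda>v e. v \<le> e"] fin by simp
qed

end

section \<open>Weights of the three kinds of bad triangles\<close>

section \<open>Heavy vertices\<close>

lemma sum_UN_le:
  fixes f :: "'b \<Rightarrow> real"
  assumes "finite I" "\<And>i. i \<in> I \<Longrightarrow> finite (A i)" "\<And>i x. i \<in> I \<Longrightarrow> x \<in> A i \<Longrightarrow> 0 \<le> f x"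
  shows "sum f (\<Union>i \<in> I. A i) \<le> (\<Sum>i \<in> I. sum f (A i))"
  using assms
proof (induction I rule: finite_induct)
  case (insert j I)
  have "0 \<le> sum f (A j \<inter> (\<Union>i \<in> I. A i))"
    using insert.prems(2) by (intro sum_nonneg) auto
  then have "sum f (\<Union>i \<in> insert j I. A i) \<le> sum f (A j) + sum f (\<Union>i \<in> I. A i)"
    using sum.union_inter[of "A j" "\<Union>i \<in> I. A i" f] insert.prems(1) insert.hyps(1) by simp
  then show ?case
    using insert by force
qed simp

text \<open>The way in which the thresholds h enter: on sets of weight at most \<open>h\<close>,
  skeleton expansion becomes linear with coefficient \<open>\<alpha> + \<beta> * h\<close>.\<close>

lemma linear_plus_quadratic_le:
  fixes s :: real
  assumes "0 \<le> s" "s \<le> h" "0 \<le> \<beta>"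
  shows "\<alpha> * s + \<beta> * s\<^sup>2 \<le> (\<alpha> + \<beta> * h) * s"
  using mult_left_mono[OF mult_right_mono[OF assms(2,1)] assms(3)]
  by (simp add: algebra_simps power2_eq_square)

context dposet
begin

text \<open>Dimensions in the link of a \<open>p\<close>-face drop by \<open>p + 1\<close>: the face
  itself becomes the empty face.\<close>

lemma cells_link:
  "u \<in> cells X p \<Longrightarrow> cells (link X u) i = {x \<in> cells X (i + p + 1). u \<le> x}"
  by (auto simp: cells_def link_def)

end

text \<open>The estimates are purely combinatorial and hold for any set of edges. It will be the
  support of df, and for the cocycle distance the set of edges with two vertices in the support of a
  cocycle.\<close>

locale edge_set = weighted_dposet d X w L for d and X :: "('a::order) gposet" and w L +
  fixes A :: "'a set" and h\<^sub>0 :: real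
  assumes d_ge: "2 \<le> d" and A: "A \<subseteq> cells X 1" and h\<^sub>0: "0 < h\<^sub>0"
begin

definition star :: "'a \<Rightarrow> 'a set" where
  "star v = {e \<in> A. v \<le> e}"

definition heavy :: "'a set" where
  "heavy = {v \<in> cells X 0. h\<^sub>0 \<le> sum (link_weight d X w v) (star v)}"

definition light_triangles :: "'a set" where
  "light_triangles = {z \<in> cells X 2. \<exists>v \<in> cells X 0 - heavy.
      \<exists>e \<in> star v. \<exists>e' \<in> star v. e \<noteq> e' \<and> e \<le> z \<and> e' \<le> z}"

definition heavy_edges :: "'a set" where
  "heavy_edges = {e \<in> A. \<exists>u \<in> heavy. \<exists>v \<in> heavy. u \<noteq> v \<and> u \<le> e \<and> v \<le> e}"

definition heavy_triangles :: "'a set" where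
  "heavy_triangles = {z \<in> cells X 2. \<exists>e \<in> heavy_edges. e \<le> z}"

definition disjoint_triangles :: "'a set" where
  "disjoint_triangles = {z \<in> cells X 2. \<exists>e \<in> A. \<exists>e' \<in> A. e \<noteq> e' \<and> e < z \<and> e' < z
      \<and> max_lower_bounds X {e, e'} = {empty_face X}}"

lemma finite_A: "finite A"
  using A finite_cells finite_subset by blast

lemma heavy_cells: "heavy \<subseteq> cells X 0"
  by (auto simp: heavy_def)

lemma finite_heavy: "finite heavy"
  using heavy_cells finite_cells finite_subset by blast

lemma star_subset: "star v \<subseteq> {e \<in> cells X 1. v \<le> e}"
  using A by (auto simp: star_def)

lemma sum_star_le:
  assumes "V \<subseteq> cells X 0"
  shows "(\<Sum>v \<in> V. sum w (star v)) \<le> real (F_max X (-1) 0 1) * sum w A"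
proof -
  have "(\<Sum>v \<in> V. sum w (star v)) = (\<Sum>e \<in> A. real (card {v \<in> V. v \<le> e}) * w e)"
    unfolding star_def by (rule sum_w_link_swap[OF finite_A A assms])
  also have "\<dots> \<le> (\<Sum>e \<in> A. real (F_max X (-1) 0 1) * w e)"
  proof (intro sum_mono mult_right_mono)
    fix e assume e: "e \<in> A"
    then have "card {v \<in> V. v \<le> e} \<le> card (subfaces X e 0)"
      using assms by (intro card_mono) (auto simp: subfaces_def)
    then show "real (card {v \<in> V. v \<le> e}) \<le> real (F_max X (-1) 0 1)"
      using card_subfaces_le[of e 1 0] e A by (auto intro: order_trans)
    show "0 \<le> w e"
      using e A w_cells_nonneg by blast
  qed
  finally show ?thesis
    by (simp add: sum_distrib_left)
qed

text \<open>Replacing the maximal count by \<open>L\<close> times the minimal one lets the latter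
  cancel the scale, so sums over stars cost powers of \<open>L\<close> but no face number.\<close>

lemma link_scale_01_F_max:
  "link_scale 0 1 * L ^ 3 * real (F_max X (-1) 0 1) \<le> L ^ 4"
proof -
  have "link_scale 0 1 * L ^ 3 * real (F_max X (-1) 0 1)
      \<le> link_scale 0 1 * L ^ 3 * (L * real (F_min X (-1) 0 1))"
    using F_max_le[of "-1" 0 1] link_scale_pos[of 0 1] L_ge_1 d_ge by (intro mult_left_mono) auto
  also have "\<dots> = L ^ 4 * (link_scale 0 1 * real (F_min X (-1) 0 1))"
    by (simp add: eval_nat_numeral)
  also have "\<dots> \<le> L ^ 4 * 1"
    using link_scale_le(1)[of 0 1] L_ge_1 d_ge by (intro mult_left_mono) auto
  finally show ?thesis by simp
qed

lemma scaled_sum_star_le: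
  assumes "V \<subseteq> cells X 0"
  shows "link_scale 0 1 * L ^ 3 * (\<Sum>v \<in> V. sum w (star v)) \<le> L ^ 4 * sum w A"
proof -
  have "link_scale 0 1 * L ^ 3 * (\<Sum>v \<in> V. sum w (star v))
      \<le> link_scale 0 1 * L ^ 3 * (real (F_max X (-1) 0 1) * sum w A)"
    using sum_star_le[OF assms] link_scale_pos[of 0 1] L_ge_1 d_ge by (intro mult_left_mono) auto
  also have "\<dots> \<le> L ^ 4 * sum w A"
    using mult_right_mono[OF link_scale_01_F_max sum_w_nonneg[OF A]] by (simp add: mult.assoc)
  finally show ?thesis .
qed

text \<open>Markov's inequality: \<open>h\<^sub>0 * w v\<close> is at most the scaled weight of the
  star of a heavy vertex, and the stars together are bounded by \<open>A\<close>.\<close>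

lemma heavy_weight: "h\<^sub>0 * sum w heavy \<le> L ^ 4 * sum w A"
proof -
  have "h\<^sub>0 * sum w heavy = (\<Sum>v \<in> heavy. h\<^sub>0 * w v)"
    by (simp add: sum_distrib_left)
  also have "\<dots> \<le> (\<Sum>v \<in> heavy. link_scale 0 1 * L ^ 3 * sum w (star v))"
  proof (rule sum_mono)
    fix v assume v: "v \<in> heavy"
    then have "h\<^sub>0 * w v \<le> sum (link_weight d X w v) (star v) * w v"
      using w_cells_nonneg by (intro mult_right_mono) (auto simp: heavy_def)
    also have "\<dots> \<le> link_scale 0 1 * L ^ 3 * sum w (star v)"
      using v heavy_cells d_ge star_subset by (intro link_weight_sum_le(1)) auto
    finally show "h\<^sub>0 * w v \<le> link_scale 0 1 * L ^ 3 * sum w (star v)" .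
  qed
  also have "\<dots> \<le> L ^ 4 * sum w A"
    using scaled_sum_star_le[OF heavy_cells] by (simp add: sum_distrib_left)
  finally show ?thesis .
qed

text \<open>At a light vertex the star has link weight below \<open>h\<^sub>0\<close>, so skeleton
  expansion of the link is linear there, and the sum over light vertices reduces to the sum over
  stars. The power \<open>L ^ 7\<close> is \<open>L ^ 4\<close> from the stars times
  \<open>L ^ 3\<close> from removing the scale.\<close>

lemma light_triangles_weight:
  assumes exp: "\<And>v. v \<in> cells X 0 \<Longrightarrow> Gr_skeleton_expander (link X v) (link_weight d X w v) \<alpha> \<beta>"
    and nonneg: "0 \<le> \<alpha>" "0 \<le> \<beta>"
  shows "sum w light_triangles \<le> L ^ 7 * real (F_max X (-1) 0 2) * (\<alpha> + \<beta> * h\<^sub>0) * sum w A"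
proof -
  define Z where "Z v = {z \<in> cells X 2. v \<le> z \<and>
      (\<exists>e \<in> star v. \<exists>e' \<in> star v. e \<noteq> e' \<and> e < z \<and> e' < z)}" for v
  have l2: "0 < link_scale 0 2" and l1: "0 < link_scale 0 1"
    using link_scale_pos d_ge by auto
  have Zw: "link_scale 0 2 * sum w (Z v) \<le> (\<alpha> + \<beta> * h\<^sub>0) * (link_scale 0 1 * L ^ 3 * sum w (star v))"
    if v: "v \<in> cells X 0 - heavy" for v
  proof -
    let ?s = "sum (link_weight d X w v) (star v)"
    have s: "0 \<le> ?s" "?s \<le> h\<^sub>0"
      using v by (auto simp: heavy_def intro: sum_nonneg link_weight_nonneg)
    have g: "sum (link_weight d X w v) (Z v) \<le> \<alpha> * ?s + \<beta> * ?s\<^sup>2"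
    proof -
      have "star v \<subseteq> cells (link X v) 0"
        using v star_subset[of v] by (auto simp: cells_link)
      moreover have "{z \<in> cells (link X v) 1. \<exists>x \<in> star v. \<exists>y \<in> star v. x \<noteq> y \<and> x < z \<and> y < z} = Z v"
        using v by (auto simp: cells_link Z_def)
      ultimately show ?thesis
        using exp[of v] v unfolding Gr_skeleton_expander_def by auto
    qed
    have "link_scale 0 2 * sum w (Z v) \<le> sum (link_weight d X w v) (Z v) * w v"
      using v d_ge by (intro link_weight_sum_le(2)) (auto simp: Z_def)
    also have "\<dots> \<le> (\<alpha> + \<beta> * h\<^sub>0) * ?s * w v"
      using order_trans[OF g linear_plus_quadratic_le[OF s nonneg(2)]] v w_cells_nonneg
      by (intro mult_right_mono) auto
    also have "(\<alpha> + \<beta> * h\<^sub>0) * ?s * w v = (\<alpha> + \<beta> * h\<^sub>0) * (?s * w v)"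
      by simp
    also have "\<dots> \<le> (\<alpha> + \<beta> * h\<^sub>0) * (link_scale 0 1 * L ^ 3 * sum w (star v))"
      using v d_ge star_subset nonneg h\<^sub>0
      by (intro mult_left_mono link_weight_sum_le(1)) auto
    finally show ?thesis .
  qed
  have "light_triangles \<subseteq> (\<Union>v \<in> cells X 0 - heavy. Z v)"
  proof
    fix z assume "z \<in> light_triangles"
    then obtain v e e' where z: "z \<in> cells X 2" and v: "v \<in> cells X 0 - heavy"
      and e: "e \<in> star v" "e' \<in> star v" "e \<noteq> e'" "e \<le> z" "e' \<le> z"
      by (auto simp: light_triangles_def)
    have "e < z" "e' < z" "v \<le> z"
      using e z star_subset[of v] strictly_below_cells[of _ 1 z 2] by (auto intro: order_trans)
    then show "z \<in> (\<Union>v \<in> cells X 0 - heavy. Z v)"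
      using z v e by (auto simp: Z_def)
  qed
  then have "sum w light_triangles \<le> sum w (\<Union>v \<in> cells X 0 - heavy. Z v)"
    using w_cells_nonneg by (intro sum_mono2) (auto simp: Z_def)
  also have "\<dots> \<le> (\<Sum>v \<in> cells X 0 - heavy. sum w (Z v))"
    using w_cells_nonneg by (intro sum_UN_le) (auto simp: Z_def)
  finally have "link_scale 0 2 * sum w light_triangles
      \<le> (\<Sum>v \<in> cells X 0 - heavy. link_scale 0 2 * sum w (Z v))"
    using l2 by (simp add: sum_distrib_left[symmetric])
  also have "\<dots> \<le> (\<Sum>v \<in> cells X 0 - heavy. (\<alpha> + \<beta> * h\<^sub>0) * (link_scale 0 1 * L ^ 3 * sum w (star v)))"
    by (intro sum_mono Zw)
  also have "\<dots> = (\<alpha> + \<beta> * h\<^sub>0) * (link_scale 0 1 * L ^ 3 * (\<Sum>v \<in> cells X 0 - heavy. sum w (star v)))"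
    by (simp add: sum_distrib_left)
  also have "\<dots> \<le> (\<alpha> + \<beta> * h\<^sub>0) * (L ^ 4 * sum w A)"
    using nonneg h\<^sub>0 by (intro mult_left_mono scaled_sum_star_le) auto
  finally have main: "link_scale 0 2 * sum w light_triangles \<le> (\<alpha> + \<beta> * h\<^sub>0) * (L ^ 4 * sum w A)" .
  have "sum w light_triangles \<le> L ^ 3 * real (F_max X (-1) 0 2) * ((\<alpha> + \<beta> * h\<^sub>0) * (L ^ 4 * sum w A))"
    using main d_ge by (intro sum_w_le_of_scaled) (auto simp: light_triangles_def)
  also have "\<dots> = L ^ 7 * real (F_max X (-1) 0 2) * (\<alpha> + \<beta> * h\<^sub>0) * sum w A"
    by (simp add: eval_nat_numeral)
  finally show ?thesis .
qed

text \<open>The set of heavy vertices has weight at most \<open>h\<close>, so skeleton expansion of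
  \<open>X\<close> applied to it is linear and bounds the heavy edges. The division by
  \<open>h\<^sub>0\<close> comes from the Markov bound on its weight.\<close>

lemma heavy_triangles_weight:
  assumes exp: "Gr_skeleton_expander X w \<alpha> \<beta>"
    and nonneg: "0 \<le> \<alpha>" "0 \<le> \<beta>" and small: "L ^ 4 * sum w A \<le> h\<^sub>0 * h"
  shows "sum w heavy_triangles \<le> L ^ 7 * real (F_max X (-1) 1 2) * ((\<alpha> + \<beta> * h) / h\<^sub>0) * sum w A"
proof -
  define Z where "Z e = {z \<in> cells X 2. e \<le> z}" for e
  have l: "0 < link_scale 1 2"
    using link_scale_pos d_ge by auto
  have he: "heavy_edges \<subseteq> cells X 1"
    using A by (auto simp: heavy_edges_def)
  have fin: "finite heavy_edges"
    using he finite_cells finite_subset by blast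
  have Hh: "sum w heavy \<le> h"
    using heavy_weight small h\<^sub>0 by (meson mult_le_cancel_left_pos order_trans)
  have H0: "0 \<le> sum w heavy"
    by (rule sum_w_nonneg[OF heavy_cells])
  then have h: "0 \<le> h"
    using Hh by simp
  have "heavy_triangles = (\<Union>e \<in> heavy_edges. Z e)"
    by (auto simp: heavy_triangles_def Z_def)
  then have "sum w heavy_triangles \<le> (\<Sum>e \<in> heavy_edges. sum w (Z e))"
    using w_cells_nonneg fin by (auto simp: Z_def intro!: sum_UN_le)
  then have "link_scale 1 2 * sum w heavy_triangles \<le> (\<Sum>e \<in> heavy_edges. link_scale 1 2 * sum w (Z e))"
    using l by (simp add: sum_distrib_left[symmetric])
  \<comment> \<open>All triangles on \<open>e\<close> together have link weight 1, so their scaled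
    weight is at most \<open>w e\<close>.\<close>
  also have "\<dots> \<le> sum w heavy_edges"
  proof (rule sum_mono)
    fix e assume "e \<in> heavy_edges"
    then have e: "e \<in> cells X 1" using he by blast
    then have "link_scale 1 2 * sum w (Z e) \<le> sum (link_weight d X w e) (Z e) * w e"
      using d_ge by (intro link_weight_sum_le(2)) (auto simp: Z_def)
    then show "link_scale 1 2 * sum w (Z e) \<le> w e"
      using link_weight_sum[OF e, of 2] d_ge by (simp add: Z_def)
  qed
  also have "\<dots> \<le> sum w {e \<in> cells X 1. \<exists>x \<in> heavy. \<exists>y \<in> heavy. x \<noteq> y \<and> x < e \<and> y < e}"
  proof (intro sum_mono2)
    show "heavy_edges \<subseteq> {e \<in> cells X 1. \<exists>x \<in> heavy. \<exists>y \<in> heavy. x \<noteq> y \<and> x < e \<and> y < e}"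
    proof
      fix e assume e: "e \<in> heavy_edges"
      then have "e \<in> cells X 1" using he by blast
      moreover from this have "v < e \<longleftrightarrow> v \<le> e" if "v \<in> heavy" for v
        using strictly_below_cells[of v 0 e 1] that heavy_cells by auto
      ultimately show "e \<in> {e \<in> cells X 1. \<exists>x \<in> heavy. \<exists>y \<in> heavy. x \<noteq> y \<and> x < e \<and> y < e}"
        using e by (auto simp: heavy_edges_def)
    qed
  qed (use w_cells_nonneg in auto)
  also have "\<dots> \<le> \<alpha> * sum w heavy + \<beta> * (sum w heavy)\<^sup>2"
    using exp heavy_cells by (simp add: Gr_skeleton_expander_def)
  also have "\<dots> \<le> (\<alpha> + \<beta> * h) * sum w heavy"
    by (rule linear_plus_quadratic_le[OF H0 Hh nonneg(2)])
  also have "\<dots> \<le> (\<alpha> + \<beta> * h) * (L ^ 4 * sum w A / h\<^sub>0)"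
    using heavy_weight h\<^sub>0 nonneg h by (intro mult_left_mono) (auto simp: field_simps)
  finally have main: "link_scale 1 2 * sum w heavy_triangles \<le> (\<alpha> + \<beta> * h) * (L ^ 4 * sum w A / h\<^sub>0)" .
  have "sum w heavy_triangles \<le> L ^ 3 * real (F_max X (-1) 1 2) * ((\<alpha> + \<beta> * h) * (L ^ 4 * sum w A / h\<^sub>0))"
    using main d_ge by (intro sum_w_le_of_scaled) (auto simp: heavy_triangles_def)
  also have "\<dots> = L ^ 7 * real (F_max X (-1) 1 2) * ((\<alpha> + \<beta> * h) / h\<^sub>0) * sum w A"
    by (simp add: eval_nat_numeral)
  finally show ?thesis .
qed

lemma disjoint_triangles_weight:
  assumes exp: "NIH112_skeleton_expander X w \<alpha> \<beta>" and nonneg: "0 \<le> \<beta>" and small: "sum w A \<le> h"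
  shows "sum w disjoint_triangles \<le> (\<alpha> + \<beta> * h) * sum w A"
proof -
  have "sum w disjoint_triangles \<le> \<alpha> * sum w A + \<beta> * (sum w A)\<^sup>2"
    using exp A unfolding NIH112_skeleton_expander_def disjoint_triangles_def by blast
  also have "\<dots> \<le> (\<alpha> + \<beta> * h) * sum w A"
    by (rule linear_plus_quadratic_le[OF sum_w_nonneg[OF A] small nonneg])
  finally show ?thesis .
qed

section \<open>Charging witnesses to bad triangles\<close>

definition bad_triangles :: "'a set" where
  "bad_triangles = light_triangles \<union> heavy_triangles \<union> disjoint_triangles"

text \<open>Triangles witnessing that an edge of \<open>A\<close>, or the star of a vertex, does not carry a cocycle
  on its own.\<close>

definition edge_witnesses :: "'a \<Rightarrow> 'a set" where
  "edge_witnesses e = {z \<in> cells X 2. e \<le> z \<and> (\<exists>e' \<in> A. e' \<noteq> e \<and> e' \<le> z)}"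

definition vertex_witnesses :: "'a \<Rightarrow> 'a set" where
  "vertex_witnesses v = {z \<in> cells X 2. v \<le> z \<and> (\<exists>e \<in> star v. e \<le> z) \<and>
      (\<exists>e \<in> A. \<not> v \<le> e \<and> e \<le> z)}"

lemma bad_triangles_cells: "bad_triangles \<subseteq> cells X 2"
  by (auto simp: bad_triangles_def light_triangles_def heavy_triangles_def disjoint_triangles_def)

text \<open>Two edges in a triangle are disjoint or share a vertex, which is light or heavy. Only a
  shared heavy vertex does not already make the triangle bad, and that case is left to the
  caller.\<close>

lemma pair_bad:
  assumes "z \<in> cells X 2" "e \<in> A" "e' \<in> A" "e \<noteq> e'" "e \<le> z" "e' \<le> z"
  obtains "z \<in> bad_triangles" | u where "u \<in> heavy" "u \<le> e" "u \<le> e'"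
proof (cases "max_lower_bounds X {e, e'} = {empty_face X}")
  case True
  moreover have "e < z" "e' < z"
    using assms A strictly_below_cells[of _ 1 z 2] by auto
  ultimately have "z \<in> disjoint_triangles"
    using assms by (auto simp: disjoint_triangles_def)
  then show ?thesis
    using that by (simp add: bad_triangles_def)
next
  case False
  then obtain u where u: "u \<in> cells X 0" "u \<le> e" "u \<le> e'"
    using common_vertex assms A by (metis subsetD)
  show ?thesis
  proof (cases "u \<in> heavy")
    case False
    then have "z \<in> light_triangles"
      using assms u by (auto simp: light_triangles_def star_def)
    then show ?thesis
      using that by (simp add: bad_triangles_def)
  qed (use that u in blast)
qed

lemma edge_witnesses_bad:
  assumes "e \<in> A" "\<not> (\<exists>v \<in> heavy. v \<le> e)"
  shows "edge_witnesses e \<subseteq> {z \<in> bad_triangles. e \<le> z}"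
proof
  fix z assume "z \<in> edge_witnesses e"
  then obtain e' where z: "z \<in> cells X 2" "e \<le> z" and e': "e' \<in> A" "e \<noteq> e'" "e' \<le> z"
    by (auto simp: edge_witnesses_def)
  show "z \<in> {z \<in> bad_triangles. e \<le> z}"
    by (rule pair_bad[OF z(1) assms(1) e'(1,2) z(2) e'(3)]) (use z assms(2) in auto)
qed

text \<open>The second edge avoids \<open>v\<close>, so a heavy vertex that it shares with the first
  differs from \<open>v\<close>. Then the first edge has two heavy vertices.\<close>

lemma vertex_witnesses_bad:
  assumes v: "v \<in> heavy"
  shows "vertex_witnesses v \<subseteq> {z \<in> bad_triangles. v \<le> z}"
proof
  fix z assume "z \<in> vertex_witnesses v"
  then obtain e e' where z: "z \<in> cells X 2" "v \<le> z" and e: "e \<in> A" "v \<le> e" "e \<le> z"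
    and e': "e' \<in> A" "\<not> v \<le> e'" "e' \<le> z"
    by (auto simp: vertex_witnesses_def star_def)
  have "e \<noteq> e'"
    using e e' by blast
  then show "z \<in> {z \<in> bad_triangles. v \<le> z}"
  proof (rule pair_bad[OF z(1) e(1) e'(1) _ e(3) e'(3)])
    fix u assume u: "u \<in> heavy" "u \<le> e" "u \<le> e'"
    moreover have "u \<noteq> v"
      using u e'(2) by blast
    ultimately have "e \<in> heavy_edges"
      using e v by (auto simp: heavy_edges_def)
    then show ?thesis
      using z e by (auto simp: bad_triangles_def heavy_triangles_def)
  qed (use z in auto)
qed

text \<open>Double counting of bad triangles with the faces that charge them, namely heavy vertices
  and edges free of heavy vertices. Counting both kinds together in \<open>M\<close> gives
  \<open>m\<close> rather than \<open>2 * m\<close> for \<open>m\<close>-gons.\<close>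

lemma witnesses_le:
  assumes M: "\<And>z. z \<in> cells X 2 \<Longrightarrow>
      real (card {v \<in> heavy. v \<le> z} + card {e \<in> cells X 1. e \<le> z \<and> \<not> (\<exists>v \<in> heavy. v \<le> e)}) \<le> M"
  defines "A1 \<equiv> {e \<in> A. \<not> (\<exists>v \<in> heavy. v \<le> e)}"
  shows "(\<Sum>e \<in> A1. sum w (edge_witnesses e)) + (\<Sum>v \<in> heavy. sum w (vertex_witnesses v))
    \<le> M * sum w bad_triangles"
proof -
  have fin: "finite bad_triangles" "finite A1"
    using bad_triangles_cells finite_cells finite_subset finite_A by (blast, simp add: A1_def)
  have w0: "0 \<le> w z" if "z \<in> bad_triangles" for z
    using that bad_triangles_cells w_cells_nonneg by blast
  have "(\<Sum>e \<in> A1. sum w (edge_witnesses e)) + (\<Sum>v \<in> heavy. sum w (vertex_witnesses v))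
      \<le> (\<Sum>e \<in> A1. sum w {z \<in> bad_triangles. e \<le> z}) + (\<Sum>v \<in> heavy. sum w {z \<in> bad_triangles. v \<le> z})"
    using edge_witnesses_bad vertex_witnesses_bad fin w0
    by (intro add_mono sum_mono sum_mono2) (auto simp: A1_def)
  also have "\<dots> = (\<Sum>z \<in> bad_triangles. real (card {e \<in> A1. e \<le> z} + card {v \<in> heavy. v \<le> z}) * w z)"
    using sum.swap_restrict[of A1 bad_triangles "\<lambda>_ z. w z" "\<lambda>e z. e \<le> z"]
      sum.swap_restrict[of heavy bad_triangles "\<lambda>_ z. w z" "\<lambda>e z. e \<le> z"] fin finite_heavy
    by (simp add: sum.distrib algebra_simps)
  also have "\<dots> \<le> (\<Sum>z \<in> bad_triangles. M * w z)"
  proof (intro sum_mono mult_right_mono w0)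
    fix z assume "z \<in> bad_triangles"
    then have z: "z \<in> cells X 2"
      using bad_triangles_cells by blast
    have "card {e \<in> A1. e \<le> z} \<le> card {e \<in> cells X 1. e \<le> z \<and> \<not> (\<exists>v \<in> heavy. v \<le> e)}"
      using A by (intro card_mono) (auto simp: A1_def)
    then show "real (card {e \<in> A1. e \<le> z} + card {v \<in> heavy. v \<le> z}) \<le> M"
      using M[OF z] by linarith
  qed
  finally show ?thesis
    by (simp add: sum_distrib_left)
qed

text \<open>The link of \<open>e\<close> is left through the upper bound on link weights, at the
  cost of \<open>L ^ 3\<close>. The scale that remains is at most the reciprocal of a minimal count,
  and this count is at least \<open>\<rho>\<close>.\<close>

lemma edge_witnesses_ge:
  assumes e: "e \<in> A" and \<epsilon>: "0 \<le> \<epsilon>" "\<epsilon> \<le> sum (link_weight d X w e) (edge_witnesses e)"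
    and \<rho>: "0 \<le> \<rho>" "\<rho> \<le> real (F_min X (-1) 1 2)"
  shows "\<epsilon> * \<rho> * w e \<le> L ^ 3 * sum w (edge_witnesses e)"
proof -
  have e1: "e \<in> cells X 1" and we: "0 \<le> w e"
    using e A w_cells_nonneg by blast+
  have W0: "0 \<le> sum w (edge_witnesses e)"
    by (rule sum_w_nonneg[of _ 2]) (auto simp: edge_witnesses_def)
  have "\<epsilon> * w e \<le> sum (link_weight d X w e) (edge_witnesses e) * w e"
    using \<epsilon> we by (intro mult_right_mono) auto
  also have "\<dots> \<le> link_scale 1 2 * L ^ 3 * sum w (edge_witnesses e)"
    using e1 d_ge by (intro link_weight_sum_le(1)) (auto simp: edge_witnesses_def)
  finally have le: "\<epsilon> * w e \<le> link_scale 1 2 * L ^ 3 * sum w (edge_witnesses e)" .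
  have "\<epsilon> * \<rho> * w e = \<rho> * (\<epsilon> * w e)"
    by simp
  also have "\<dots> \<le> real (F_min X (-1) 1 2) * (\<epsilon> * w e)"
    using \<rho> \<epsilon> we by (intro mult_right_mono) auto
  also have "\<dots> \<le> real (F_min X (-1) 1 2) * (link_scale 1 2 * L ^ 3 * sum w (edge_witnesses e))"
    using le by (intro mult_left_mono) auto
  also have "\<dots> = link_scale 1 2 * real (F_min X (-1) 1 2) * (L ^ 3 * sum w (edge_witnesses e))"
    by simp
  also have "\<dots> \<le> 1 * (L ^ 3 * sum w (edge_witnesses e))"
    using link_scale_le(1)[of 1 2] d_ge W0 L_ge_1 by (intro mult_right_mono) auto
  finally show ?thesis by simp
qed

text \<open>The exponent 9 collects three factors \<open>L ^ 3\<close>: the one in the assumption,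
  the upper bound on link weights of triangles, and the removal of the scale for edges. The scales
  for edges and triangles differ; \<open>\<rho>\<close> bounds the ratio of the face numbers behind
  them.\<close>

lemma vertex_witnesses_ge:
  assumes v: "v \<in> cells X 0" and \<epsilon>: "0 \<le> \<epsilon>"
    "\<epsilon> * sum (link_weight d X w v) (star v) \<le> L ^ 3 * sum (link_weight d X w v) (vertex_witnesses v)"
    and \<rho>: "0 \<le> \<rho>" "\<rho> * real (F_max X (-1) 0 1) \<le> real (F_min X (-1) 0 2)"
  shows "\<epsilon> * \<rho> * sum w (star v) \<le> L ^ 9 * sum w (vertex_witnesses v)"
proof -
  let ?S = "sum w (star v)" and ?W = "sum w (vertex_witnesses v)"
  let ?b = "real (F_min X (-1) 0 2)" and ?a = "real (F_max X (-1) 0 1)"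
  have l: "0 < link_scale 0 1" "0 < link_scale 0 2"
    using link_scale_pos d_ge by auto
  have S0: "0 \<le> ?S"
    using star_subset by (intro sum_w_nonneg[of _ 1]) auto
  have W0: "0 \<le> ?W"
    by (rule sum_w_nonneg[of _ 2]) (auto simp: vertex_witnesses_def)
  have "\<epsilon> * (link_scale 0 1 * ?S) \<le> \<epsilon> * (sum (link_weight d X w v) (star v) * w v)"
    using v d_ge star_subset \<epsilon> by (intro mult_left_mono link_weight_sum_le(2)) auto
  also have "\<dots> \<le> L ^ 3 * (sum (link_weight d X w v) (vertex_witnesses v) * w v)"
    using mult_right_mono[OF \<epsilon>(2) w_cells_nonneg[OF v]] by (simp add: mult.assoc)
  also have "\<dots> \<le> L ^ 3 * (link_scale 0 2 * L ^ 3 * ?W)"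
    using v d_ge L_ge_1
    by (intro mult_left_mono link_weight_sum_le(1)) (auto simp: vertex_witnesses_def)
  finally have le: "\<epsilon> * (link_scale 0 1 * ?S) \<le> L ^ 3 * (link_scale 0 2 * L ^ 3 * ?W)" .
  have "\<epsilon> * \<rho> * ?S \<le> link_scale 0 1 * L ^ 3 * ?a * (\<epsilon> * \<rho> * ?S)"
    using link_scale_le(2)[of 0 1] d_ge \<epsilon> \<rho> S0
      mult_right_mono[of 1 "link_scale 0 1 * L ^ 3 * ?a" "\<epsilon> * \<rho> * ?S"] by simp
  also have "\<dots> = (\<rho> * ?a) * (L ^ 3 * (\<epsilon> * (link_scale 0 1 * ?S)))"
    by simp
  also have "\<dots> \<le> ?b * (L ^ 3 * (\<epsilon> * (link_scale 0 1 * ?S)))"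
    using \<rho> \<epsilon> l S0 L_ge_1 by (intro mult_right_mono) auto
  also have "\<dots> \<le> ?b * (L ^ 3 * (L ^ 3 * (link_scale 0 2 * L ^ 3 * ?W)))"
    using le L_ge_1 by (intro mult_left_mono) auto
  also have "\<dots> = link_scale 0 2 * ?b * (L ^ 9 * ?W)"
    by (simp add: eval_nat_numeral)
  also have "\<dots> \<le> 1 * (L ^ 9 * ?W)"
    using link_scale_le(1)[of 0 2] d_ge W0 L_ge_1 by (intro mult_right_mono) auto
  finally show ?thesis by simp
qed

text \<open>Two estimates collide. The bad triangles weigh at most
  \<open>L ^ 7 * K * (E' * \<epsilon>) * sum w A\<close>, whereas the witnesses, charged at most
  \<open>M\<close> times per triangle, force \<open>\<epsilon> * \<tau> * \<rho> * sum w A\<close>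
  to be at most \<open>L ^ 9 * M\<close> times that weight. With \<open>E'\<close> as assumed this
  gives \<open>\<tau> \<le> 1 / 2\<close>.\<close>

lemma locally_minimal_empty:
  assumes skel: "skeleton_expansion d X w \<alpha>\<^sub>0 \<beta>\<^sub>0 \<alpha>\<^sub>m \<beta>\<^sub>m \<alpha>\<^sub>p \<beta>\<^sub>p"
    and nonneg: "0 \<le> \<alpha>\<^sub>0" "0 \<le> \<beta>\<^sub>0" "0 \<le> \<alpha>\<^sub>m" "0 \<le> \<beta>\<^sub>m" "0 \<le> \<alpha>\<^sub>p" "0 \<le> \<beta>\<^sub>p"
    and hs: "0 < h\<^sub>m" "0 < h\<^sub>p"
    and small: "L ^ 4 * sum w A \<le> h\<^sub>0 * h\<^sub>m" "sum w A \<le> h\<^sub>p"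
    and sum_le: "(\<alpha>\<^sub>0 + \<beta>\<^sub>0 * h\<^sub>0) + (\<alpha>\<^sub>p + \<beta>\<^sub>p * h\<^sub>p) + (\<alpha>\<^sub>m + \<beta>\<^sub>m * h\<^sub>m) / h\<^sub>0 \<le> E' * \<epsilon>"
    and K: "real (F_max X (-1) 0 2) \<le> K" "real (F_max X (-1) 1 2) \<le> K" "1 \<le> K"
    and M: "\<And>z H. z \<in> cells X 2 \<Longrightarrow> H \<subseteq> cells X 0 \<Longrightarrow>
      real (card {v \<in> H. v \<le> z} + card {e \<in> cells X 1. e \<le> z \<and> \<not> (\<exists>v \<in> H. v \<le> e)}) \<le> M"
    and \<rho>: "0 < \<rho>" "\<rho> \<le> real (F_min X (-1) 1 2)"
      "\<rho> * real (F_max X (-1) 0 1) \<le> real (F_min X (-1) 0 2)"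
    and E': "2 * M * K * L ^ 16 * E' \<le> \<rho>"
    and \<epsilon>: "0 < \<epsilon>" and \<tau>: "1 / 2 < \<tau>" "\<tau> \<le> 1"
    and edges: "\<And>e. e \<in> A \<Longrightarrow> \<epsilon> \<le> sum (link_weight d X w e) (edge_witnesses e)"
    and vertices: "\<And>v. v \<in> heavy \<Longrightarrow> \<epsilon> * \<tau> * sum (link_weight d X w v) (star v)
      \<le> L ^ 3 * sum (link_weight d X w v) (vertex_witnesses v)"
  shows "A = {}"
proof (rule ccontr)
  assume "A \<noteq> {}"
  then have WA: "0 < sum w A"
    using finite_A A w_pos cells_faces by (intro sum_pos) auto
  define A1 where "A1 = {e \<in> A. \<not> (\<exists>v \<in> heavy. v \<le> e)}"
  let ?P = "(\<alpha>\<^sub>0 + \<beta>\<^sub>0 * h\<^sub>0) + (\<alpha>\<^sub>p + \<beta>\<^sub>p * h\<^sub>p) + (\<alpha>\<^sub>m + \<beta>\<^sub>m * h\<^sub>m) / h\<^sub>0"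
  have pos: "0 \<le> \<alpha>\<^sub>0 + \<beta>\<^sub>0 * h\<^sub>0" "0 \<le> \<alpha>\<^sub>p + \<beta>\<^sub>p * h\<^sub>p" "0 \<le> (\<alpha>\<^sub>m + \<beta>\<^sub>m * h\<^sub>m) / h\<^sub>0"
    using nonneg hs h\<^sub>0 by auto
  have cells: "light_triangles \<subseteq> cells X 2" "heavy_triangles \<subseteq> cells X 2" "disjoint_triangles \<subseteq> cells X 2"
    by (auto simp: light_triangles_def heavy_triangles_def disjoint_triangles_def)
  then have fin: "finite light_triangles" "finite heavy_triangles" "finite disjoint_triangles"
    using finite_cells finite_subset by blast+
  have L7: "1 \<le> L ^ 7"
    using L_ge_1 by simp
  have L0: "0 \<le> L"
    using L_ge_1 by simp
  have t1: "sum w light_triangles \<le> L ^ 7 * K * (\<alpha>\<^sub>0 + \<beta>\<^sub>0 * h\<^sub>0) * sum w A"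
  proof -
    have "sum w light_triangles \<le> L ^ 7 * real (F_max X (-1) 0 2) * (\<alpha>\<^sub>0 + \<beta>\<^sub>0 * h\<^sub>0) * sum w A"
      using skel nonneg by (intro light_triangles_weight) (auto simp: skeleton_expansion_def)
    also have "\<dots> \<le> L ^ 7 * K * (\<alpha>\<^sub>0 + \<beta>\<^sub>0 * h\<^sub>0) * sum w A"
      using K pos WA L0 by (intro mult_right_mono mult_left_mono) auto
    finally show ?thesis .
  qed
  have t2: "sum w heavy_triangles \<le> L ^ 7 * K * ((\<alpha>\<^sub>m + \<beta>\<^sub>m * h\<^sub>m) / h\<^sub>0) * sum w A"
  proof -
    have "sum w heavy_triangles
        \<le> L ^ 7 * real (F_max X (-1) 1 2) * ((\<alpha>\<^sub>m + \<beta>\<^sub>m * h\<^sub>m) / h\<^sub>0) * sum w A"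
      using skel nonneg small by (intro heavy_triangles_weight) (auto simp: skeleton_expansion_def)
    also have "\<dots> \<le> L ^ 7 * K * ((\<alpha>\<^sub>m + \<beta>\<^sub>m * h\<^sub>m) / h\<^sub>0) * sum w A"
      using K pos WA L0 by (intro mult_right_mono mult_left_mono) auto
    finally show ?thesis .
  qed
  \<comment> \<open>No link is involved here; the bound is inflated to share the factor
    \<open>L ^ 7 * K\<close> with the other two.\<close>
  have t3: "sum w disjoint_triangles \<le> L ^ 7 * K * (\<alpha>\<^sub>p + \<beta>\<^sub>p * h\<^sub>p) * sum w A"
  proof -
    have "sum w disjoint_triangles \<le> 1 * (\<alpha>\<^sub>p + \<beta>\<^sub>p * h\<^sub>p) * sum w A"
      using skel nonneg small disjoint_triangles_weight by (auto simp: skeleton_expansion_def)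
    also have "\<dots> \<le> L ^ 7 * K * (\<alpha>\<^sub>p + \<beta>\<^sub>p * h\<^sub>p) * sum w A"
      using K(3) pos WA L7 L0 mult_mono[OF L7 K(3)] by (intro mult_right_mono) auto
    finally show ?thesis .
  qed
  have "sum w bad_triangles \<le> sum w light_triangles + sum w heavy_triangles + sum w disjoint_triangles"
    unfolding bad_triangles_def
    using sum_Un[of "light_triangles \<union> heavy_triangles" disjoint_triangles w]
      sum_Un[of light_triangles heavy_triangles w] fin
      sum_w_nonneg[of "(light_triangles \<union> heavy_triangles) \<inter> disjoint_triangles" 2]
      sum_w_nonneg[of "light_triangles \<inter> heavy_triangles" 2] cells
    by (simp add: le_infI1)
  also have "\<dots> \<le> L ^ 7 * K * ?P * sum w A"
    using t1 t2 t3 by (simp add: algebra_simps)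
  also have "\<dots> \<le> L ^ 7 * K * (E' * \<epsilon>) * sum w A"
    using sum_le WA K(3) L0 by (intro mult_right_mono mult_left_mono) auto
  finally have upper: "sum w bad_triangles \<le> L ^ 7 * K * (E' * \<epsilon>) * sum w A" .
  \<comment> \<open>\<open>M\<close> is known only as an upper bound for counts in 2-faces, so its
    sign is read off from an existing 2-face.\<close>
  have M0: "0 \<le> M"
  proof -
    obtain y where "y \<in> cells X 2"
      using between_counts_nonempty[of 2 2 2] d_ge by (auto simp: between_counts_def)
    from M[OF this, of "{}"] show ?thesis
      by (meson bot.extremum of_nat_0_le_iff order_trans)
  qed
  have wit: "(\<Sum>e \<in> A1. sum w (edge_witnesses e)) + (\<Sum>v \<in> heavy. sum w (vertex_witnesses v))
      \<le> M * sum w bad_triangles"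
    unfolding A1_def using M heavy_cells by (intro witnesses_le) auto
  \<comment> \<open>Edges satisfy a better bound; \<open>\<tau> \<le> 1\<close> and
    \<open>L ^ 3 \<le> L ^ 9\<close> weaken it to the shape of the one for heavy vertices.\<close>
  have "(\<Sum>e \<in> A1. \<epsilon> * \<tau> * \<rho> * w e) \<le> (\<Sum>e \<in> A1. L ^ 9 * sum w (edge_witnesses e))"
  proof (rule sum_mono)
    fix e assume "e \<in> A1"
    then have e: "e \<in> A" by (simp add: A1_def)
    have W0: "0 \<le> sum w (edge_witnesses e)"
      by (rule sum_w_nonneg[of _ 2]) (auto simp: edge_witnesses_def)
    have "\<epsilon> * \<tau> * \<rho> * w e \<le> \<epsilon> * 1 * \<rho> * w e"
      using \<epsilon> \<tau> \<rho> e A w_cells_nonneg by (intro mult_right_mono mult_left_mono) auto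
    also have "\<dots> \<le> L ^ 3 * sum w (edge_witnesses e)"
      using edge_witnesses_ge[OF e _ edges[OF e], of \<rho>] \<epsilon> \<rho> by simp
    also have "\<dots> \<le> L ^ 9 * sum w (edge_witnesses e)"
      using W0 L_ge_1 by (intro mult_right_mono power_increasing) auto
    finally show "\<epsilon> * \<tau> * \<rho> * w e \<le> L ^ 9 * sum w (edge_witnesses e)" .
  qed
  then have lowE: "\<epsilon> * \<tau> * \<rho> * sum w A1 \<le> L ^ 9 * (\<Sum>e \<in> A1. sum w (edge_witnesses e))"
    by (simp only: sum_distrib_left[symmetric])
  have "(\<Sum>v \<in> heavy. \<epsilon> * \<tau> * \<rho> * sum w (star v))
      \<le> (\<Sum>v \<in> heavy. L ^ 9 * sum w (vertex_witnesses v))"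
    using vertices heavy_cells \<epsilon> \<tau> \<rho> by (intro sum_mono vertex_witnesses_ge) auto
  then have lowV: "\<epsilon> * \<tau> * \<rho> * (\<Sum>v \<in> heavy. sum w (star v))
      \<le> L ^ 9 * (\<Sum>v \<in> heavy. sum w (vertex_witnesses v))"
    by (simp only: sum_distrib_left[symmetric])
  \<comment> \<open>An edge of \<open>A\<close> without heavy vertices is in \<open>A1\<close>, any
    other lies in the star of a heavy vertex. Overlaps of stars only enlarge the bound.\<close>
  have "sum w A = sum w A1 + sum w (A - A1)"
    using finite_A sum.subset_diff[of A1 A w] by (auto simp: A1_def)
  also have "sum w (A - A1) \<le> sum w (\<Union>v \<in> heavy. star v)"
    using finite_A finite_heavy A w_cells_nonneg
    by (intro sum_mono2) (auto simp: A1_def star_def)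
  also have "\<dots> \<le> (\<Sum>v \<in> heavy. sum w (star v))"
    using finite_heavy finite_A A w_cells_nonneg by (intro sum_UN_le) (auto simp: star_def)
  finally have "\<epsilon> * \<tau> * \<rho> * sum w A \<le> \<epsilon> * \<tau> * \<rho> * (sum w A1 + (\<Sum>v \<in> heavy. sum w (star v)))"
    using \<epsilon> \<tau> \<rho> by (intro mult_left_mono) auto
  also have "\<dots> \<le> L ^ 9 * ((\<Sum>e \<in> A1. sum w (edge_witnesses e)) +
      (\<Sum>v \<in> heavy. sum w (vertex_witnesses v)))"
    using lowE lowV by (simp add: distrib_left)
  also have "\<dots> \<le> L ^ 9 * (M * (L ^ 7 * K * (E' * \<epsilon>) * sum w A))"
    using L_ge_1 order_trans[OF wit mult_left_mono[OF upper M0]] by (intro mult_left_mono) auto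
  also have "\<dots> = (M * K * L ^ 16 * E') * (\<epsilon> * sum w A)"
    by (simp add: eval_nat_numeral)
  also have "\<dots> \<le> \<rho> / 2 * (\<epsilon> * sum w A)"
    using E' \<epsilon> WA by (intro mult_right_mono) auto
  finally have "\<tau> * (\<rho> * (\<epsilon> * sum w A)) \<le> 1 / 2 * (\<rho> * (\<epsilon> * sum w A))"
    by (simp add: algebra_simps)
  moreover have "0 < \<rho> * (\<epsilon> * sum w A)"
    using \<rho> \<epsilon> WA by simp
  ultimately show False
    using \<tau>(1) by (meson linorder_not_less mult_less_cancel_right_pos)
qed

end

section \<open>The coboundary of a sheaf and its square\<close>

section \<open>Sheaf cochains\<close>

lemma (in abelian_monoid) finsum_swap:
  assumes "finite A" "finite B" "\<And>a b. a \<in> A \<Longrightarrow> b \<in> B \<Longrightarrow> f a b \<in> carrier G"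
  shows "(\<Oplus>a \<in> A. \<Oplus>b \<in> B. f a b) = (\<Oplus>b \<in> B. \<Oplus>a \<in> A. f a b)"
  using assms(1,3)
proof (induction A rule: finite_induct)
  case empty
  then show ?case by simp
next
  case (insert a A)
  then have "(\<Oplus>a \<in> insert a A. \<Oplus>b \<in> B. f a b) = (\<Oplus>b \<in> B. f a b) \<oplus> (\<Oplus>b \<in> B. \<Oplus>a \<in> A. f a b)"
    by (subst finsum_insert) auto
  also have "\<dots> = (\<Oplus>b \<in> B. f a b \<oplus> (\<Oplus>a \<in> A. f a b))"
    using insert by (intro finsum_addf[symmetric]) auto
  also have "\<dots> = (\<Oplus>b \<in> B. \<Oplus>a \<in> insert a A. f a b)"
    using insert by (intro finsum_cong') auto
  finally show ?case .
qed

lemma (in module) finsum_smult_rdistr: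
  assumes "finite A" "c \<in> A \<rightarrow> carrier R" "x \<in> carrier M"
  shows "(\<Oplus>i \<in> A. c i) \<odot>\<^bsub>M\<^esub> x = (\<Oplus>\<^bsub>M\<^esub> i \<in> A. c i \<odot>\<^bsub>M\<^esub> x)"
  using assms(1,2)
proof (induction A rule: finite_induct)
  case empty
  then show ?case using assms by simp
next
  case (insert i A)
  then show ?case
    using assms(3) by (simp add: Pi_def smult_l_distr)
qed

lemma linear_maps_zero:
  assumes "Module.module R M" "Module.module R N" "h \<in> linear_maps R M N"
  shows "h \<zero>\<^bsub>M\<^esub> = \<zero>\<^bsub>N\<^esub>"
proof -
  interpret M: module R M by fact
  interpret N: module R N by fact
  have h: "h \<zero>\<^bsub>M\<^esub> \<in> carrier N"
    using assms(3) by (auto simp: linear_maps_def)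
  have "h (\<zero>\<^bsub>R\<^esub> \<odot>\<^bsub>M\<^esub> \<zero>\<^bsub>M\<^esub>) = \<zero>\<^bsub>R\<^esub> \<odot>\<^bsub>N\<^esub> h \<zero>\<^bsub>M\<^esub>"
    using assms(3) M.R.zero_closed M.M.zero_closed unfolding linear_maps_def by blast
  then show ?thesis
    using h by simp
qed

lemma linear_maps_finsum:
  assumes "Module.module R M" "Module.module R N" "h \<in> linear_maps R M N"
    and "finite A" "\<And>a. a \<in> A \<Longrightarrow> f a \<in> carrier M"
  shows "h (\<Oplus>\<^bsub>M\<^esub> a \<in> A. f a) = (\<Oplus>\<^bsub>N\<^esub> a \<in> A. h (f a))"
proof -
  interpret M: module R M by fact
  interpret N: module R N by fact
  have closed: "h u \<in> carrier N" if "u \<in> carrier M" for u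
    using assms(3) that by (auto simp: linear_maps_def)
  have add: "h (u \<oplus>\<^bsub>M\<^esub> v) = h u \<oplus>\<^bsub>N\<^esub> h v" if "u \<in> carrier M" "v \<in> carrier M" for u v
    using assms(3) that by (auto simp: linear_maps_def)
  show ?thesis
    using assms(4,5)
  proof (induction A rule: finite_induct)
    case empty
    then show ?case using linear_maps_zero[OF assms(1-3)] by simp
  next
    case (insert a A)
    have "h (\<Oplus>\<^bsub>M\<^esub> a \<in> insert a A. f a) = h (f a \<oplus>\<^bsub>M\<^esub> (\<Oplus>\<^bsub>M\<^esub> a \<in> A. f a))"
      using insert by (subst M.finsum_insert) auto
    also have "\<dots> = h (f a) \<oplus>\<^bsub>N\<^esub> h (\<Oplus>\<^bsub>M\<^esub> a \<in> A. f a)"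
      using insert by (intro add M.finsum_closed) auto
    also have "\<dots> = h (f a) \<oplus>\<^bsub>N\<^esub> (\<Oplus>\<^bsub>N\<^esub> a \<in> A. h (f a))"
      using insert by simp
    also have "\<dots> = (\<Oplus>\<^bsub>N\<^esub> a \<in> insert a A. h (f a))"
      using insert closed by (subst N.finsum_insert) auto
    finally show ?case .
  qed
qed

locale sheaf_dposet = weighted_dposet d X w L for d and X :: "('a::order) gposet" and w L +
  fixes R :: "'r ring" and \<sigma> :: "'a \<Rightarrow> 'a \<Rightarrow> 'r" and \<F> :: "('a, 'r, 'm) sheaf"
  assumes cring: "cring R" and orientation: "is_orientation R X \<sigma>" and sheaf: "is_sheaf R X \<F>"
    and d_ge_2: "2 \<le> d"
begin

interpretation cring R
  by (rule cring)

lemma stalk_module: "x \<in> faces X \<Longrightarrow> Module.module R (stalk \<F> x)"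
  using sheaf by (simp add: is_sheaf_def)

lemma stalk_group: "x \<in> cells X i \<Longrightarrow> abelian_group (stalk \<F> x)"
  using stalk_module cells_faces by (metis module.axioms(2))

lemma zero_in_stalk: "x \<in> cells X i \<Longrightarrow> \<zero>\<^bsub>stalk \<F> x\<^esub> \<in> carrier (stalk \<F> x)"
  using stalk_group by (simp add: abelian_group.axioms(1) abelian_monoid.zero_closed)

lemma covered_cells:
  assumes "x \<in> cells X i" "y \<in> cells X (i + 1)" "x \<le> y"
  shows "covered X x y"
proof -
  have "x < y"
    using strictly_below_cells[OF assms(1,2)] assms(3) by simp
  moreover have "\<not> (x < z \<and> z < y)" if "z \<in> faces X" for z
    using gdim_strict[of x z] gdim_strict[of z y] that assms cells_faces cells_gdim by fastforce
  ultimately show ?thesis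
    using assms cells_faces by (auto simp: covered_def)
qed

lemma orientation_unit:
  "x \<in> cells X i \<Longrightarrow> y \<in> cells X (i + 1) \<Longrightarrow> x \<le> y \<Longrightarrow> \<sigma> y x \<in> Units R"
  using covered_cells orientation by (auto simp: is_orientation_def)

lemma orientation_closed:
  "x \<in> cells X i \<Longrightarrow> y \<in> cells X (i + 1) \<Longrightarrow> x \<le> y \<Longrightarrow> \<sigma> y x \<in> carrier R"
  using orientation_unit by (auto simp: Units_def)

lemma res_linear:
  "x \<in> faces X \<Longrightarrow> y \<in> faces X \<Longrightarrow> x < y \<Longrightarrow> res \<F> y x \<in> linear_maps R (stalk \<F> x) (stalk \<F> y)"
  using sheaf by (simp add: is_sheaf_def)

text \<open>One summand of the coboundary. Treating it as a linear map between stalks allows sums to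
  be pushed through it.\<close>

definition tr :: "'a \<Rightarrow> 'a \<Rightarrow> 'm \<Rightarrow> 'm" where
  "tr y x u = \<sigma> y x \<odot>\<^bsub>stalk \<F> y\<^esub> res \<F> y x u"

text \<open>Commutativity of \<open>R\<close> moves the orientation scalar past the scalar of the
  module.\<close>

lemma tr_linear:
  assumes x: "x \<in> cells X i" "y \<in> cells X (i + 1)" "x \<le> y"
  shows "tr y x \<in> linear_maps R (stalk \<F> x) (stalk \<F> y)"
proof -
  interpret M: module R "stalk \<F> x" using stalk_module x cells_faces by blast
  interpret N: module R "stalk \<F> y" using stalk_module x cells_faces by blast
  have s: "\<sigma> y x \<in> carrier R"
    using orientation_unit[OF x] by auto
  have "x < y"
    using strictly_below_cells[OF x(1,2)] x(3) by simp
  then have res: "res \<F> y x \<in> linear_maps R (stalk \<F> x) (stalk \<F> y)"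
    using res_linear x cells_faces by blast
  have "tr y x (a \<odot>\<^bsub>stalk \<F> x\<^esub> u) = a \<odot>\<^bsub>stalk \<F> y\<^esub> tr y x u"
    if "a \<in> carrier R" "u \<in> carrier (stalk \<F> x)" for a u
  proof -
    have "res \<F> y x (a \<odot>\<^bsub>stalk \<F> x\<^esub> u) = a \<odot>\<^bsub>stalk \<F> y\<^esub> res \<F> y x u"
      "res \<F> y x u \<in> carrier (stalk \<F> y)"
      using res that by (auto simp: linear_maps_def)
    then show ?thesis
      using that s by (simp add: tr_def N.smult_assoc1[symmetric] m_comm)
  qed
  moreover have "tr y x u \<in> carrier (stalk \<F> y)" if "u \<in> carrier (stalk \<F> x)" for u
    using that s res by (auto simp: tr_def linear_maps_def)
  moreover have "tr y x (u \<oplus>\<^bsub>stalk \<F> x\<^esub> v) = tr y x u \<oplus>\<^bsub>stalk \<F> y\<^esub> tr y x v"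
    if "u \<in> carrier (stalk \<F> x)" "v \<in> carrier (stalk \<F> x)" for u v
  proof -
    have "res \<F> y x (u \<oplus>\<^bsub>stalk \<F> x\<^esub> v) = res \<F> y x u \<oplus>\<^bsub>stalk \<F> y\<^esub> res \<F> y x v"
      "res \<F> y x u \<in> carrier (stalk \<F> y)" "res \<F> y x v \<in> carrier (stalk \<F> y)"
      using res that by (auto simp: linear_maps_def)
    then show ?thesis
      using s by (simp add: tr_def N.smult_r_distr)
  qed
  ultimately show ?thesis
    by (auto simp: linear_maps_def)
qed

lemma tr_closed:
  assumes "x \<in> cells X i" "y \<in> cells X (i + 1)" "x \<le> y" "u \<in> carrier (stalk \<F> x)"
  shows "tr y x u \<in> carrier (stalk \<F> y)"
  using tr_linear[OF assms(1-3)] assms(4) by (auto simp: linear_maps_def)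

lemma tr_add:
  assumes "x \<in> cells X i" "y \<in> cells X (i + 1)" "x \<le> y"
    "u \<in> carrier (stalk \<F> x)" "v \<in> carrier (stalk \<F> x)"
  shows "tr y x (u \<oplus>\<^bsub>stalk \<F> x\<^esub> v) = tr y x u \<oplus>\<^bsub>stalk \<F> y\<^esub> tr y x v"
  using tr_linear[OF assms(1-3)] assms(4,5) by (auto simp: linear_maps_def)

lemma tr_zero:
  assumes "x \<in> cells X i" "y \<in> cells X (i + 1)" "x \<le> y"
  shows "tr y x \<zero>\<^bsub>stalk \<F> x\<^esub> = \<zero>\<^bsub>stalk \<F> y\<^esub>"
  using linear_maps_zero[OF _ _ tr_linear[OF assms]] stalk_module assms cells_faces by blast

lemma tr_minus:
  assumes "x \<in> cells X i" "y \<in> cells X (i + 1)" "x \<le> y" "u \<in> carrier (stalk \<F> x)"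
  shows "tr y x (\<ominus>\<^bsub>stalk \<F> x\<^esub> u) = \<ominus>\<^bsub>stalk \<F> y\<^esub> tr y x u"
proof -
  interpret M: module R "stalk \<F> x" using stalk_module assms cells_faces by blast
  interpret N: module R "stalk \<F> y" using stalk_module assms cells_faces by blast
  have "tr y x (\<ominus>\<^bsub>stalk \<F> x\<^esub> u) \<oplus>\<^bsub>stalk \<F> y\<^esub> tr y x u = \<zero>\<^bsub>stalk \<F> y\<^esub>"
    using tr_add[OF assms(1-3), of "\<ominus>\<^bsub>stalk \<F> x\<^esub> u" u] assms(4) tr_zero[OF assms(1-3)]
    by (simp add: M.l_neg)
  then show ?thesis
    using tr_closed[OF assms(1-3)] assms(4) by (intro N.minus_equality[symmetric]) auto
qed

lemma finite_subfaces [simp]: "finite (subfaces X y i)"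
  by (simp add: subfaces_def)

lemma subfaces_cells: "x \<in> subfaces X y i \<Longrightarrow> x \<in> cells X i \<and> x \<le> y"
  by (simp add: subfaces_def)

lemma cobd_apply: "y \<in> cells X (i + 1) \<Longrightarrow>
    cobd X \<sigma> \<F> i f y = (\<Oplus>\<^bsub>stalk \<F> y\<^esub> x \<in> subfaces X y i. tr y x (f x))"
  by (simp add: cobd_def tr_def)

lemma cochain_closed: "f \<in> cochains X \<F> i \<Longrightarrow> x \<in> cells X i \<Longrightarrow> f x \<in> carrier (stalk \<F> x)"
  by (auto simp: cochains_def)

lemma cobd_closed:
  assumes "f \<in> cochains X \<F> i" "y \<in> cells X (i + 1)"
  shows "cobd X \<sigma> \<F> i f y \<in> carrier (stalk \<F> y)"
proof -
  interpret abelian_group "stalk \<F> y" using stalk_group assms(2) .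
  show ?thesis
    unfolding cobd_apply[OF assms(2)]
    using tr_closed assms subfaces_cells cochain_closed by (intro finsum_closed) blast
qed

lemma cobd_add:
  assumes f: "f \<in> cochains X \<F> i" "g \<in> cochains X \<F> i" and y: "y \<in> cells X (i + 1)"
  shows "cobd X \<sigma> \<F> i (cochain_add X \<F> i f g) y =
    cobd X \<sigma> \<F> i f y \<oplus>\<^bsub>stalk \<F> y\<^esub> cobd X \<sigma> \<F> i g y"
proof -
  interpret abelian_group "stalk \<F> y" using stalk_group y .
  have closed: "tr y x (h x) \<in> carrier (stalk \<F> y)"
    if "x \<in> subfaces X y i" "h \<in> cochains X \<F> i" for x h
    using that tr_closed y subfaces_cells cochain_closed by blast
  have "cobd X \<sigma> \<F> i (cochain_add X \<F> i f g) y =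
      (\<Oplus>\<^bsub>stalk \<F> y\<^esub> x \<in> subfaces X y i. tr y x (f x) \<oplus>\<^bsub>stalk \<F> y\<^esub> tr y x (g x))"
    unfolding cobd_apply[OF y] using closed f
    by (intro finsum_cong')
       (auto simp: cochain_add_def subfaces_def y intro!: tr_add cochain_closed)
  also have "\<dots> = cobd X \<sigma> \<F> i f y \<oplus>\<^bsub>stalk \<F> y\<^esub> cobd X \<sigma> \<F> i g y"
    unfolding cobd_apply[OF y] using closed f by (intro finsum_addf) auto
  finally show ?thesis .
qed

lemma cochain_add_closed:
  assumes "f \<in> cochains X \<F> i" "g \<in> cochains X \<F> i"
  shows "cochain_add X \<F> i f g \<in> cochains X \<F> i"
proof -
  have "f x \<oplus>\<^bsub>stalk \<F> x\<^esub> g x \<in> carrier (stalk \<F> x)" if x: "x \<in> cells X i" for x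
  proof -
    interpret abelian_group "stalk \<F> x" using stalk_group x .
    show ?thesis using assms x cochain_closed by blast
  qed
  then show ?thesis
    by (simp add: cochains_def cochain_add_def)
qed

text \<open>By functoriality of restriction, the composite along \<open>v < e < z\<close> depends on
  \<open>e\<close> only through a scalar, so a sum over \<open>e\<close> can be evaluated in
  \<open>R\<close>.\<close>

lemma tr_tr:
  assumes v: "v \<in> cells X i" "v \<le> e" and e: "e \<in> cells X (i + 1)" "e \<le> z" and z: "z \<in> cells X (i + 1 + 1)"
    and u: "u \<in> carrier (stalk \<F> v)"
  shows "tr z e (tr e v u) = (\<sigma> z e \<otimes>\<^bsub>R\<^esub> \<sigma> e v) \<odot>\<^bsub>stalk \<F> z\<^esub> res \<F> z v u"
proof -
  interpret Z: module R "stalk \<F> z" using stalk_module z cells_faces by blast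
  have s: "\<sigma> z e \<in> carrier R" "\<sigma> e v \<in> carrier R"
    using orientation_closed[OF e(1) z e(2)] orientation_closed[OF v(1) e(1) v(2)] .
  have lt: "v < e" "e < z"
    using strictly_below_cells[OF v(1) e(1)] strictly_below_cells[OF e(1) z] v e by simp_all
  have f: "v \<in> faces X" "e \<in> faces X" "z \<in> faces X"
    using v e z cells_faces by auto
  have ev: "res \<F> e v u \<in> carrier (stalk \<F> e)" and zv: "res \<F> z v u \<in> carrier (stalk \<F> z)"
    using res_linear f lt u order_less_trans[OF lt] by (auto simp: linear_maps_def Pi_iff)
  have "res \<F> z e (\<sigma> e v \<odot>\<^bsub>stalk \<F> e\<^esub> res \<F> e v u) = \<sigma> e v \<odot>\<^bsub>stalk \<F> z\<^esub> res \<F> z e (res \<F> e v u)"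
    using res_linear[OF f(2,3) lt(2)] ev s by (auto simp: linear_maps_def)
  also have "res \<F> z e (res \<F> e v u) = res \<F> z v u"
    using sheaf f lt u unfolding is_sheaf_def by blast
  finally show ?thesis
    using s zv by (simp add: tr_def Z.smult_assoc1)
qed

text \<open>The axiom on orientations sums over an open interval; when the dimensions differ by two,
  this is the set of faces in the middle dimension.\<close>

lemma orientation_sum:
  assumes v: "v \<in> cells X i" "v \<le> z" and z: "z \<in> cells X (i + 1 + 1)"
  shows "(\<Oplus>\<^bsub>R\<^esub> e \<in> {e \<in> cells X (i + 1). v \<le> e \<and> e \<le> z}. \<sigma> z e \<otimes>\<^bsub>R\<^esub> \<sigma> e v) = \<zero>\<^bsub>R\<^esub>"
proof -
  have "{e \<in> cells X (i + 1). v \<le> e \<and> e \<le> z} = {y \<in> faces X. v < y \<and> y < z}"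
  proof (intro equalityI subsetI)
    fix e assume "e \<in> {y \<in> faces X. v < y \<and> y < z}"
    then show "e \<in> {e \<in> cells X (i + 1). v \<le> e \<and> e \<le> z}"
      using gdim_strict[of v e] gdim_strict[of e z] v z by (auto simp: cells_def)
  next
    fix e assume "e \<in> {e \<in> cells X (i + 1). v \<le> e \<and> e \<le> z}"
    then show "e \<in> {y \<in> faces X. v < y \<and> y < z}"
      using strictly_below_cells[OF v(1), of e "i + 1"] strictly_below_cells[of e "i + 1", OF _ z] cells_faces
      by auto
  qed
  moreover have "gdim X z = gdim X v + 2"
    using v z cells_gdim by fastforce
  ultimately show ?thesis
    using orientation v z cells_faces unfolding is_orientation_def by auto
qed

text \<open>This is d d = 0. Once the sums are interchanged, the coefficient of each restricted
  value \<open>f v\<close> is the orientation sum between \<open>v\<close> and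
  \<open>z\<close>.\<close>

lemma cobd_cobd:
  assumes f: "f \<in> cochains X \<F> i" and z: "z \<in> cells X (i + 1 + 1)"
  shows "(\<Oplus>\<^bsub>stalk \<F> z\<^esub> e \<in> subfaces X z (i + 1). tr z e (cobd X \<sigma> \<F> i f e)) = \<zero>\<^bsub>stalk \<F> z\<^esub>"
proof -
  interpret Z: module R "stalk \<F> z" using stalk_module z cells_faces by blast
  let ?M = "stalk \<F> z"
  let ?E = "subfaces X z (i + 1)" and ?V = "subfaces X z i"
  define c where "c e v = \<sigma> z e \<otimes>\<^bsub>R\<^esub> \<sigma> e v" for e v
  define r where "r v = res \<F> z v (f v)" for v
  \<comment> \<open>Padding with zeros where \<open>v \<le> e\<close> fails turns the index set into
    a product, so that the sums can be interchanged.\<close>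
  define t where "t e v = (if v \<le> e then c e v \<odot>\<^bsub>?M\<^esub> r v else \<zero>\<^bsub>?M\<^esub>)" for e v
  have E: "e \<in> cells X (i + 1)" "e \<le> z" if "e \<in> ?E" for e
    using that by (auto simp: subfaces_def)
  have V: "v \<in> cells X i" "v \<le> z" if "v \<in> ?V" for v
    using that by (auto simp: subfaces_def)
  have r: "r v \<in> carrier ?M" if "v \<in> ?V" for v
    unfolding r_def
    using res_linear[of v z] strictly_below_cells[of v i z "i + 1 + 1"] V[OF that] z cells_faces
      cochain_closed[OF f] by (auto simp: linear_maps_def)
  have c: "c e v \<in> carrier R" if "e \<in> ?E" "v \<in> ?V" "v \<le> e" for e v
    unfolding c_def using orientation_closed[OF V(1) E(1)] orientation_closed[OF E(1) z E(2)] that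
    by (intro m_closed) auto
  have t: "t e v \<in> carrier ?M" if "e \<in> ?E" "v \<in> ?V" for e v
    using c r that by (simp add: t_def)
  have "(\<Oplus>\<^bsub>?M\<^esub> e \<in> ?E. tr z e (cobd X \<sigma> \<F> i f e)) = (\<Oplus>\<^bsub>?M\<^esub> e \<in> ?E. \<Oplus>\<^bsub>?M\<^esub> v \<in> ?V. t e v)"
  proof (intro Z.finsum_cong')
    fix e assume e: "e \<in> ?E"
    have sub: "subfaces X e i \<subseteq> ?V"
      using E[OF e] by (auto simp: subfaces_def)
    have ve: "v \<in> cells X i" "v \<le> e" "v \<in> ?V" if "v \<in> subfaces X e i" for v
      using that sub by (auto simp: subfaces_def)
    have "tr z e (cobd X \<sigma> \<F> i f e) = (\<Oplus>\<^bsub>?M\<^esub> v \<in> subfaces X e i. tr z e (tr e v (f v)))"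
      unfolding cobd_apply[OF E(1)[OF e]]
    proof (rule linear_maps_finsum)
      show "Module.module R (stalk \<F> e)"
        using stalk_module cells_faces[OF E(1)[OF e]] .
      show "tr z e \<in> linear_maps R (stalk \<F> e) ?M"
        using tr_linear[OF E(1)[OF e] z E(2)[OF e]] .
      show "tr e v (f v) \<in> carrier (stalk \<F> e)" if "v \<in> subfaces X e i" for v
        using tr_closed[OF ve(1) E(1)[OF e] ve(2)] that cochain_closed[OF f ve(1)] by blast
    qed (use Z.module_axioms in auto)
    also have "\<dots> = (\<Oplus>\<^bsub>?M\<^esub> v \<in> ?V. t e v)"
    proof (intro Z.add.finprod_mono_neutral_cong_left)
      fix v assume v: "v \<in> subfaces X e i"
      show "tr z e (tr e v (f v)) = t e v"
        using tr_tr[OF ve(1,2)[OF v] E[OF e] z cochain_closed[OF f ve(1)[OF v]]] ve[OF v]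
        by (simp add: t_def c_def r_def)
    next
      fix v assume "v \<in> ?V - subfaces X e i"
      then have "\<not> v \<le> e" by (auto simp: subfaces_def)
      then show "t e v = \<zero>\<^bsub>?M\<^esub>" by (simp add: t_def)
    qed (use t e sub in auto)
    finally show "tr z e (cobd X \<sigma> \<F> i f e) = (\<Oplus>\<^bsub>?M\<^esub> v \<in> ?V. t e v)" .
  qed (use t in auto)
  also have "\<dots> = (\<Oplus>\<^bsub>?M\<^esub> v \<in> ?V. \<Oplus>\<^bsub>?M\<^esub> e \<in> ?E. t e v)"
    using t by (intro Z.finsum_swap) auto
  also have "\<dots> = (\<Oplus>\<^bsub>?M\<^esub> v \<in> ?V. \<zero>\<^bsub>?M\<^esub>)"
  proof (intro Z.finsum_cong' refl)
    fix v assume v: "v \<in> ?V"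
    let ?Ev = "{e \<in> cells X (i + 1). v \<le> e \<and> e \<le> z}"
    have Ev: "e \<in> ?E" "v \<le> e" if "e \<in> ?Ev" for e
      using that by (auto simp: subfaces_def)
    have "(\<Oplus>\<^bsub>?M\<^esub> e \<in> ?E. t e v) = (\<Oplus>\<^bsub>?M\<^esub> e \<in> ?Ev. c e v \<odot>\<^bsub>?M\<^esub> r v)"
      using t v by (intro Z.add.finprod_mono_neutral_cong_right) (auto simp: t_def subfaces_def)
    also have "\<dots> = (\<Oplus>\<^bsub>R\<^esub> e \<in> ?Ev. c e v) \<odot>\<^bsub>?M\<^esub> r v"
    proof (rule Z.finsum_smult_rdistr[symmetric])
      show "(\<lambda>e. c e v) \<in> ?Ev \<rightarrow> carrier R"
        using c[OF Ev(1) v Ev(2)] by blast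
    qed (use r[OF v] in auto)
    also have "(\<Oplus>\<^bsub>R\<^esub> e \<in> ?Ev. c e v) = \<zero>\<^bsub>R\<^esub>"
      unfolding c_def using orientation_sum V[OF v] z by blast
    finally show "(\<Oplus>\<^bsub>?M\<^esub> e \<in> ?E. t e v) = \<zero>\<^bsub>?M\<^esub>"
      using r[OF v] by simp
  qed auto
  also have "\<dots> = \<zero>\<^bsub>?M\<^esub>"
    by simp
  finally show ?thesis .
qed

end

section \<open>Cancelling edges forced by expansion of links\<close>

section \<open>Local expansion\<close>

lemma (in abelian_monoid) finsum_nonzero_witness:
  assumes "(\<Oplus>b \<in> B. t b) \<noteq> \<zero>"
  obtains b where "b \<in> B" "t b \<noteq> \<zero>"
  using assms add.finprod_one_eqI[of B t] by blast

text \<open>If all terms outside \<open>S\<close> vanished, the two sums would agree. Applied to d d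
  f = 0, this produces the cancelling edge of a witness.\<close>

lemma (in abelian_monoid) finsum_zero_other:
  assumes "finite B" "S \<subseteq> B" "t \<in> B \<rightarrow> carrier G" "(\<Oplus>b \<in> B. t b) = \<zero>" "(\<Oplus>b \<in> S. t b) \<noteq> \<zero>"
  obtains b where "b \<in> B - S" "t b \<noteq> \<zero>"
  using assms add.finprod_mono_neutral_cong_left[of B S t t] by auto

lemma wdist_set_lower:
  assumes "S \<noteq> {}" "\<And>g. g \<in> S \<Longrightarrow> c \<le> wdist X w \<F> i f g"
  shows "c \<le> wdist_set X w \<F> i f S"
  unfolding wdist_set_def using assms by (intro cINF_greatest) auto

text \<open>\<open>cbe\<close> is a supremum that might not be attained, but a failure of the
  inequality at \<open>\<epsilon>\<close> would persist for slightly smaller coefficients.\<close>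

lemma cbe_lower:
  assumes "ereal \<epsilon> \<le> cbe X w \<sigma> \<F> i" "f \<in> cochains X \<F> i"
    and "0 \<le> wdist_set X w \<F> i f (coboundaries X \<sigma> \<F> i)"
  shows "\<epsilon> * wdist_set X w \<F> i f (coboundaries X \<sigma> \<F> i) \<le> wnorm X w \<F> (i + 1) (cobd X \<sigma> \<F> i f)"
    (is "\<epsilon> * ?D \<le> ?N")
proof (rule ccontr)
  assume less: "\<not> \<epsilon> * ?D \<le> ?N"
  \<comment> \<open>For positive \<open>?D\<close> every \<open>\<mu> > ?N / ?D\<close> violates the
    inequality. For \<open>?D = 0\<close> the failure means \<open>?N < 0\<close>, so every
    \<open>\<mu>\<close> violates it and any number below \<open>\<epsilon>\<close> will do.\<close>
  define r where "r = (if ?D = 0 then \<epsilon> - 1 else ?N / ?D)"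
  have "r < \<epsilon>"
    using less assms(3) by (simp add: r_def divide_less_eq)
  then have "ereal r < cbe X w \<sigma> \<F> i"
    using assms(1) less_le_trans[of "ereal r" "ereal \<epsilon>"] by simp
  then obtain \<mu> where \<mu>: "r < \<mu>" "\<mu> * ?D \<le> ?N"
    unfolding cbe_def less_Sup_iff using assms(2) by auto
  then show False
    using less assms(3) by (auto simp: r_def divide_less_eq split: if_splits)
qed

context sheaf_dposet
begin

lemma sum_lw_mono:
  assumes "S \<subseteq> T" "finite T"
  shows "sum (link_weight d X w u) S \<le> sum (link_weight d X w u) T"
  using assms link_weight_nonneg by (intro sum_mono2) auto

lemma wnorm_link: "u \<in> cells X p \<Longrightarrow>
    wnorm (link X u) w' \<F> i g = sum w' {x \<in> cells X (i + p + 1). u \<le> x \<and> g x \<noteq> \<zero>\<^bsub>stalk \<F> x\<^esub>}"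
  unfolding wnorm_def by (auto simp: cells_link intro!: sum.cong)

lemma cobd_link_apply:
  assumes "u \<in> cells X p" "y \<in> cells X (i + 1 + p + 1)" "u \<le> y"
  shows "cobd (link X u) \<sigma> \<F> i g y =
    (\<Oplus>\<^bsub>stalk \<F> y\<^esub> x \<in> {x \<in> cells X (i + p + 1). u \<le> x \<and> x \<le> y}. tr y x (g x))"
proof -
  have "y \<in> cells (link X u) (i + 1)"
    using assms by (simp add: cells_link)
  moreover have "subfaces (link X u) y i = {x \<in> cells X (i + p + 1). u \<le> x \<and> x \<le> y}"
    using assms(1) by (auto simp: subfaces_def cells_link)
  ultimately show ?thesis
    by (simp add: cobd_def tr_def)
qed

lemma cells_link_minus_one: "u \<in> cells X p \<Longrightarrow> cells (link X u) (-1) = {u}"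
  using eq_of_same_gdim by (auto simp: cells_link)

lemma cochains_link_minus_one:
  assumes "u \<in> cells X p" "c \<in> carrier (stalk \<F> u)"
  shows "(\<lambda>x \<in> {u}. c) \<in> cochains (link X u) \<F> (-1)"
  using assms by (simp add: cochains_def cells_link_minus_one)

text \<open>Only \<open>u\<close> has dimension -1 in its link, so the sum over subfaces has a
  single term.\<close>

lemma cobd_link_minus_one:
  assumes "u \<in> cells X p" "y \<in> cells X (p + 1)" "u \<le> y" "g u \<in> carrier (stalk \<F> u)"
  shows "cobd (link X u) \<sigma> \<F> (-1) g y = tr y u (g u)"
proof -
  interpret abelian_group "stalk \<F> y" using stalk_group assms(2) .
  have "{x \<in> cells X (-1 + p + 1). u \<le> x \<and> x \<le> y} = {u}"
    using assms eq_of_same_gdim[of u p] by auto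
  then have "cobd (link X u) \<sigma> \<F> (-1) g y = (\<Oplus>\<^bsub>stalk \<F> y\<^esub> x \<in> {u}. tr y x (g x))"
    using cobd_link_apply[OF assms(1), of y "-1" g] assms by simp
  also have "\<dots> = tr y u (g u)"
    using tr_closed[OF assms] by (subst finsum_insert) auto
  finally show ?thesis .
qed

lemma minus_zero_stalk:
  assumes "x \<in> cells X i" "a \<in> carrier (stalk \<F> x)"
  shows "a \<ominus>\<^bsub>stalk \<F> x\<^esub> \<zero>\<^bsub>stalk \<F> x\<^esub> = a"
proof -
  interpret abelian_group "stalk \<F> x" using stalk_group assms(1) .
  show ?thesis using assms(2) by (simp add: minus_eq)
qed

text \<open>The only \<open>(-1)\<close>-coboundary of a link is zero, since links have no faces of dimension \<open>-2\<close>.\<close>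

lemma link_expansion_minus_one:
  assumes u: "u \<in> cells X p" and c: "c \<in> carrier (stalk \<F> u)" "c \<noteq> \<zero>\<^bsub>stalk \<F> u\<^esub>"
    and exp: "ereal \<epsilon> \<le> cbe (link X u) (link_weight d X w u) \<sigma> \<F> (-1)"
  shows "\<epsilon> \<le> sum (link_weight d X w u) {y \<in> cells X (p + 1). u \<le> y \<and> tr y u c \<noteq> \<zero>\<^bsub>stalk \<F> y\<^esub>}"
proof -
  let ?h = "\<lambda>x \<in> {u}. c" and ?lw = "link_weight d X w u"
  let ?B = "coboundaries (link X u) \<sigma> \<F> (-1)"
  have empty: "cells (link X u) (-2) = {}"
    using u gdim_mono[of u] cells_faces cells_gdim by (fastforce simp: cells_link)
  have B: "wdist (link X u) ?lw \<F> (-1) ?h b = 1" if "b \<in> ?B" for b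
  proof -
    obtain g where "b = cobd (link X u) \<sigma> \<F> (-2) g"
      using \<open>b \<in> ?B\<close> by (auto simp: coboundaries_def)
    then have "b u = \<zero>\<^bsub>stalk \<F> u\<^esub>"
      using abelian_group.axioms(1)[OF stalk_group[OF u]]
      by (simp add: cobd_def cells_link_minus_one[OF u] subfaces_def empty abelian_monoid.finsum_empty)
    then have "cochain_diff (link X u) \<F> (-1) ?h b u = c"
      using minus_zero_stalk[OF u c(1)] by (simp add: cochain_diff_def cells_link_minus_one[OF u])
    then show ?thesis
      using c(2) link_weight_self[OF u]
      by (simp add: wdist_def wnorm_def cells_link_minus_one[OF u] conj_commute cong: conj_cong)
  qed
  \<comment> \<open>The (-2)-cochains form a singleton, consisting of the function on the empty
    index set, so the infimum defining the distance is over a nonempty set.\<close>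
  have "?B \<noteq> {}"
    by (simp add: coboundaries_def cochains_def empty)
  then have ge: "1 \<le> wdist_set (link X u) ?lw \<F> (-1) ?h ?B"
    using B by (intro wdist_set_lower) auto
  moreover have "wdist_set (link X u) ?lw \<F> (-1) ?h ?B = 1"
    unfolding wdist_set_def using B \<open>?B \<noteq> {}\<close> by simp
  ultimately have "\<epsilon> * 1 \<le> wnorm (link X u) ?lw \<F> (-1 + 1) (cobd (link X u) \<sigma> \<F> (-1) ?h)"
    using cbe_lower[OF exp cochains_link_minus_one[OF u c(1)]] by simp
  also have "\<dots> = sum ?lw {y \<in> cells X (p + 1). u \<le> y \<and> tr y u c \<noteq> \<zero>\<^bsub>stalk \<F> y\<^esub>}"
    unfolding wnorm_link[OF u] using cobd_link_minus_one[OF u, of _ ?h] c(1)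
    by (intro sum.cong) auto
  finally show ?thesis by simp
qed

definition nonzero_edges :: "('a \<Rightarrow> 'm) \<Rightarrow> 'a set" where
  "nonzero_edges f = {e \<in> cells X 1. cobd X \<sigma> \<F> 0 f e \<noteq> \<zero>\<^bsub>stalk \<F> e\<^esub>}"

lemma wnorm_cobd: "wnorm X w \<F> 1 (cobd X \<sigma> \<F> 0 f) = sum w (nonzero_edges f)"
  by (simp add: wnorm_def nonzero_edges_def)

lemma nonzero_edges_cells: "nonzero_edges f \<subseteq> cells X 1"
  by (auto simp: nonzero_edges_def)

lemma cobd_0_closed:
  "f \<in> cochains X \<F> 0 \<Longrightarrow> e \<in> cells X 1 \<Longrightarrow> cobd X \<sigma> \<F> 0 f e \<in> carrier (stalk \<F> e)"
  using cobd_closed[of f 0 e] by simp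

lemma cobd_cobd_0:
  assumes "f \<in> cochains X \<F> 0" "z \<in> cells X 2"
  shows "(\<Oplus>\<^bsub>stalk \<F> z\<^esub> e \<in> subfaces X z 1. tr z e (cobd X \<sigma> \<F> 0 f e)) = \<zero>\<^bsub>stalk \<F> z\<^esub>"
  using cobd_cobd[of f 0 z] assms by simp

text \<open>The full sum over the edges of \<open>z\<close> vanishes by d d f = 0. A nonzero part
  has a nonzero term inside and needs a nonzero term outside to cancel it; both come from edges
  where df is nonzero.\<close>

lemma other_nonzero_edge:
  assumes f: "f \<in> cochains X \<F> 0" and z: "z \<in> cells X 2" and S: "S \<subseteq> subfaces X z 1"
    and nz: "(\<Oplus>\<^bsub>stalk \<F> z\<^esub> e \<in> S. tr z e (cobd X \<sigma> \<F> 0 f e)) \<noteq> \<zero>\<^bsub>stalk \<F> z\<^esub>"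
  shows "\<exists>e \<in> S. e \<in> nonzero_edges f" "\<exists>e \<in> subfaces X z 1 - S. e \<in> nonzero_edges f"
proof -
  interpret abelian_group "stalk \<F> z" using stalk_group z .
  have sub: "e \<in> cells X 1" "e \<le> z" if "e \<in> subfaces X z 1" for e
    using that by (auto simp: subfaces_def)
  have zero: "cobd X \<sigma> \<F> 0 f e \<noteq> \<zero>\<^bsub>stalk \<F> e\<^esub>"
    if "e \<in> subfaces X z 1" "tr z e (cobd X \<sigma> \<F> 0 f e) \<noteq> \<zero>\<^bsub>stalk \<F> z\<^esub>" for e
    using that sub[of e] tr_zero[of e 1 z] z by auto
  have closed: "tr z e (cobd X \<sigma> \<F> 0 f e) \<in> carrier (stalk \<F> z)" if "e \<in> subfaces X z 1" for e
    using tr_closed[of e 1 z] sub[OF that] z cobd_0_closed[OF f] by simp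
  obtain e where "e \<in> S" "tr z e (cobd X \<sigma> \<F> 0 f e) \<noteq> \<zero>\<^bsub>stalk \<F> z\<^esub>"
    using finsum_nonzero_witness[OF nz] .
  then show "\<exists>e \<in> S. e \<in> nonzero_edges f"
    using zero sub S unfolding nonzero_edges_def by blast
  obtain e' where "e' \<in> subfaces X z 1 - S" "tr z e' (cobd X \<sigma> \<F> 0 f e') \<noteq> \<zero>\<^bsub>stalk \<F> z\<^esub>"
    using finsum_zero_other[OF _ S _ cobd_cobd_0[OF f z] nz] closed by auto
  then show "\<exists>e \<in> subfaces X z 1 - S. e \<in> nonzero_edges f"
    using zero sub unfolding nonzero_edges_def by blast
qed

lemma edge_set_nonzero_edges: "0 < (h\<^sub>0 :: real) \<Longrightarrow> edge_set d X w L (nonzero_edges f) h\<^sub>0"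
  using d_ge_2 nonzero_edges_cells weighted_dposet_axioms
  by (simp add: edge_set_def edge_set_axioms_def)

text \<open>The value of df at \<open>e\<close> is a nonzero (-1)-cochain of the link of
  \<open>e\<close>, and expansion keeps it nonzero on triangles of link weight at least
  \<open>\<epsilon>\<close>. In each of these another edge has to cancel it.\<close>

lemma edges_expand:
  assumes f: "f \<in> cochains X \<F> 0" and e: "e \<in> nonzero_edges f" and h: "0 < (h\<^sub>0 :: real)"
    and exp: "ereal \<epsilon> \<le> cbe (link X e) (link_weight d X w e) \<sigma> \<F> (-1)"
  shows "\<epsilon> \<le> sum (link_weight d X w e) (edge_set.edge_witnesses X (nonzero_edges f) e)"
proof -
  interpret E: edge_set d X w L "nonzero_edges f" h\<^sub>0
    using edge_set_nonzero_edges[OF h] .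
  let ?g = "cobd X \<sigma> \<F> 0 f"
  have e1: "e \<in> cells X 1" and nz: "?g e \<noteq> \<zero>\<^bsub>stalk \<F> e\<^esub>"
    using e by (auto simp: nonzero_edges_def)
  have "\<epsilon> \<le> sum (link_weight d X w e) {z \<in> cells X 2. e \<le> z \<and> tr z e (?g e) \<noteq> \<zero>\<^bsub>stalk \<F> z\<^esub>}"
    using link_expansion_minus_one[OF e1 cobd_0_closed[OF f e1] nz exp] by simp
  also have "\<dots> \<le> sum (link_weight d X w e) (E.edge_witnesses e)"
  proof (intro sum_lw_mono subsetI)
    fix z assume "z \<in> {z \<in> cells X 2. e \<le> z \<and> tr z e (?g e) \<noteq> \<zero>\<^bsub>stalk \<F> z\<^esub>}"
    then have z: "z \<in> cells X 2" "e \<le> z" and tz: "tr z e (?g e) \<noteq> \<zero>\<^bsub>stalk \<F> z\<^esub>"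
      by auto
    interpret abelian_group "stalk \<F> z" using stalk_group z(1) .
    have "tr z e (?g e) \<in> carrier (stalk \<F> z)"
      using tr_closed[of e 1 z] e1 z cobd_0_closed[OF f e1] by simp
    then have "(\<Oplus>\<^bsub>stalk \<F> z\<^esub> e \<in> {e}. tr z e (?g e)) \<noteq> \<zero>\<^bsub>stalk \<F> z\<^esub>"
      using tz by (subst finsum_insert) auto
    then have "\<exists>e' \<in> subfaces X z 1 - {e}. e' \<in> nonzero_edges f"
      using e1 z by (intro other_nonzero_edge(2)[OF f]) (auto simp: subfaces_def)
    then show "z \<in> E.edge_witnesses e"
      using z by (auto simp: E.edge_witnesses_def subfaces_def)
  qed (simp add: E.edge_witnesses_def)
  finally show ?thesis .
qed

lemma extend_by_zero_closed:
  assumes "v \<in> cells X 0" "g \<in> cochains (link X v) \<F> (-1)"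
  shows "extend_by_zero X \<F> 0 v g \<in> cochains X \<F> 0"
proof -
  have "(if v \<le> x then g x else \<zero>\<^bsub>stalk \<F> x\<^esub>) \<in> carrier (stalk \<F> x)" if "x \<in> cells X 0" for x
    using that assms eq_of_same_gdim[OF assms(1) that] zero_in_stalk[OF that]
    by (auto simp: cochains_def cells_link_minus_one[OF assms(1)])
  then show ?thesis
    by (simp add: cochains_def extend_by_zero_def)
qed

text \<open>The only vertex above \<open>v\<close> is \<open>v\<close>, so a correction at
  \<open>v\<close> affects df on the edges through \<open>v\<close> alone.\<close>

lemma cobd_extend_by_zero:
  assumes v: "v \<in> cells X 0" and g: "g \<in> cochains (link X v) \<F> (-1)" and e: "e \<in> cells X 1"
  shows "cobd X \<sigma> \<F> 0 (extend_by_zero X \<F> 0 v g) e = (if v \<le> e then tr e v (g v) else \<zero>\<^bsub>stalk \<F> e\<^esub>)"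
proof -
  interpret abelian_group "stalk \<F> e" using stalk_group e .
  let ?g = "extend_by_zero X \<F> 0 v g"
  have sub: "x \<in> cells X 0" "x \<le> e" if "x \<in> subfaces X e 0" for x
    using that by (auto simp: subfaces_def)
  have closed: "tr e x (?g x) \<in> carrier (stalk \<F> e)" if "x \<in> subfaces X e 0" for x
    using tr_closed[of x 0 e] sub[OF that] e cochain_closed[OF extend_by_zero_closed[OF v g]] by simp
  have other: "tr e x (?g x) = \<zero>\<^bsub>stalk \<F> e\<^esub>" if "x \<in> subfaces X e 0" "x \<noteq> v" for x
  proof -
    have "?g x = \<zero>\<^bsub>stalk \<F> x\<^esub>"
      using sub[OF that(1)] that(2) eq_of_same_gdim[OF v] by (auto simp: extend_by_zero_def)
    then show ?thesis
      using tr_zero[of x 0 e] sub[OF that(1)] e by simp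
  qed
  have "cobd X \<sigma> \<F> 0 ?g e = (\<Oplus>\<^bsub>stalk \<F> e\<^esub> x \<in> subfaces X e 0. tr e x (?g x))"
    using cobd_apply[of e 0] e by simp
  also have "\<dots> = (\<Oplus>\<^bsub>stalk \<F> e\<^esub> x \<in> {x \<in> {v}. v \<le> e}. tr e x (?g x))"
    using v closed other by (intro add.finprod_mono_neutral_cong_right) (auto simp: subfaces_def)
  also have "\<dots> = (if v \<le> e then tr e v (g v) else \<zero>\<^bsub>stalk \<F> e\<^esub>)"
  proof (cases "v \<le> e")
    case True
    then have "{x \<in> {v}. v \<le> e} = {v}" by auto
    moreover have "?g v = g v"
      using v by (simp add: extend_by_zero_def)
    ultimately show ?thesis
      using closed[of v] True v finsum_insert[of "{}" v "\<lambda>x. tr e x (?g x)"]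
      by (simp add: subfaces_def)
  qed simp
  finally show ?thesis .
qed

end

context sheaf_dposet
begin

text \<open>A coboundary \<open>b\<close> of the link is a possible correction at \<open>v\<close>:
  subtracting it from df cannot gain more than \<open>q * w v\<close>. After conversion to link
  weights this slack is at most a share \<open>1 - \<tau>\<close> of the heavy star, so df stays at
  distance at least \<open>\<tau> * ?s / L ^ 3\<close> from all coboundaries and the expansion of
  the link in dimension 0 applies.\<close>

lemma vertices_expand:
  assumes f: "f \<in> cochains X \<F> 0" and h: "0 < (h\<^sub>0 :: real)"
    and v: "v \<in> edge_set.heavy d X w (nonzero_edges f) h\<^sub>0"
    and stuck: "\<not> (\<exists>f'. correction_step X w \<sigma> \<F> 0 q f f')"
    and q: "0 \<le> q" "q * L ^ 3 \<le> (1 - \<tau>) * h\<^sub>0" "\<tau> \<le> 1"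
    and exp: "ereal \<epsilon> \<le> cbe (link X v) (link_weight d X w v) \<sigma> \<F> 0" and \<epsilon>: "0 \<le> \<epsilon>" "0 \<le> \<tau>"
  shows "\<epsilon> * \<tau> * sum (link_weight d X w v) (edge_set.star (nonzero_edges f) v)
    \<le> L ^ 3 * sum (link_weight d X w v) (edge_set.vertex_witnesses X (nonzero_edges f) v)"
proof -
  interpret E: edge_set d X w L "nonzero_edges f" h\<^sub>0
    using edge_set_nonzero_edges[OF h] .
  let ?lw = "link_weight d X w v" and ?df = "cobd X \<sigma> \<F> 0 f"
  let ?s = "sum ?lw (E.star v)"
  have v0: "v \<in> cells X 0" and heavy: "h\<^sub>0 \<le> ?s"
    using v by (auto simp: E.heavy_def)
  have wv: "0 < w v"
    using v0 w_pos cells_faces by blast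
  let ?g = "\<lambda>e \<in> cells (link X v) 0. ?df e"
  let ?B = "coboundaries (link X v) \<sigma> \<F> 0"
  have g: "?g \<in> cochains (link X v) \<F> 0"
    using cobd_0_closed[OF f] by (auto simp: cochains_def cells_link[OF v0])
  have L3: "0 < L ^ 3"
    using L_ge_1 by simp
  have lower: "\<tau> * ?s / L ^ 3 \<le> wdist (link X v) ?lw \<F> 0 ?g b" if b: "b \<in> ?B" for b
  proof -
    obtain k where k: "k \<in> cochains (link X v) \<F> (-1)" and b_eq: "b = cobd (link X v) \<sigma> \<F> (-1) k"
      using b by (auto simp: coboundaries_def)
    have kv: "k v \<in> carrier (stalk \<F> v)"
      using k by (auto simp: cochains_def cells_link_minus_one[OF v0])
    define B where "B = {e \<in> cells X 1. v \<le> e \<and> ?df e \<ominus>\<^bsub>stalk \<F> e\<^esub> tr e v (k v) \<noteq> \<zero>\<^bsub>stalk \<F> e\<^esub>}"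
    have b_val: "b e = tr e v (k v)" if "e \<in> cells X 1" "v \<le> e" for e
      using cobd_link_minus_one[OF v0, of e k] that kv by (simp add: b_eq)
    have dist: "wdist (link X v) ?lw \<F> 0 ?g b = sum ?lw B"
      unfolding wdist_def wnorm_link[OF v0] B_def using b_val
      by (auto simp: cochain_diff_def cells_link[OF v0] intro!: sum.cong)
    \<comment> \<open>The algorithm adds its correction whereas the distance to \<open>b\<close>
      subtracts, hence the sign.\<close>
    let ?k = "\<lambda>x \<in> {v}. \<ominus>\<^bsub>stalk \<F> v\<^esub> k v"
    let ?ext = "extend_by_zero X \<F> 0 v ?k"
    have kc: "\<ominus>\<^bsub>stalk \<F> v\<^esub> k v \<in> carrier (stalk \<F> v)"
      using abelian_group.a_inv_closed[OF stalk_group[OF v0] kv] .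
    have k': "?k \<in> cochains (link X v) \<F> (-1)"
      using cochains_link_minus_one[OF v0 kc] .
    let ?C = "{e \<in> cells X 1. cochain_add X \<F> 1 ?df (cobd X \<sigma> \<F> 0 ?ext) e \<noteq> \<zero>\<^bsub>stalk \<F> e\<^esub>}"
    have "\<not> wnorm X w \<F> 1 (cochain_add X \<F> 1 ?df (cobd X \<sigma> \<F> 0 ?ext)) < wnorm X w \<F> 1 ?df - q * w v"
    proof
      assume "wnorm X w \<F> 1 (cochain_add X \<F> 1 ?df (cobd X \<sigma> \<F> 0 ?ext)) < wnorm X w \<F> 1 ?df - q * w v"
      then have "correction_step X w \<sigma> \<F> 0 q f (cochain_add X \<F> 0 f ?ext)"
        unfolding correction_step_def using v0 k' cells_faces[OF v0] cells_gdim[OF v0]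
        by (intro bexI[of _ v] conjI bexI[of _ ?k]) auto
      then show False
        using stuck by blast
    qed
    then have "sum w (nonzero_edges f) - q * w v \<le> sum w ?C"
      by (simp add: wnorm_cobd[symmetric] wnorm_def)
    \<comment> \<open>After the correction, df can be nonzero only on \<open>B\<close> among the
      edges through \<open>v\<close>, and as before on the edges away from \<open>v\<close>.\<close>
    also have "\<dots> \<le> sum w (B \<union> (nonzero_edges f - E.star v))"
    proof (intro sum_mono2 subsetI)
      fix e assume "e \<in> ?C"
      then have e: "e \<in> cells X 1"
        and nz: "?df e \<oplus>\<^bsub>stalk \<F> e\<^esub> cobd X \<sigma> \<F> 0 ?ext e \<noteq> \<zero>\<^bsub>stalk \<F> e\<^esub>"
        by (auto simp: cochain_add_def)
      interpret abelian_group "stalk \<F> e" using stalk_group e .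
      have dfe: "?df e \<in> carrier (stalk \<F> e)"
        using cobd_0_closed[OF f e] .
      show "e \<in> B \<union> (nonzero_edges f - E.star v)"
      proof (cases "v \<le> e")
        case True
        then have "cobd X \<sigma> \<F> 0 ?ext e = \<ominus>\<^bsub>stalk \<F> e\<^esub> tr e v (k v)"
          using cobd_extend_by_zero[OF v0 k' e] tr_minus[of v 0 e] v0 e kv by simp
        then show ?thesis
          using nz e True by (simp add: B_def minus_eq)
      next
        case False
        then show ?thesis
          using nz e cobd_extend_by_zero[OF v0 k' e] dfe by (simp add: nonzero_edges_def E.star_def[unfolded nonzero_edges_def])
      qed
    qed (use w_cells_nonneg nonzero_edges_cells in \<open>auto simp: B_def E.finite_A\<close>)
    also have "\<dots> \<le> sum w B + sum w (nonzero_edges f - E.star v)"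
    proof -
      have "0 \<le> sum w (B \<inter> (nonzero_edges f - E.star v))"
        by (rule sum_w_nonneg[of _ 1]) (auto simp: B_def)
      then show ?thesis
        using sum.union_inter[of B "nonzero_edges f - E.star v" w] E.finite_A by (simp add: B_def)
    qed
    also have "sum w (nonzero_edges f - E.star v) = sum w (nonzero_edges f) - sum w (E.star v)"
      using E.finite_A by (intro sum_diff) (auto simp: E.star_def)
    finally have star_le: "sum w (E.star v) - q * w v \<le> sum w B"
      by simp
    \<comment> \<open>The scale belongs to the star but not to the slack \<open>q * w v\<close>;
      being at most 1, it can be factored out of both.\<close>
    have l: "0 < link_scale 0 1" "link_scale 0 1 \<le> 1"
    proof -
      show l0: "0 < link_scale 0 1"
        using link_scale_pos d_ge_2 by simp
      have "link_scale 0 1 * 1 \<le> link_scale 0 1 * real (F_min X (-1) 0 1)"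
        using F_min_pos[of "-1" 0 1] d_ge_2 l0 by (intro mult_left_mono) auto
      then show "link_scale 0 1 \<le> 1"
        using link_scale_le(1)[of 0 1] d_ge_2 by simp
    qed
    have "?s * w v - L ^ 3 * q * w v \<le> link_scale 0 1 * L ^ 3 * sum w (E.star v) - L ^ 3 * (link_scale 0 1 * (q * w v))"
    proof (intro diff_mono)
      show "?s * w v \<le> link_scale 0 1 * L ^ 3 * sum w (E.star v)"
        using v0 d_ge_2 E.star_subset by (intro link_weight_sum_le(1)) auto
      have "link_scale 0 1 * (q * w v) \<le> 1 * (q * w v)"
        using l q wv by (intro mult_right_mono) auto
      then show "L ^ 3 * (link_scale 0 1 * (q * w v)) \<le> L ^ 3 * q * w v"
        using L3 by (simp add: mult.assoc)
    qed
    also have "\<dots> = L ^ 3 * (link_scale 0 1 * (sum w (E.star v) - q * w v))"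
      by (simp add: algebra_simps)
    also have "\<dots> \<le> L ^ 3 * (link_scale 0 1 * sum w B)"
      using star_le l L3 by (intro mult_left_mono) auto
    also have "\<dots> \<le> L ^ 3 * (sum ?lw B * w v)"
      using v0 d_ge_2 L3 by (intro mult_left_mono link_weight_sum_le(2)) (auto simp: B_def)
    finally have "(?s - L ^ 3 * q) * w v \<le> (L ^ 3 * sum ?lw B) * w v"
      by (simp add: algebra_simps)
    then have "?s - L ^ 3 * q \<le> L ^ 3 * sum ?lw B"
      using wv by simp
    \<comment> \<open>Heaviness turns the absolute slack into a share of the star.\<close>
    moreover have "L ^ 3 * q \<le> (1 - \<tau>) * ?s"
      using q mult_left_mono[OF heavy, of "1 - \<tau>"] by (simp add: mult.commute)
    ultimately have "\<tau> * ?s \<le> L ^ 3 * sum ?lw B"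
      by (simp add: algebra_simps)
    then show ?thesis
      unfolding dist using L3 by (simp add: divide_le_eq mult.commute)
  qed
  have "(\<lambda>x \<in> {v}. \<zero>\<^bsub>stalk \<F> v\<^esub>) \<in> cochains (link X v) \<F> (-1)"
    using cochains_link_minus_one[OF v0 zero_in_stalk[OF v0]] .
  then have "?B \<noteq> {}"
    by (auto simp: coboundaries_def)
  then have dist: "\<tau> * ?s / L ^ 3 \<le> wdist_set (link X v) ?lw \<F> 0 ?g ?B"
    using lower by (intro wdist_set_lower)
  have s0: "0 \<le> \<tau> * ?s / L ^ 3"
    using \<epsilon> link_weight_nonneg L3 by (intro divide_nonneg_pos mult_nonneg_nonneg sum_nonneg) auto
  have "\<epsilon> * (\<tau> * ?s / L ^ 3) \<le> \<epsilon> * wdist_set (link X v) ?lw \<F> 0 ?g ?B"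
    using dist \<epsilon> by (intro mult_left_mono)
  also have "\<dots> \<le> wnorm (link X v) ?lw \<F> (0 + 1) (cobd (link X v) \<sigma> \<F> 0 ?g)"
    using cbe_lower[OF exp g] dist s0 by simp
  also have "\<dots> \<le> sum ?lw (E.vertex_witnesses v)"
    unfolding wnorm_link[OF v0]
  proof (intro sum_lw_mono subsetI)
    fix z assume "z \<in> {z \<in> cells X (0 + 1 + 0 + 1). v \<le> z \<and> cobd (link X v) \<sigma> \<F> 0 ?g z \<noteq> \<zero>\<^bsub>stalk \<F> z\<^esub>}"
    then have z: "z \<in> cells X 2" "v \<le> z" and nz: "cobd (link X v) \<sigma> \<F> 0 ?g z \<noteq> \<zero>\<^bsub>stalk \<F> z\<^esub>"
      by auto
    interpret abelian_group "stalk \<F> z" using stalk_group z(1) .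
    let ?S = "{e \<in> cells X 1. v \<le> e \<and> e \<le> z}"
    \<comment> \<open>The link coboundary at \<open>z\<close> is the part of the sum for d d f that
      belongs to the edges through \<open>v\<close>. Where it is nonzero, an edge avoiding
      \<open>v\<close> must cancel it.\<close>
    have "cobd (link X v) \<sigma> \<F> 0 ?g z = (\<Oplus>\<^bsub>stalk \<F> z\<^esub> e \<in> ?S. tr z e (?g e))"
      using cobd_link_apply[OF v0, of z 0 ?g] z by simp
    also have "\<dots> = (\<Oplus>\<^bsub>stalk \<F> z\<^esub> e \<in> ?S. tr z e (?df e))"
      using tr_closed[of _ 1 z] z cobd_0_closed[OF f]
      by (intro finsum_cong') (auto simp: cells_link[OF v0])
    finally have nz': "(\<Oplus>\<^bsub>stalk \<F> z\<^esub> e \<in> ?S. tr z e (?df e)) \<noteq> \<zero>\<^bsub>stalk \<F> z\<^esub>"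
      using nz by simp
    have S: "?S \<subseteq> subfaces X z 1"
      by (auto simp: subfaces_def)
    obtain e where "e \<in> ?S" "e \<in> nonzero_edges f"
      using other_nonzero_edge(1)[OF f z(1) S nz'] by blast
    moreover obtain e' where "e' \<in> subfaces X z 1 - ?S" "e' \<in> nonzero_edges f"
      using other_nonzero_edge(2)[OF f z(1) S nz'] by blast
    ultimately show "z \<in> E.vertex_witnesses v"
      using z by (auto simp: E.vertex_witnesses_def E.star_def subfaces_def)
  qed (simp add: E.vertex_witnesses_def)
  finally show ?thesis
    using L3 by (simp add: divide_le_eq mult.commute mult.left_commute)
qed

section \<open>Progress and termination of the corrections\<close>

section \<open>The Correction Algorithm\<close>

lemma cocycles_iff: "f \<in> cocycles X \<sigma> \<F> 0 \<longleftrightarrow> f \<in> cochains X \<F> 0 \<and> nonzero_edges f = {}"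
  by (auto simp: cocycles_def nonzero_edges_def)

lemma wdist_nonneg: "0 \<le> wdist X w \<F> 0 f g"
  unfolding wdist_def wnorm_def using w_cells_nonneg by (intro sum_nonneg) auto

lemma wdist_le_1: "wdist X w \<F> 0 f g \<le> 1"
proof -
  have "wdist X w \<F> 0 f g \<le> sum w (cells X 0)"
    unfolding wdist_def wnorm_def using w_cells_nonneg by (intro sum_mono2) auto
  then show ?thesis
    using sum_w_cells[of 0] by simp
qed

text \<open>A difference of values vanishes exactly where they agree, so the distance is the weight
  of a disagreement set and the triangle inequality becomes an inclusion.\<close>

lemma wdist_alt:
  assumes "f \<in> cochains X \<F> 0" "g \<in> cochains X \<F> 0"
  shows "wdist X w \<F> 0 f g = sum w {x \<in> cells X 0. f x \<noteq> g x}"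
proof -
  have "cochain_diff X \<F> 0 f g x = \<zero>\<^bsub>stalk \<F> x\<^esub> \<longleftrightarrow> f x = g x" if x: "x \<in> cells X 0" for x
  proof -
    interpret abelian_group "stalk \<F> x" using stalk_group x .
    have c: "f x \<in> carrier (stalk \<F> x)" "g x \<in> carrier (stalk \<F> x)"
      using x cochain_closed assms by auto
    have "f x \<ominus>\<^bsub>stalk \<F> x\<^esub> g x = \<zero>\<^bsub>stalk \<F> x\<^esub> \<longleftrightarrow> f x = g x"
      using c by (metis a_inv_closed minus_eq minus_equality minus_minus r_neg)
    then show ?thesis
      using x by (simp add: cochain_diff_def)
  qed
  then show ?thesis
    unfolding wdist_def wnorm_def by (intro sum.cong) auto
qed

lemma wdist_triangle:
  assumes "f \<in> cochains X \<F> 0" "g \<in> cochains X \<F> 0" "k \<in> cochains X \<F> 0"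
  shows "wdist X w \<F> 0 f k \<le> wdist X w \<F> 0 f g + wdist X w \<F> 0 g k"
proof -
  let ?D = "\<lambda>f g. {x \<in> cells X 0. f x \<noteq> g x}"
  have "sum w (?D f k) \<le> sum w (?D f g \<union> ?D g k)"
    using w_cells_nonneg by (intro sum_mono2) auto
  also have "\<dots> \<le> sum w (?D f g) + sum w (?D g k)"
  proof -
    have "0 \<le> sum w (?D f g \<inter> ?D g k)"
      by (rule sum_w_nonneg[of _ 0]) auto
    then show ?thesis
      using sum.union_inter[of "?D f g" "?D g k" w] by simp
  qed
  finally show ?thesis
    using assms by (simp add: wdist_alt)
qed

lemma wdist_set_le:
  "g \<in> S \<Longrightarrow> wdist_set X w \<F> 0 f S \<le> wdist X w \<F> 0 f g"
  unfolding wdist_set_def by (intro cINF_lower bdd_belowI2[of _ 0] wdist_nonneg)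

lemma zero_cocycle: "(\<lambda>x \<in> cells X 0. \<zero>\<^bsub>stalk \<F> x\<^esub>) \<in> cocycles X \<sigma> \<F> 0" (is "?z \<in> _")
proof -
  have z: "?z \<in> cochains X \<F> 0"
    using zero_in_stalk by (simp add: cochains_def)
  have "cobd X \<sigma> \<F> 0 ?z e = \<zero>\<^bsub>stalk \<F> e\<^esub>" if e: "e \<in> cells X 1" for e
  proof -
    interpret abelian_group "stalk \<F> e" using stalk_group e .
    have "cobd X \<sigma> \<F> 0 ?z e = (\<Oplus>\<^bsub>stalk \<F> e\<^esub> x \<in> subfaces X e 0. tr e x (?z x))"
      using cobd_apply[of e 0 ?z] e by simp
    also have "\<dots> = \<zero>\<^bsub>stalk \<F> e\<^esub>"
      using e tr_zero[of _ 0 e] by (intro add.finprod_one_eqI) (auto simp: subfaces_def)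
    finally show ?thesis .
  qed
  then show ?thesis
    using z by (auto simp: cocycles_iff nonzero_edges_def)
qed

text \<open>For \<open>k = 0\<close> the chosen face is a vertex, and \<open>f\<close> changes there
  only. The distance moved is at most \<open>w u\<close>, while the norm of df drops by more than
  \<open>q * w u\<close>.\<close>

lemma correction_step_props:
  assumes f: "f \<in> cochains X \<F> 0" and step: "correction_step X w \<sigma> \<F> 0 q f f'" and q: "0 \<le> q"
  shows "f' \<in> cochains X \<F> 0"
    "q * wdist X w \<F> 0 f f' + sum w (nonzero_edges f') \<le> sum w (nonzero_edges f)"
    "sum w (nonzero_edges f') < sum w (nonzero_edges f)"
proof -
  obtain u g where u: "u \<in> faces X" "0 \<le> gdim X u" "gdim X u \<le> 0"
    and g: "g \<in> cochains (link X u) \<F> (0 - gdim X u - 1)"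
    and less: "wnorm X w \<F> (0 + 1) (cochain_add X \<F> (0 + 1) (cobd X \<sigma> \<F> 0 f)
        (cobd X \<sigma> \<F> 0 (extend_by_zero X \<F> 0 u g))) < wnorm X w \<F> (0 + 1) (cobd X \<sigma> \<F> 0 f) - q * w u"
    and f': "f' = cochain_add X \<F> 0 f (extend_by_zero X \<F> 0 u g)"
    using step unfolding correction_step_def by blast
  have u0: "u \<in> cells X 0"
    using u by (simp add: cells_def)
  let ?ext = "extend_by_zero X \<F> 0 u g"
  have g': "g \<in> cochains (link X u) \<F> (-1)"
    using g cells_gdim[OF u0] by simp
  have ext: "?ext \<in> cochains X \<F> 0"
    using extend_by_zero_closed[OF u0 g'] .
  show f'_closed: "f' \<in> cochains X \<F> 0"
    unfolding f' using cochain_add_closed[OF f ext] .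
  have "cochain_add X \<F> 1 (cobd X \<sigma> \<F> 0 f) (cobd X \<sigma> \<F> 0 ?ext) e = cobd X \<sigma> \<F> 0 f' e"
    if "e \<in> cells X 1" for e
    using cobd_add[OF f ext, of e] that by (simp add: cochain_add_def f')
  then have "wnorm X w \<F> 1 (cochain_add X \<F> 1 (cobd X \<sigma> \<F> 0 f) (cobd X \<sigma> \<F> 0 ?ext))
      = sum w (nonzero_edges f')"
    unfolding wnorm_def nonzero_edges_def by (intro sum.cong) auto
  then have less': "sum w (nonzero_edges f') < sum w (nonzero_edges f) - q * w u"
    using less by (simp add: wnorm_cobd)
  have wu: "0 \<le> w u"
    using w_cells_nonneg[OF u0] .
  have "f x = f' x" if x: "x \<in> cells X 0" "x \<noteq> u" for x
  proof -
    interpret abelian_group "stalk \<F> x" using stalk_group x(1) .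
    have "\<not> u \<le> x"
      using eq_of_same_gdim[OF u0 x(1)] x(2) by blast
    then show ?thesis
      using x cochain_closed[OF f x(1)] by (simp add: f' cochain_add_def extend_by_zero_def)
  qed
  then have "wdist X w \<F> 0 f f' \<le> sum w {u}"
    unfolding wdist_alt[OF f f'_closed] using wu by (intro sum_mono2) auto
  then have "q * wdist X w \<F> 0 f f' \<le> q * w u"
    using q by (intro mult_left_mono) auto
  then show "q * wdist X w \<F> 0 f f' + sum w (nonzero_edges f') \<le> sum w (nonzero_edges f)"
    using less' by simp
  show "sum w (nonzero_edges f') < sum w (nonzero_edges f)"
    using less' mult_nonneg_nonneg[OF q wu] by simp
qed

text \<open>The inequalities for single steps telescope: the distance travelled, times
  \<open>q\<close>, is paid for by the decrease of the norm of df.\<close>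

lemma correction_run_props:
  assumes "(correction_step X w \<sigma> \<F> 0 q)\<^sup>*\<^sup>* f f'" "f \<in> cochains X \<F> 0" "0 \<le> q"
  shows "f' \<in> cochains X \<F> 0 \<and>
    q * wdist X w \<F> 0 f f' + sum w (nonzero_edges f') \<le> sum w (nonzero_edges f)"
  using assms(1)
proof (induction rule: rtranclp_induct)
  case base
  then show ?case
    using assms(2) by (simp add: wdist_alt)
next
  case (step g g')
  then have g: "g \<in> cochains X \<F> 0"
    by blast
  note props = correction_step_props[OF g step.hyps(2) assms(3)]
  have "q * wdist X w \<F> 0 f g' \<le> q * (wdist X w \<F> 0 f g + wdist X w \<F> 0 g g')"
    using wdist_triangle[OF assms(2) g props(1)] assms(3) by (intro mult_left_mono) auto
  then show ?case
    using props step.IH by (simp add: distrib_left)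
qed

text \<open>Stalks may be infinite, but the norm depends only on the support, a subset of the finite
  set X(1).\<close>

lemma finite_norms: "finite (range (\<lambda>f. sum w (nonzero_edges f)))"
proof -
  have "range (\<lambda>f. sum w (nonzero_edges f)) \<subseteq> sum w ` Pow (cells X 1)"
    using nonzero_edges_cells by auto
  then show ?thesis
    by (rule finite_subset) simp
qed

text \<open>Even for \<open>q = 0\<close> the norm of df decreases strictly, and it has finitely
  many possible values.\<close>

lemma correction_terminates:
  assumes f: "f \<in> cochains X \<F> 0" and q: "0 \<le> q"
  shows "correction_terminates X w \<sigma> \<F> 0 q f"
  unfolding correction_terminates_def
proof
  assume "\<exists>s. s 0 = f \<and> (\<forall>i. correction_step X w \<sigma> \<F> 0 q (s i) (s (Suc i)))"
  then obtain s where s: "s 0 = f" "\<And>i. correction_step X w \<sigma> \<F> 0 q (s i) (s (Suc i))"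
    by blast
  have closed: "s i \<in> cochains X \<F> 0" for i
  proof (induction i)
    case (Suc i)
    then show ?case
      using correction_step_props(1)[OF _ s(2) q] by blast
  qed (simp add: s(1) f)
  let ?n = "\<lambda>i. - sum w (nonzero_edges (s i))"
  have "strict_mono ?n"
    using correction_step_props(3)[OF closed s(2) q] by (simp add: strict_mono_Suc_iff)
  then have "infinite (range ?n)"
    using range_inj_infinite strict_mono_imp_inj_on by blast
  moreover have "range ?n \<subseteq> uminus ` range (\<lambda>f. sum w (nonzero_edges f))"
    by auto
  ultimately show False
    using finite_norms finite_subset by blast
qed

text \<open>A reachable cochain of least norm admits no further step. With an output at hand, the
  algorithm also serves to prove cosystolic expansion.\<close>

lemma correction_output_exists:
  assumes f: "f \<in> cochains X \<F> 0" and q: "0 \<le> q"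
  obtains f' where "correction_output X w \<sigma> \<F> 0 q f f'"
proof -
  define S where "S = {f'. (correction_step X w \<sigma> \<F> 0 q)\<^sup>*\<^sup>* f f'}"
  let ?N = "\<lambda>f. sum w (nonzero_edges f)"
  have "?N ` S \<subseteq> range ?N"
    by blast
  then have "finite (?N ` S)" "?N ` S \<noteq> {}"
    using finite_norms finite_subset by (blast, auto simp: S_def)
  then have "Min (?N ` S) \<in> ?N ` S"
    by (rule Min_in)
  then obtain f' where f': "f' \<in> S" "?N f' = Min (?N ` S)"
    by force
  have "\<not> correction_step X w \<sigma> \<F> 0 q f' f''" for f''
  proof
    assume step: "correction_step X w \<sigma> \<F> 0 q f' f''"
    have "f' \<in> cochains X \<F> 0"
      using f'(1) correction_run_props f q by (auto simp: S_def)
    then have "?N f'' < ?N f'"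
      using correction_step_props(3) step q by blast
    moreover have "f'' \<in> S"
      using f'(1) step by (auto simp: S_def)
    then have "?N f' \<le> ?N f''"
      unfolding f'(2) using \<open>finite (?N ` S)\<close> by (intro Min_le) auto
    ultimately show False by simp
  qed
  then show ?thesis
    using that f'(1) by (auto simp: correction_output_def S_def)
qed

text \<open>Where \<open>f\<close> agrees with a cocycle on all vertices of an edge, df vanishes.
  Each vertex of disagreement thus contributes at most the weight of its edges, which is its own
  weight times \<open>L ^ 3\<close> and a face count.\<close>

lemma cobd_Lipschitz:
  assumes f: "f \<in> cochains X \<F> 0" and g: "g \<in> cocycles X \<sigma> \<F> 0"
  shows "sum w (nonzero_edges f) \<le> real (F_max X (-1) 0 1) * L ^ 3 * wdist X w \<F> 0 f g"
proof -
  have g': "g \<in> cochains X \<F> 0" "nonzero_edges g = {}"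
    using g by (auto simp: cocycles_iff)
  let ?V = "{x \<in> cells X 0. f x \<noteq> g x}"
  let ?S = "\<lambda>v. {e \<in> cells X 1. v \<le> e}"
  let ?a = "real (F_max X (-1) 0 1)"
  have star: "sum w (?S v) \<le> ?a * L ^ 3 * w v" if v: "v \<in> cells X 0" for v
  proof -
    have "link_scale 0 1 * sum w (?S v) \<le> sum (link_weight d X w v) (?S v) * w v"
      using v d_ge_2 by (intro link_weight_sum_le(2)) auto
    then have "sum w (?S v) \<le> L ^ 3 * ?a * w v"
      using link_weight_sum[OF v, of 1] d_ge_2 by (intro sum_w_le_of_scaled) auto
    then show ?thesis
      by (simp add: mult.commute)
  qed
  have "nonzero_edges f \<subseteq> (\<Union>v \<in> ?V. ?S v)"
  proof
    fix e assume "e \<in> nonzero_edges f"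
    then have e: "e \<in> cells X 1" and nz: "cobd X \<sigma> \<F> 0 f e \<noteq> \<zero>\<^bsub>stalk \<F> e\<^esub>"
      by (auto simp: nonzero_edges_def)
    interpret abelian_group "stalk \<F> e" using stalk_group e .
    have "\<exists>v \<in> subfaces X e 0. f v \<noteq> g v"
    proof (rule ccontr)
      assume "\<not> ?thesis"
      then have "cobd X \<sigma> \<F> 0 f e = cobd X \<sigma> \<F> 0 g e"
        using cobd_apply[of e 0 f] cobd_apply[of e 0 g] e tr_closed[of _ 0 e] cochain_closed[OF g'(1)]
        by (auto simp: subfaces_def intro!: finsum_cong')
      then show False
        using nz g'(2) e by (auto simp: nonzero_edges_def)
    qed
    then show "e \<in> (\<Union>v \<in> ?V. ?S v)"
      using e by (auto simp: subfaces_def)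
  qed
  then have "sum w (nonzero_edges f) \<le> sum w (\<Union>v \<in> ?V. ?S v)"
    using w_cells_nonneg by (intro sum_mono2) auto
  also have "\<dots> \<le> (\<Sum>v \<in> ?V. sum w (?S v))"
    using w_cells_nonneg by (intro sum_UN_le) auto
  also have "\<dots> \<le> (\<Sum>v \<in> ?V. ?a * L ^ 3 * w v)"
    using star by (intro sum_mono) auto
  finally show ?thesis
    using wdist_alt[OF f g'(1)] by (simp add: sum_distrib_left)
qed

section \<open>Cocycle distance\<close>

text \<open>The edges with two vertices in the support \<open>S\<close> are bounded below by local
  expansion, summed over \<open>S\<close>, and above by skeleton expansion. This yields
  \<open>\<epsilon> * sum w S \<le> L ^ 4 * (\<alpha> * sum w S + \<beta> * (sum w
  S)\<^sup>2)\<close>, and \<open>sum w S\<close> is cancelled.\<close>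

lemma cocycle_norm_ge:
  assumes f: "f \<in> cocycles X \<sigma> \<F> 0" "f \<notin> coboundaries X \<sigma> \<F> 0"
    and exp: "\<And>v. v \<in> cells X 0 \<Longrightarrow> ereal \<epsilon> \<le> cbe (link X v) (link_weight d X w v) \<sigma> \<F> (-1)"
    and Gr: "Gr_skeleton_expander X w \<alpha> \<beta>"
  shows "0 < wnorm X w \<F> 0 f" "\<epsilon> \<le> L ^ 4 * (\<alpha> + \<beta> * wnorm X w \<F> 0 f)"
proof -
  have fc: "f \<in> cochains X \<F> 0" and df: "nonzero_edges f = {}"
    using f by (auto simp: cocycles_iff)
  define S where "S = {v \<in> cells X 0. f v \<noteq> \<zero>\<^bsub>stalk \<F> v\<^esub>}"
  define E2 where "E2 = {e \<in> cells X 1. \<exists>x \<in> S. \<exists>y \<in> S. x \<noteq> y \<and> x < e \<and> y < e}"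
  have S_cells: "S \<subseteq> cells X 0"
    by (auto simp: S_def)
  then have finS: "finite S"
    using finite_cells finite_subset by blast
  have norm: "wnorm X w \<F> 0 f = sum w S"
    by (simp add: wnorm_def S_def)
  \<comment> \<open>The zero cochain is the coboundary of the zero (-1)-cochain, so the support of a
    cocycle that is no coboundary is not empty.\<close>
  have "S \<noteq> {}"
  proof
    assume "S = {}"
    define k where "k = (\<lambda>x \<in> cells X (-1). \<zero>\<^bsub>stalk \<F> x\<^esub>)"
    have k: "k \<in> cochains X \<F> (-1)"
      using zero_in_stalk by (simp add: cochains_def k_def)
    have "cobd X \<sigma> \<F> (-1) k = f"
    proof
      fix x
      show "cobd X \<sigma> \<F> (-1) k x = f x"
      proof (cases "x \<in> cells X 0")
        case True
        interpret abelian_group "stalk \<F> x" using stalk_group True .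
        have "cobd X \<sigma> \<F> (-1) k x = (\<Oplus>\<^bsub>stalk \<F> x\<^esub> y \<in> subfaces X x (-1). tr x y (k y))"
          using cobd_apply[of x "-1" k] True by simp
        also have "\<dots> = \<zero>\<^bsub>stalk \<F> x\<^esub>"
          using True tr_zero[of _ "-1" x]
          by (intro add.finprod_one_eqI) (auto simp: subfaces_def k_def)
        also have "\<dots> = f x"
          using True \<open>S = {}\<close> by (simp add: S_def)
        finally show ?thesis .
      next
        \<comment> \<open>Outside X(0) both functions take the default value of extensional
          functions.\<close>
        case False
        then show ?thesis
          using fc by (auto simp: cobd_def cochains_def PiE_def extensional_def)
      qed
    qed
    then show False
      using f(2) k by (auto simp: coboundaries_def)
  qed
  then have WS: "0 < sum w S"
    using finS S_cells w_pos cells_faces by (intro sum_pos) auto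
  then show "0 < wnorm X w \<F> 0 f"
    by (simp add: norm)
  interpret E: edge_set d X w L E2 1
    using d_ge_2 weighted_dposet_axioms by (simp add: edge_set_def edge_set_axioms_def E2_def)
  have each: "\<epsilon> * w v \<le> link_scale 0 1 * L ^ 3 * sum w (E.star v)" if v: "v \<in> S" for v
  proof -
    have v0: "v \<in> cells X 0" and fv: "f v \<noteq> \<zero>\<^bsub>stalk \<F> v\<^esub>" and fvc: "f v \<in> carrier (stalk \<F> v)"
      using v cochain_closed[OF fc] by (auto simp: S_def)
    have "\<epsilon> \<le> sum (link_weight d X w v) {e \<in> cells X 1. v \<le> e \<and> tr e v (f v) \<noteq> \<zero>\<^bsub>stalk \<F> e\<^esub>}"
      using link_expansion_minus_one[OF v0 fvc fv exp[OF v0]] by simp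
    also have "\<dots> \<le> sum (link_weight d X w v) (E.star v)"
    proof (intro sum_lw_mono subsetI)
      fix e assume "e \<in> {e \<in> cells X 1. v \<le> e \<and> tr e v (f v) \<noteq> \<zero>\<^bsub>stalk \<F> e\<^esub>}"
      then have e: "e \<in> cells X 1" "v \<le> e" and nz: "tr e v (f v) \<noteq> \<zero>\<^bsub>stalk \<F> e\<^esub>"
        by auto
      interpret abelian_group "stalk \<F> e" using stalk_group e(1) .
      have closed: "tr e x (f x) \<in> carrier (stalk \<F> e)" if "x \<in> subfaces X e 0" for x
        using that tr_closed[of x 0 e] e cochain_closed[OF fc] by (auto simp: subfaces_def)
      have vs: "v \<in> subfaces X e 0"
        using v0 e by (simp add: subfaces_def)
      have "(\<Oplus>\<^bsub>stalk \<F> e\<^esub> x \<in> {v}. tr e x (f x)) \<noteq> \<zero>\<^bsub>stalk \<F> e\<^esub>"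
        using nz closed[OF vs] by (subst finsum_insert) auto
      moreover have "(\<Oplus>\<^bsub>stalk \<F> e\<^esub> x \<in> subfaces X e 0. tr e x (f x)) = \<zero>\<^bsub>stalk \<F> e\<^esub>"
        using df e cobd_apply[of e 0 f] by (auto simp: nonzero_edges_def)
      ultimately obtain x where x: "x \<in> subfaces X e 0 - {v}" "tr e x (f x) \<noteq> \<zero>\<^bsub>stalk \<F> e\<^esub>"
        using finsum_zero_other[of "subfaces X e 0" "{v}" "\<lambda>x. tr e x (f x)"] closed vs by auto
      then have "x \<in> S"
        using tr_zero[of x 0 e] e by (auto simp: subfaces_def S_def)
      then have "e \<in> E2"
        using v e x strictly_below_cells[OF v0 e(1)] strictly_below_cells[of x 0 e 1]
        by (auto simp: E2_def subfaces_def)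
      then show "e \<in> E.star v"
        using e by (simp add: E.star_def)
    qed (use E.finite_A in \<open>simp add: E.star_def\<close>)
    finally have "\<epsilon> * w v \<le> sum (link_weight d X w v) (E.star v) * w v"
      using w_cells_nonneg[OF v0] by (intro mult_right_mono) auto
    also have "\<dots> \<le> link_scale 0 1 * L ^ 3 * sum w (E.star v)"
      using v0 d_ge_2 E.star_subset by (intro link_weight_sum_le(1)) auto
    finally show ?thesis .
  qed
  have "\<epsilon> * sum w S = (\<Sum>v \<in> S. \<epsilon> * w v)"
    by (simp add: sum_distrib_left)
  also have "\<dots> \<le> (\<Sum>v \<in> S. link_scale 0 1 * L ^ 3 * sum w (E.star v))"
    by (intro sum_mono each)
  also have "\<dots> = link_scale 0 1 * L ^ 3 * (\<Sum>v \<in> S. sum w (E.star v))"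
    by (simp only: sum_distrib_left)
  also have "\<dots> \<le> L ^ 4 * sum w E2"
    by (rule E.scaled_sum_star_le[OF S_cells])
  also have "\<dots> \<le> L ^ 4 * (\<alpha> * sum w S + \<beta> * (sum w S)\<^sup>2)"
    using Gr S_cells L_ge_1 unfolding Gr_skeleton_expander_def E2_def by (intro mult_left_mono) auto
  also have "\<dots> = L ^ 4 * (\<alpha> + \<beta> * sum w S) * sum w S"
    by (simp add: power2_eq_square algebra_simps)
  finally show "\<epsilon> \<le> L ^ 4 * (\<alpha> + \<beta> * wnorm X w \<F> 0 f)"
    using WS by (simp add: norm)
qed

end

section \<open>Conditions on the constants in terms of face counts\<close>

section \<open>The criterion\<close>

text \<open>Face counts enter through three numbers: \<open>K\<close> for the bad triangles,
  \<open>M\<close> for the charging, \<open>\<rho>\<close> for the lower bound on witnesses. They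
  become F, 2F, 1/L in general and m, m, m/2 for m-gons.\<close>

locale face_bounds = sheaf_dposet d X w L R \<sigma> \<F>
  for d and X :: "('a::order) gposet" and w L and R :: "'r ring" and \<sigma> and \<F> :: "('a, 'r, 'm) sheaf" +
  fixes K M \<rho> :: real
  assumes K: "real (F_max X (-1) 0 2) \<le> K" "real (F_max X (-1) 1 2) \<le> K" "1 \<le> K"
    and M: "\<And>z H. z \<in> cells X 2 \<Longrightarrow> H \<subseteq> cells X 0 \<Longrightarrow>
      real (card {v \<in> H. v \<le> z} + card {e \<in> cells X 1. e \<le> z \<and> \<not> (\<exists>v \<in> H. v \<le> e)}) \<le> M"
    and \<rho>: "0 < \<rho>" "\<rho> \<le> real (F_min X (-1) 1 2)"
      "\<rho> * real (F_max X (-1) 0 1) \<le> real (F_min X (-1) 0 2)"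
begin

lemma stuck_is_cocycle:
  assumes f: "f \<in> cochains X \<F> 0"
    and loc: "local_expansion d X w \<sigma> \<F> \<epsilon> \<epsilon>'"
    and skel: "skeleton_expansion d X w \<alpha>\<^sub>0 \<beta>\<^sub>0 \<alpha>\<^sub>m \<beta>\<^sub>m \<alpha>\<^sub>p \<beta>\<^sub>p"
    and nonneg: "0 \<le> \<alpha>\<^sub>0" "0 \<le> \<beta>\<^sub>0" "0 \<le> \<alpha>\<^sub>m" "0 \<le> \<beta>\<^sub>m" "0 \<le> \<alpha>\<^sub>p" "0 \<le> \<beta>\<^sub>p"
    and hs: "0 < h\<^sub>0" "0 < h\<^sub>m" "0 < h\<^sub>p"
    and sum_le: "(\<alpha>\<^sub>0 + \<beta>\<^sub>0 * h\<^sub>0) + (\<alpha>\<^sub>p + \<beta>\<^sub>p * h\<^sub>p) + (\<alpha>\<^sub>m + \<beta>\<^sub>m * h\<^sub>m) / h\<^sub>0 \<le> E' * \<epsilon>'"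
    and E': "2 * M * K * L ^ 16 * E' \<le> \<rho>" and \<epsilon>': "0 < \<epsilon>'"
    and small: "L ^ 4 * sum w (nonzero_edges f) \<le> h\<^sub>0 * h\<^sub>m" "sum w (nonzero_edges f) \<le> h\<^sub>p"
    and stuck: "\<not> (\<exists>f'. correction_step X w \<sigma> \<F> 0 q f f')"
    and q: "0 \<le> q" "2 * q * L ^ 3 < h\<^sub>0"
  shows "f \<in> cocycles X \<sigma> \<F> 0"
proof -
  \<comment> \<open>The share of a heavy star that survives the slack of the algorithm. The
    assumption \<open>2 * q * L ^ 3 < h\<^sub>0\<close> says that it exceeds one half.\<close>
  define \<tau> where "\<tau> = 1 - q * L ^ 3 / h\<^sub>0"
  have qL: "0 \<le> q * L ^ 3"
    using q L_ge_1 by simp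
  have \<tau>: "1 / 2 < \<tau>" "\<tau> \<le> 1" "q * L ^ 3 \<le> (1 - \<tau>) * h\<^sub>0"
    using q hs qL by (simp_all add: \<tau>_def field_simps)
  interpret E: edge_set d X w L "nonzero_edges f" h\<^sub>0
    using edge_set_nonzero_edges[OF hs(1)] .
  have "nonzero_edges f = {}"
  proof (rule E.locally_minimal_empty[OF skel nonneg hs(2,3) small sum_le K M \<rho> E' \<epsilon>' \<tau>(1,2)])
    show "\<epsilon>' \<le> sum (link_weight d X w e) (E.edge_witnesses e)" if e: "e \<in> nonzero_edges f" for e
    proof (rule edges_expand[OF f e hs(1)])
      show "ereal \<epsilon>' \<le> cbe (link X e) (link_weight d X w e) \<sigma> \<F> (-1)"
        using loc subsetD[OF nonzero_edges_cells e] by (simp add: local_expansion_def)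
    qed
    show "\<epsilon>' * \<tau> * sum (link_weight d X w v) (E.star v)
        \<le> L ^ 3 * sum (link_weight d X w v) (E.vertex_witnesses v)" if "v \<in> E.heavy" for v
    proof (rule vertices_expand[OF f hs(1) that stuck q(1) \<tau>(3,2)])
      show "ereal \<epsilon>' \<le> cbe (link X v) (link_weight d X w v) \<sigma> \<F> 0"
        using that loc E.heavy_cells by (auto simp: local_expansion_def)
    qed (use \<epsilon>' \<tau> in auto)
  qed
  then show ?thesis
    using f by (simp add: cocycles_iff)
qed

text \<open>The bound on \<open>cse\<close> and the assertion on the algorithm both follow from one
  fact: once the norm of df is at most \<open>T / L ^ 4\<close>, every output for small
  \<open>q\<close> is a cocycle. \<open>D\<close> makes df small near cocycles, \<open>D''\<close>
  accounts for the distance travelled. The bound on \<open>ccd\<close> is independent of the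
  algorithm.\<close>

lemma criterionI:
  assumes E: "E \<le> 1 / L ^ 4" and E': "2 * M * K * L ^ 16 * E' \<le> \<rho>"
    and E'': "0 \<le> E''" "2 * E'' * L ^ 4 \<le> 1" and E''': "0 \<le> E'''" "E''' \<le> 1"
    and D: "D * real (F_max X (-1) 0 1) * L ^ 7 \<le> 1"
    and D': "0 < D'" "4 * D' * L ^ 3 \<le> 1" and D'': "0 < D''" "D'' * real (F_max X (-1) 0 1) * L ^ 3 \<le> D'"
  shows "criterion E E' E'' E''' D D' D'' d X w \<sigma> \<F>"
  unfolding criterion_def
proof (intro allI impI, elim conjE)
  fix \<epsilon> \<epsilon>' \<alpha>\<^sub>0 \<beta>\<^sub>0 \<alpha>\<^sub>m \<beta>\<^sub>m \<alpha>\<^sub>p \<beta>\<^sub>p h\<^sub>m h\<^sub>0 h\<^sub>p :: real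
  assume \<epsilon>: "0 < \<epsilon>" and \<epsilon>': "0 < \<epsilon>'"
    and nonneg: "0 \<le> \<alpha>\<^sub>0" "0 \<le> \<beta>\<^sub>0" "0 \<le> \<alpha>\<^sub>m" "0 \<le> \<beta>\<^sub>m" "0 \<le> \<alpha>\<^sub>p" "0 \<le> \<beta>\<^sub>p"
    and loc: "local_expansion d X w \<sigma> \<F> \<epsilon> \<epsilon>'"
    and skel: "skeleton_expansion d X w \<alpha>\<^sub>0 \<beta>\<^sub>0 \<alpha>\<^sub>m \<beta>\<^sub>m \<alpha>\<^sub>p \<beta>\<^sub>p"
    and \<alpha>m: "\<alpha>\<^sub>m < E * \<epsilon>"
    and h: "h\<^sub>m \<in> {0<..1}" "h\<^sub>0 \<in> {0<..1}" "h\<^sub>p \<in> {0<..1}"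
    and sum_le: "(\<alpha>\<^sub>0 + \<beta>\<^sub>0 * h\<^sub>0) + (\<alpha>\<^sub>p + \<beta>\<^sub>p * h\<^sub>p) + (\<alpha>\<^sub>m + \<beta>\<^sub>m * h\<^sub>m) / h\<^sub>0 \<le> E' * \<epsilon>'"
  let ?a = "real (F_max X (-1) 0 1)"
  let ?N = "\<lambda>f. sum w (nonzero_edges f)"
  let ?Z = "cocycles X \<sigma> \<F> 0"
  define T where "T = 1 / (1 / h\<^sub>0 * (1 / h\<^sub>m) + 1 / h\<^sub>p)"
  have h': "0 < h\<^sub>m" "0 < h\<^sub>0" "0 < h\<^sub>p" "h\<^sub>m \<le> 1" "h\<^sub>0 \<le> 1" "h\<^sub>p \<le> 1"
    using h by auto
  \<comment> \<open>Half of a harmonic mean is smaller than both numbers, so the single bound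
    \<open>T\<close> covers both smallness conditions.\<close>
  have T: "0 < T" "T < h\<^sub>0 * h\<^sub>m" "T < h\<^sub>p"
  proof -
    have "h\<^sub>0 * h\<^sub>m / (1 + h\<^sub>0 * h\<^sub>m / h\<^sub>p) = T" "h\<^sub>p / (1 + h\<^sub>p / (h\<^sub>0 * h\<^sub>m)) = T"
      unfolding T_def using h' by (simp_all add: field_simps)
    moreover have "x / (1 + y) < x" if "0 < x" "0 < y" for x y :: real
      using that by (simp add: divide_less_eq distrib_left)
    ultimately show "T < h\<^sub>0 * h\<^sub>m" "T < h\<^sub>p"
      using h' by (metis divide_pos_pos mult_pos_pos)+
    show "0 < T"
      unfolding T_def using h' by (intro divide_pos_pos add_pos_pos mult_pos_pos) auto
  qed
  have T_h0: "T < h\<^sub>0"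
    using T(2) mult_left_le[of h\<^sub>m h\<^sub>0] h' by linarith
  have L_pow: "1 \<le> L ^ n" for n
    using L_ge_1 by simp
  have Z_ne: "?Z \<noteq> {}"
    using zero_cocycle by blast
  have output_cocycle: "f' \<in> ?Z \<and> q * wdist X w \<F> 0 f f' \<le> ?N f"
    if f: "f \<in> cochains X \<F> 0" and small: "L ^ 4 * ?N f \<le> T"
      and q: "0 \<le> q" "2 * q * L ^ 3 < h\<^sub>0" and out: "correction_output X w \<sigma> \<F> 0 q f f'" for f f' q
  proof -
    have f': "f' \<in> cochains X \<F> 0" and le: "q * wdist X w \<F> 0 f f' + ?N f' \<le> ?N f"
      and stuck: "\<not> (\<exists>f''. correction_step X w \<sigma> \<F> 0 q f' f'')"
      using correction_run_props[OF _ f q(1), of f'] out by (auto simp: correction_output_def)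
    have N0: "0 \<le> ?N f'" "0 \<le> q * wdist X w \<F> 0 f f'"
      using sum_w_nonneg[OF nonzero_edges_cells] q wdist_nonneg by auto
    have N_le: "?N f' \<le> ?N f"
      using le N0 by simp
    have "L ^ 4 * ?N f' \<le> L ^ 4 * ?N f"
      using N_le L_ge_1 by (intro mult_left_mono) auto
    then have "L ^ 4 * ?N f' \<le> h\<^sub>0 * h\<^sub>m"
      using small T by linarith
    moreover have "?N f' \<le> h\<^sub>p"
      using mult_right_mono[OF L_pow[of 4] N0(1)] \<open>L ^ 4 * ?N f' \<le> L ^ 4 * ?N f\<close> small T by linarith
    ultimately have "f' \<in> ?Z"
      using stuck_is_cocycle[OF f' loc skel nonneg h'(2,1,3) sum_le E' \<epsilon>' _ _ stuck q] by blast
    then show ?thesis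
      using le N0 by simp
  qed
  \<comment> \<open>The algorithm is run with \<open>q = E'' * T\<close>. If the norm of df is at
    least \<open>E'' * T\<close>, the inequality is trivial since distances are at most 1. Otherwise
    df is small enough for the output to be a cocycle, whose distance from \<open>f\<close>, times
    \<open>q\<close>, is at most the norm of df.\<close>
  have "ereal (E'' / (1 / h\<^sub>0 * (1 / h\<^sub>m) + 1 / h\<^sub>p)) \<le> cse X w \<sigma> \<F> 0"
  proof -
    have q: "0 \<le> E'' * T" "2 * (E'' * T) * L ^ 3 < h\<^sub>0"
    proof -
      have "2 * (E'' * T) * L ^ 3 \<le> (2 * (E'' * T) * L ^ 3) * L"
        using E''(1) T(1) L_ge_1 mult_left_mono[OF L_ge_1, of "2 * (E'' * T) * L ^ 3"] by simp
      also have "\<dots> = (2 * E'' * L ^ 4) * T"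
        by (simp add: eval_nat_numeral)
      also have "\<dots> \<le> 1 * T"
        using E''(2) T(1) by (intro mult_right_mono) auto
      finally show "2 * (E'' * T) * L ^ 3 < h\<^sub>0"
        using T_h0 by simp
    qed (use E'' T in auto)
    have "E'' * T * wdist_set X w \<F> 0 f ?Z \<le> ?N f" if f: "f \<in> cochains X \<F> 0" for f
    proof (cases "E'' * T \<le> ?N f")
      case True
      obtain g where "g \<in> ?Z"
        using Z_ne by blast
      then have "wdist_set X w \<F> 0 f ?Z \<le> 1"
        using wdist_set_le wdist_le_1 by (meson order_trans)
      then have "E'' * T * wdist_set X w \<F> 0 f ?Z \<le> E'' * T"
        using q(1) mult_left_le by blast
      then show ?thesis
        using True by simp
    next
      case False
      obtain f' where out: "correction_output X w \<sigma> \<F> 0 (E'' * T) f f'"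
        using correction_output_exists[OF f q(1)] .
      have "L ^ 4 * ?N f \<le> L ^ 4 * (E'' * T)"
        using False L_ge_1 by (intro mult_left_mono) auto
      also have "\<dots> = (E'' * L ^ 4) * T"
        by simp
      also have "\<dots> \<le> 1 * T"
        using E'' T L_ge_1 by (intro mult_right_mono) auto
      finally have "f' \<in> ?Z \<and> E'' * T * wdist X w \<F> 0 f f' \<le> ?N f"
        using output_cocycle[OF f _ q out] by simp
      then show ?thesis
        using mult_left_mono[OF wdist_set_le q(1)] by (meson order_trans)
    qed
    then have "ereal (E'' * T) \<le> cse X w \<sigma> \<F> 0"
      unfolding cse_def using q(1) by (intro Sup_upper) (auto simp: wnorm_cobd)
    then show ?thesis
      by (simp add: T_def)
  qed
  moreover have "(if \<beta>\<^sub>m = 0 then \<infinity> else ereal (E''' * (E * \<epsilon> - \<alpha>\<^sub>m) / \<beta>\<^sub>m)) \<le> ccd X w \<sigma> \<F> 0"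
    unfolding ccd_def
  proof (rule INF_greatest)
    fix f assume f: "f \<in> ?Z - coboundaries X \<sigma> \<F> 0"
    let ?n = "wnorm X w \<F> 0 f"
    have exp: "ereal \<epsilon> \<le> cbe (link X v) (link_weight d X w v) \<sigma> \<F> (-1)" if "v \<in> cells X 0" for v
      using loc that by (simp add: local_expansion_def)
    have Gr: "Gr_skeleton_expander X w \<alpha>\<^sub>m \<beta>\<^sub>m"
      using skel by (simp add: skeleton_expansion_def)
    have n: "0 < ?n" "\<epsilon> \<le> L ^ 4 * (\<alpha>\<^sub>m + \<beta>\<^sub>m * ?n)"
      using cocycle_norm_ge[of f \<epsilon> \<alpha>\<^sub>m \<beta>\<^sub>m] f exp Gr by auto
    have "E * \<epsilon> \<le> 1 / L ^ 4 * \<epsilon>"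
      using E \<epsilon> by (intro mult_right_mono) auto
    also have "\<dots> \<le> \<alpha>\<^sub>m + \<beta>\<^sub>m * ?n"
      using n(2) L_ge_1 by (simp add: divide_le_eq mult.commute)
    finally have le: "E * \<epsilon> - \<alpha>\<^sub>m \<le> \<beta>\<^sub>m * ?n"
      by simp
    show "(if \<beta>\<^sub>m = 0 then \<infinity> else ereal (E''' * (E * \<epsilon> - \<alpha>\<^sub>m) / \<beta>\<^sub>m)) \<le> ereal ?n"
    proof (cases "\<beta>\<^sub>m = 0")
      \<comment> \<open>For \<open>\<beta>\<^sub>m = 0\<close> the inequality contradicts
        \<open>\<alpha>\<^sub>m < E * \<epsilon>\<close>: every cocycle is a coboundary, and the
        infimum over the empty set is infinite.\<close>
      case True
      then show ?thesis
        using le \<alpha>m by simp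
    next
      case False
      then have "0 < \<beta>\<^sub>m"
        using nonneg by simp
      have "E''' * (E * \<epsilon> - \<alpha>\<^sub>m) \<le> 1 * (E * \<epsilon> - \<alpha>\<^sub>m)"
        using E''' \<alpha>m by (intro mult_right_mono) auto
      then show ?thesis
        using le \<open>0 < \<beta>\<^sub>m\<close> by (simp add: divide_le_eq mult.commute)
    qed
  qed
  moreover have "correction_terminates X w \<sigma> \<F> 0 (D' * h\<^sub>0) f \<and>
      (\<forall>f'. correction_output X w \<sigma> \<F> 0 (D' * h\<^sub>0) f f' \<longrightarrow> f' \<in> ?Z \<and>
        wdist X w \<F> 0 f f' \<le> 1 / (D'' * h\<^sub>0) * wdist_set X w \<F> 0 f ?Z)"
    if f: "f \<in> cochains X \<F> 0"
      and close: "wdist_set X w \<F> 0 f ?Z < D / (1 / h\<^sub>0 * (1 / h\<^sub>m) + 1 / h\<^sub>p)" for f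
  proof (intro conjI allI impI)
    let ?\<delta> = "wdist_set X w \<F> 0 f ?Z"
    have close': "?\<delta> < D * T"
      using close by (simp add: T_def)
    have q: "0 \<le> D' * h\<^sub>0" "2 * (D' * h\<^sub>0) * L ^ 3 < h\<^sub>0"
    proof -
      have "2 * D' * L ^ 3 < 1"
        using D' L_pow[of 3] by simp
      then show "2 * (D' * h\<^sub>0) * L ^ 3 < h\<^sub>0"
        using h'(2) mult_strict_right_mono[of "2 * D' * L ^ 3" 1 h\<^sub>0] by (simp add: ac_simps)
    qed (use D' h' in auto)
    show "correction_terminates X w \<sigma> \<F> 0 (D' * h\<^sub>0) f"
      using correction_terminates[OF f q(1)] .
    have a: "0 < ?a"
      using F_min_pos[of "-1" 0 1] F_min_le_F_max[of "-1" 0 1] d_ge_2 by simp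
    have aL: "0 < ?a * L ^ 3"
      using a L_ge_1 by (intro mult_pos_pos) auto
    \<comment> \<open>The Lipschitz bound holds for each single cocycle; in divided form it passes
      to the infimum.\<close>
    have "?N f / (?a * L ^ 3) \<le> ?\<delta>"
      using Z_ne cobd_Lipschitz[OF f] aL
      by (intro wdist_set_lower) (auto simp: divide_le_eq mult.commute)
    then have N: "?N f \<le> ?a * L ^ 3 * ?\<delta>"
      using aL by (simp add: divide_le_eq mult.commute)
    have "L ^ 4 * ?N f \<le> L ^ 4 * (?a * L ^ 3 * (D * T))"
      using N close' aL L_ge_1 mult_left_mono[of ?\<delta> "D * T" "?a * L ^ 3"]
      by (intro mult_left_mono) auto
    also have "\<dots> = (D * ?a * L ^ 7) * T"
      by (simp add: eval_nat_numeral)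
    also have "\<dots> \<le> 1 * T"
      using D T by (intro mult_right_mono) auto
    finally have small: "L ^ 4 * ?N f \<le> T"
      by simp
    fix f' assume out: "correction_output X w \<sigma> \<F> 0 (D' * h\<^sub>0) f f'"
    have f': "f' \<in> ?Z" "D' * h\<^sub>0 * wdist X w \<F> 0 f f' \<le> ?N f"
      using output_cocycle[OF f small q out] by auto
    show "f' \<in> ?Z" by fact
    have Dh: "0 < D'' * h\<^sub>0"
      using D'' h' by simp
    have "D'' * h\<^sub>0 * wdist X w \<F> 0 f f' * (?a * L ^ 3) = (D'' * ?a * L ^ 3) * (h\<^sub>0 * wdist X w \<F> 0 f f')"
      by simp
    also have "\<dots> \<le> D' * (h\<^sub>0 * wdist X w \<F> 0 f f')"
      using D'' h' wdist_nonneg by (intro mult_right_mono) auto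
    also have "\<dots> \<le> ?\<delta> * (?a * L ^ 3)"
      using f'(2) N by (simp add: mult.commute mult.left_commute)
    finally have "D'' * h\<^sub>0 * wdist X w \<F> 0 f f' \<le> ?\<delta>"
      using aL by (simp only: mult_le_cancel_right_pos)
    then show "wdist X w \<F> 0 f f' \<le> 1 / (D'' * h\<^sub>0) * ?\<delta>"
      using Dh by (simp add: le_divide_eq mult.commute)
  qed
  ultimately show "cse X w \<sigma> \<F> 0 \<ge> ereal (E'' / (1 / h\<^sub>0 * (1 / h\<^sub>m) + 1 / h\<^sub>p))
      \<and> ccd X w \<sigma> \<F> 0 \<ge> (if \<beta>\<^sub>m = 0 then \<infinity> else ereal (E''' * (E * \<epsilon> - \<alpha>\<^sub>m) / \<beta>\<^sub>m))
      \<and> (\<forall>f \<in> cochains X \<F> 0.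
           wdist_set X w \<F> 0 f (cocycles X \<sigma> \<F> 0) < D / (1 / h\<^sub>0 * (1 / h\<^sub>m) + 1 / h\<^sub>p) \<longrightarrow>
           correction_terminates X w \<sigma> \<F> 0 (D' * h\<^sub>0) f
           \<and> (\<forall>f'. correction_output X w \<sigma> \<F> 0 (D' * h\<^sub>0) f f' \<longrightarrow>
                f' \<in> cocycles X \<sigma> \<F> 0
                \<and> wdist X w \<F> 0 f f' \<le> 1 / (D'' * h\<^sub>0) * wdist_set X w \<F> 0 f (cocycles X \<sigma> \<F> 0)))"
    by blast
qed

end

section \<open>Transport of face counts along isomorphisms; simplices\<close>

section \<open>Face numbers of simplicial, cube and polygon complexes\<close>

lemma card_between_sets:
  assumes "finite T" "S \<subseteq> T" "card S \<le> n"
  shows "card {D. S \<subseteq> D \<and> D \<subseteq> T \<and> card D = n} = (card T - card S) choose (n - card S)"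
proof -
  have finS: "finite S"
    using assms finite_subset by blast
  have "bij_betw (\<lambda>D. D - S) {D. S \<subseteq> D \<and> D \<subseteq> T \<and> card D = n}
      {D. D \<subseteq> T - S \<and> card D = n - card S}"
  proof (rule bij_betw_byWitness[where f' = "\<lambda>D. D \<union> S"])
    show "(\<lambda>D. D - S) ` {D. S \<subseteq> D \<and> D \<subseteq> T \<and> card D = n} \<subseteq> {D. D \<subseteq> T - S \<and> card D = n - card S}"
      using finS by (auto simp: card_Diff_subset)
    have "card (D \<union> S) = n" if "D \<subseteq> T - S" "card D = n - card S" for D
      using that finS assms card_Un_disjoint[of D S] finite_subset[of D T] by auto
    then show "(\<lambda>D. D \<union> S) ` {D. D \<subseteq> T - S \<and> card D = n - card S} \<subseteq> {D. S \<subseteq> D \<and> D \<subseteq> T \<and> card D = n}"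
      using assms by auto
  qed auto
  then have "card {D. S \<subseteq> D \<and> D \<subseteq> T \<and> card D = n} = card {D. D \<subseteq> T - S \<and> card D = n - card S}"
    by (rule bij_betw_same_card)
  also have "\<dots> = card (T - S) choose (n - card S)"
    using assms by (intro n_subsets) auto
  finally show ?thesis
    using assms finS by (simp add: card_Diff_subset)
qed

context dposet
begin

text \<open>Along a maximal chain below \<open>x\<close> a strictly monotone function with values in \<open>-1..gdim X x\<close>
  takes each of these values.\<close>

lemma rank_eq_gdim:
  assumes x: "x \<in> faces X"
    and mono: "\<And>y y'. y \<in> faces X \<Longrightarrow> y' \<in> faces X \<Longrightarrow> y < y' \<Longrightarrow> y' \<le> x \<Longrightarrow> r y < r y'"
    and range: "\<And>y. y \<in> faces X \<Longrightarrow> y \<le> x \<Longrightarrow> -1 \<le> r y \<and> r y \<le> gdim X x"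
    and y: "y \<in> faces X" "y \<le> x"
  shows "r y = gdim X y"
proof (rule antisym)
  show "gdim X y \<le> r y"
    using y
  proof (induction "nat (gdim X y + 1)" arbitrary: y)
    case 0
    then show ?case using range[of y] by simp
  next
    case (Suc n)
    have "0 \<le> gdim X y"
      using Suc.hyps(2) by linarith
    then obtain y' where y': "y' \<in> cells X (gdim X y - 1)" "y' \<le> y"
      using exists_between[OF empty_face_in_faces Suc.prems(1) empty_face_props(2)[OF Suc.prems(1)],
          of "gdim X y - 1"] cells_gdim[OF empty_face_props(1)] by force
    have "y' < y"
      using y' cells_gdim[OF y'(1)] by (auto simp: order_le_less)
    moreover have "gdim X y' \<le> r y'"
      using Suc y' cells_gdim[OF y'(1)] cells_faces[OF y'(1)] by (intro Suc.hyps(1)) auto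
    ultimately show ?case
      using mono[of y' y] Suc.prems y' cells_gdim[OF y'(1)] cells_faces[OF y'(1)] by simp
  qed
  show "r y \<le> gdim X y"
    using y
  proof (induction "nat (gdim X x - gdim X y)" arbitrary: y)
    case 0
    then show ?case using range[of y] by simp
  next
    case (Suc n)
    have "gdim X y + 1 \<le> gdim X x"
      using Suc.hyps(2) by linarith
    then obtain y' where y': "y' \<in> cells X (gdim X y + 1)" "y \<le> y'" "y' \<le> x"
      using exists_between[OF Suc.prems(1) x Suc.prems(2), of "gdim X y + 1"] by force
    have "y < y'"
      using y' cells_gdim[OF y'(1)] by (auto simp: order_le_less)
    moreover have "r y' \<le> gdim X y'"
      using Suc y' cells_gdim[OF y'(1)] cells_faces[OF y'(1)] by (intro Suc.hyps(1)) auto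
    ultimately show ?case
      using mono[of y y'] Suc.prems y' cells_gdim[OF y'(1)] cells_faces[OF y'(1)] by simp
  qed
qed

text \<open>A strictly increasing function on the model with values in the right range must be the
  dimension. Hence an order isomorphism, not assumed to respect dimensions, still transports face
  counts, and cubes and polygons can be counted in their models.\<close>

lemma poset_iso_cells:
  fixes \<phi> :: "'a \<Rightarrow> 'c::order"
  assumes x: "x \<in> faces X" and iso: "poset_iso \<phi> {y \<in> faces X. y \<le> x} Q"
    and mono: "\<forall>S \<in> Q. \<forall>T \<in> Q. S < T \<longrightarrow> r S < r T"
    and range: "\<forall>S \<in> Q. -1 \<le> r S \<and> r S \<le> gdim X x"
  shows "y \<in> faces X \<Longrightarrow> y \<le> x \<Longrightarrow> \<phi> y \<in> Q \<and> r (\<phi> y) = gdim X y"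
    "card (subfaces X x j) = card {S \<in> Q. r S = j}"
    "u \<in> faces X \<Longrightarrow> u \<le> x \<Longrightarrow> card {y \<in> cells X j. u \<le> y \<and> y \<le> x} = card {S \<in> Q. r S = j \<and> \<phi> u \<le> S}"
    "u \<in> faces X \<Longrightarrow> u \<le> x \<Longrightarrow> card (subfaces X u j) = card {S \<in> Q. r S = j \<and> S \<le> \<phi> u}"
proof -
  let ?P = "{y \<in> faces X. y \<le> x}"
  have bij: "bij_betw \<phi> ?P Q" and le: "\<And>y y'. y \<in> ?P \<Longrightarrow> y' \<in> ?P \<Longrightarrow> y \<le> y' \<longleftrightarrow> \<phi> y \<le> \<phi> y'"
    using iso by (auto simp: poset_iso_def)
  have Q: "\<phi> y \<in> Q" if "y \<in> ?P" for y
    using bij that by (auto simp: bij_betw_def)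
  have inj: "inj_on \<phi> ?P" and img: "\<phi> ` ?P = Q"
    using bij by (auto simp: bij_betw_def)
  have rank: "r (\<phi> y) = gdim X y" if "y \<in> ?P" for y
  proof (rule rank_eq_gdim[OF x])
    fix y y' assume y: "y \<in> faces X" "y' \<in> faces X" "y < y'" "y' \<le> x"
    then have P: "y \<in> ?P" "y' \<in> ?P" by auto
    have "\<phi> y \<le> \<phi> y'" "\<not> \<phi> y' \<le> \<phi> y"
      using le[OF P] le[OF P(2,1)] y(3) by auto
    then show "r (\<phi> y) < r (\<phi> y')"
      using mono Q[OF P(1)] Q[OF P(2)] by (simp add: less_le_not_le)
  qed (use range Q that in auto)
  show "\<phi> y \<in> Q \<and> r (\<phi> y) = gdim X y" if "y \<in> faces X" "y \<le> x" for y
    using Q rank that by blast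
  have main: "card {y \<in> ?P. gdim X y = j \<and> A y} = card {S \<in> Q. r S = j \<and> B S}"
    if AB: "\<And>y. y \<in> ?P \<Longrightarrow> A y \<longleftrightarrow> B (\<phi> y)" for A B
  proof -
    have "\<phi> ` {y \<in> ?P. gdim X y = j \<and> A y} = {S \<in> Q. r S = j \<and> B S}"
    proof (intro equalityI subsetI)
      fix S assume S: "S \<in> {S \<in> Q. r S = j \<and> B S}"
      then obtain y where y: "y \<in> ?P" "S = \<phi> y"
        using img by blast
      then show "S \<in> \<phi> ` {y \<in> ?P. gdim X y = j \<and> A y}"
        using S AB[OF y(1)] rank[OF y(1)] unfolding y(2) by (intro imageI) auto
    next
      fix S assume "S \<in> \<phi> ` {y \<in> ?P. gdim X y = j \<and> A y}"
      then obtain y where y: "y \<in> ?P" "gdim X y = j" "A y" "S = \<phi> y"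
        by auto
      then show "S \<in> {S \<in> Q. r S = j \<and> B S}"
        using AB[OF y(1)] rank[OF y(1)] Q[OF y(1)] by auto
    qed
    moreover have "inj_on \<phi> {y \<in> ?P. gdim X y = j \<and> A y}"
      using inj by (rule inj_on_subset) auto
    then have "card (\<phi> ` {y \<in> ?P. gdim X y = j \<and> A y}) = card {y \<in> ?P. gdim X y = j \<and> A y}"
      by (rule card_image)
    ultimately show ?thesis
      by simp
  qed
  have "subfaces X x j = {y \<in> ?P. gdim X y = j \<and> True}"
    by (auto simp: subfaces_def cells_def)
  then show "card (subfaces X x j) = card {S \<in> Q. r S = j}"
    using main[of "\<lambda>_. True" "\<lambda>_. True"] by simp
  show "card {y \<in> cells X j. u \<le> y \<and> y \<le> x} = card {S \<in> Q. r S = j \<and> \<phi> u \<le> S}"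
    if u: "u \<in> faces X" "u \<le> x" for u
  proof -
    have "{y \<in> cells X j. u \<le> y \<and> y \<le> x} = {y \<in> ?P. gdim X y = j \<and> u \<le> y}"
      by (auto simp: cells_def)
    then show ?thesis
      using main[of "\<lambda>y. u \<le> y" "\<lambda>S. \<phi> u \<le> S"] le[of u] u by simp
  qed
  show "card (subfaces X u j) = card {S \<in> Q. r S = j \<and> S \<le> \<phi> u}"
    if u: "u \<in> faces X" "u \<le> x" for u
  proof -
    have "subfaces X u j = {y \<in> ?P. gdim X y = j \<and> y \<le> u}"
      using u(2) by (auto simp: subfaces_def cells_def)
    then show ?thesis
      using main[of "\<lambda>y. y \<le> u" "\<lambda>S. S \<le> \<phi> u"] le[of _ u] u by simp
  qed
qed

text \<open>Closure under subsets makes every set between two simplices a face. The shift by one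
  between dimension and cardinality lets this include the empty face.\<close>

lemma simplicial_count:
  assumes "is_simplicial_complex X" "x \<in> cells X i" "z \<in> cells X k" "x \<le> z" "i \<le> j"
  shows "card {y \<in> cells X j. x \<le> y \<and> y \<le> z} = nat (k - i) choose nat (j - i)"
proof -
  obtain \<Delta> :: "'a set set" and \<phi> where \<Delta>: "abstract_simplicial_complex \<Delta>"
    and iso: "poset_iso \<phi> (faces X) \<Delta>" and dim: "\<And>x. x \<in> faces X \<Longrightarrow> gdim X x = int (card (\<phi> x)) - 1"
    using assms(1) by (auto simp: is_simplicial_complex_def)
  have inj: "inj_on \<phi> (faces X)" and img: "\<phi> ` faces X = \<Delta>"
    and le: "\<And>y y'. y \<in> faces X \<Longrightarrow> y' \<in> faces X \<Longrightarrow> y \<le> y' \<longleftrightarrow> \<phi> y \<subseteq> \<phi> y'"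
    using iso by (auto simp: poset_iso_def bij_betw_def)
  have f: "x \<in> faces X" "z \<in> faces X"
    using assms cells_faces by auto
  have card: "int (card (\<phi> x)) = i + 1" "int (card (\<phi> z)) = k + 1"
    using dim f assms cells_gdim by fastforce+
  have fin: "finite (\<phi> z)" and sub: "\<And>\<tau>. \<tau> \<subseteq> \<phi> z \<Longrightarrow> \<tau> \<in> \<Delta>"
    using \<Delta> img f by (auto simp: abstract_simplicial_complex_def)
  have "\<phi> ` {y \<in> cells X j. x \<le> y \<and> y \<le> z} = {D. \<phi> x \<subseteq> D \<and> D \<subseteq> \<phi> z \<and> card D = nat (j + 1)}"
  proof (intro equalityI subsetI)
    fix D assume D: "D \<in> {D. \<phi> x \<subseteq> D \<and> D \<subseteq> \<phi> z \<and> card D = nat (j + 1)}"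
    then obtain y where y: "y \<in> faces X" "D = \<phi> y"
      using sub img by blast
    have "0 \<le> j + 1"
      using card(1) assms(5) by linarith
    then have "gdim X y = j"
      using dim[OF y(1)] D y(2) by simp
    then show "D \<in> \<phi> ` {y \<in> cells X j. x \<le> y \<and> y \<le> z}"
      using D le[OF f(1) y(1)] le[OF y(1) f(2)] y(1) unfolding y(2) by (intro imageI) (auto simp: cells_def)
  next
    fix D assume "D \<in> \<phi> ` {y \<in> cells X j. x \<le> y \<and> y \<le> z}"
    then obtain y where y: "y \<in> cells X j" "x \<le> y" "y \<le> z" "D = \<phi> y"
      by auto
    then show "D \<in> {D. \<phi> x \<subseteq> D \<and> D \<subseteq> \<phi> z \<and> card D = nat (j + 1)}"
      using le[OF f(1) cells_faces[OF y(1)]] le[OF cells_faces[OF y(1)] f(2)]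
        dim[OF cells_faces[OF y(1)]] cells_gdim[OF y(1)] by auto
  qed
  moreover have "inj_on \<phi> {y \<in> cells X j. x \<le> y \<and> y \<le> z}"
    using cells_faces by (intro inj_on_subset[OF inj]) auto
  then have "card (\<phi> ` {y \<in> cells X j. x \<le> y \<and> y \<le> z}) = card {y \<in> cells X j. x \<le> y \<and> y \<le> z}"
    by (rule card_image)
  ultimately have "card {y \<in> cells X j. x \<le> y \<and> y \<le> z}
      = card {D. \<phi> x \<subseteq> D \<and> D \<subseteq> \<phi> z \<and> card D = nat (j + 1)}"
    by simp
  also have "\<dots> = (card (\<phi> z) - card (\<phi> x)) choose (nat (j + 1) - card (\<phi> x))"
    using fin le[OF f] assms card by (intro card_between_sets) auto
  also have "card (\<phi> z) - card (\<phi> x) = nat (k - i)"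
    using card by linarith
  also have "nat (j + 1) - card (\<phi> x) = nat (j - i)"
    using card by linarith
  finally show ?thesis .
qed

end

section \<open>Faces of the cube as Boolean intervals\<close>

text \<open>The union of \<open>{A..B}\<close> is \<open>B\<close> and its intersection is
  \<open>A\<close>, so the rank is the number of free coordinates of the cube face.\<close>

definition cube_rank :: "nat set set \<Rightarrow> int" where
  "cube_rank S = (if S = {} then -1 else int (card (\<Union>S - \<Inter>S)))"

lemma cube_faces_cases:
  assumes "S \<in> cube_faces n" "S \<noteq> {}"
  obtains A B where "S = {A..B}" "A \<subseteq> B" "B \<subseteq> {..<n}" "\<Union>S = B" "\<Inter>S = A"
proof -
  obtain A B where AB: "S = {A..B}" "A \<subseteq> B" "B \<subseteq> {..<n}"
    using assms by (auto simp: cube_faces_def)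
  moreover have "\<Union>S = B" "\<Inter>S = A"
    unfolding AB(1) using AB(2) by auto
  ultimately show ?thesis
    using that by blast
qed

lemma cube_rank_strict:
  assumes "S \<in> cube_faces n" "T \<in> cube_faces n" "S < T"
  shows "cube_rank S < cube_rank T"
proof (cases "S = {}")
  case True
  then show ?thesis
    using assms by (auto simp: cube_rank_def)
next
  case False
  obtain A B where S: "S = {A..B}" "A \<subseteq> B" "B \<subseteq> {..<n}" "\<Union>S = B" "\<Inter>S = A"
    using cube_faces_cases[OF assms(1) False] .
  have "T \<noteq> {}"
    using assms(3) by auto
  then obtain A' B' where T: "T = {A'..B'}" "A' \<subseteq> B'" "B' \<subseteq> {..<n}" "\<Union>T = B'" "\<Inter>T = A'"
    using cube_faces_cases[OF assms(2)] by blast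
  have "{A..B} \<subseteq> {A'..B'}"
    using assms(3) S(1) T(1) by auto
  then have sub: "A' \<subseteq> A" "B \<subseteq> B'"
    using S(2) by auto
  have "B - A \<noteq> B' - A'"
  proof
    assume eq: "B - A = B' - A'"
    have "A = A'" "B = B'"
      using eq sub S(2) T(2) by blast+
    then show False
      using assms(3) S(1) T(1) by simp
  qed
  then have "B - A \<subset> B' - A'"
    using sub by blast
  then have "card (B - A) < card (B' - A')"
    using T(3) finite_subset[of "B' - A'" "{..<n}"] by (intro psubset_card_mono) auto
  then show ?thesis
    using False \<open>T \<noteq> {}\<close> S T by (simp add: cube_rank_def)
qed

lemma cube_rank_range:
  assumes "S \<in> cube_faces n"
  shows "-1 \<le> cube_rank S \<and> cube_rank S \<le> int n"
proof (cases "S = {}")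
  case False
  obtain A B where S: "B \<subseteq> {..<n}" "\<Union>S = B" "\<Inter>S = A"
    using cube_faces_cases[OF assms False] by metis
  have "card (B - A) \<le> card {..<n}"
    using S(1) by (intro card_mono) auto
  then show ?thesis
    using False S by (simp add: cube_rank_def)
qed (simp add: cube_rank_def)

lemma card_cube_vertices: "card {S \<in> cube_faces n. cube_rank S = 0} = 2 ^ n"
proof -
  have "{S \<in> cube_faces n. cube_rank S = 0} = (\<lambda>A. {A}) ` Pow {..<n}"
  proof (intro equalityI subsetI)
    fix S assume S: "S \<in> {S \<in> cube_faces n. cube_rank S = 0}"
    then have SQ: "S \<in> cube_faces n" "S \<noteq> {}"
      by (auto simp: cube_rank_def)
    obtain A B where AB: "S = {A..B}" "A \<subseteq> B" "B \<subseteq> {..<n}" "\<Union>S = B" "\<Inter>S = A"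
      using cube_faces_cases[OF SQ] .
    have "finite (B - A)"
      using AB(3) finite_subset by blast
    moreover have "card (B - A) = 0"
      using S SQ(2) AB(4,5) by (simp add: cube_rank_def)
    ultimately have "A = B"
      using AB(2) by auto
    then show "S \<in> (\<lambda>A. {A}) ` Pow {..<n}"
      using AB by auto
  next
    fix S assume "S \<in> (\<lambda>A. {A}) ` Pow {..<n}"
    then obtain A where A: "A \<subseteq> {..<n}" "S = {A..A}"
      by auto
    then have "S \<in> cube_faces n"
      unfolding cube_faces_def by blast
    then show "S \<in> {S \<in> cube_faces n. cube_rank S = 0}"
      using A by (simp add: cube_rank_def)
  qed
  then show ?thesis
    by (simp add: card_image card_Pow)
qed

text \<open>A face containing \<open>{A..B}\<close> is determined by its set \<open>D\<close> of
  free coordinates, any superset of \<open>B - A\<close>; it is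
  \<open>{A - D..B \<union> D}\<close>.\<close>

lemma card_cube_faces_above:
  assumes "{A..B} \<in> cube_faces n" "A \<subseteq> B" "card (B - A) \<le> j"
  shows "card {S \<in> cube_faces n. cube_rank S = int j \<and> {A..B} \<subseteq> S} = (n - card (B - A)) choose (j - card (B - A))"
proof -
  have B: "B \<subseteq> {..<n}"
  proof -
    have ne: "{A..B} \<noteq> {}"
      using assms(2) by simp
    obtain A' B' where "{A..B} = {A'..B'}" "B' \<subseteq> {..<n}"
      using cube_faces_cases[OF assms(1) ne] by metis
    then show ?thesis
      using assms(2) by (simp add: Icc_eq_Icc)
  qed
  have "bij_betw (\<lambda>S. \<Union>S - \<Inter>S) {S \<in> cube_faces n. cube_rank S = int j \<and> {A..B} \<subseteq> S}
      {D. B - A \<subseteq> D \<and> D \<subseteq> {..<n} \<and> card D = j}"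
  proof (rule bij_betw_byWitness[where f' = "\<lambda>D. {A - D..B \<union> D}"])
    have *: "\<Union>S - \<Inter>S \<in> {D. B - A \<subseteq> D \<and> D \<subseteq> {..<n} \<and> card D = j} \<and>
        {A - (\<Union>S - \<Inter>S)..B \<union> (\<Union>S - \<Inter>S)} = S"
      if S: "S \<in> {S \<in> cube_faces n. cube_rank S = int j \<and> {A..B} \<subseteq> S}" for S
    proof -
      have SQ: "S \<in> cube_faces n" "S \<noteq> {}"
        using S assms(2) by auto
      obtain A' B' where S': "S = {A'..B'}" "A' \<subseteq> B'" "B' \<subseteq> {..<n}" "\<Union>S = B'" "\<Inter>S = A'"
        using cube_faces_cases[OF SQ] .
      have sub: "A' \<subseteq> A" "B \<subseteq> B'"
        using S S'(1) assms(2) by auto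
      have "card (B' - A') = j"
        using S SQ(2) S'(4,5) by (simp add: cube_rank_def)
      moreover have "A - (B' - A') = A'" "B \<union> (B' - A') = B'"
        using sub assms(2) by blast+
      ultimately show ?thesis
        unfolding S'(4,5) using S'(1,3) sub by auto
    qed
    show "\<forall>S \<in> {S \<in> cube_faces n. cube_rank S = int j \<and> {A..B} \<subseteq> S}.
        {A - (\<Union>S - \<Inter>S)..B \<union> (\<Union>S - \<Inter>S)} = S"
      by (intro ballI conjunct2[OF *])
    show "(\<lambda>S. \<Union>S - \<Inter>S) ` {S \<in> cube_faces n. cube_rank S = int j \<and> {A..B} \<subseteq> S}
        \<subseteq> {D. B - A \<subseteq> D \<and> D \<subseteq> {..<n} \<and> card D = j}"
      by (intro image_subsetI conjunct1[OF *])
    have **: "{A - D..B \<union> D} \<in> cube_faces n \<and> {A..B} \<subseteq> {A - D..B \<union> D} \<and>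
        \<Union>{A - D..B \<union> D} - \<Inter>{A - D..B \<union> D} = D" if D: "B - A \<subseteq> D" "D \<subseteq> {..<n}" for D
    proof -
      have le: "A - D \<subseteq> B \<union> D"
        using assms(2) by blast
      then have "\<Union>{A - D..B \<union> D} = B \<union> D" "\<Inter>{A - D..B \<union> D} = A - D"
        by auto
      moreover have "(B \<union> D) - (A - D) = D"
        using D by blast
      moreover have "{A - D..B \<union> D} \<in> cube_faces n"
        using le B D by (auto simp: cube_faces_def)
      ultimately show ?thesis
        by auto
    qed
    show "\<forall>D \<in> {D. B - A \<subseteq> D \<and> D \<subseteq> {..<n} \<and> card D = j}. \<Union>{A - D..B \<union> D} - \<Inter>{A - D..B \<union> D} = D"
      by (intro ballI conjunct2[OF conjunct2[OF **]]) auto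
    show "(\<lambda>D. {A - D..B \<union> D}) ` {D. B - A \<subseteq> D \<and> D \<subseteq> {..<n} \<and> card D = j}
        \<subseteq> {S \<in> cube_faces n. cube_rank S = int j \<and> {A..B} \<subseteq> S}"
    proof
      fix S assume "S \<in> (\<lambda>D. {A - D..B \<union> D}) ` {D. B - A \<subseteq> D \<and> D \<subseteq> {..<n} \<and> card D = j}"
      then obtain D where D: "B - A \<subseteq> D" "D \<subseteq> {..<n}" "card D = j" "S = {A - D..B \<union> D}"
        by auto
      have "S \<noteq> {}"
        using assms(2) D(4) by auto
      then show "S \<in> {S \<in> cube_faces n. cube_rank S = int j \<and> {A..B} \<subseteq> S}"
        using **[OF D(1,2)] D(3) unfolding D(4)[symmetric] by (simp add: cube_rank_def)
    qed
  qed
  then have "card {S \<in> cube_faces n. cube_rank S = int j \<and> {A..B} \<subseteq> S}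
      = card {D. B - A \<subseteq> D \<and> D \<subseteq> {..<n} \<and> card D = j}"
    by (rule bij_betw_same_card)
  also have "\<dots> = (n - card (B - A)) choose (j - card (B - A))"
    using card_between_sets[of "{..<n}" "B - A" j] B assms(3) by auto
  finally show ?thesis .
qed

section \<open>Faces of the polygon\<close>

text \<open>The full vertex set is the 2-face for every \<open>m\<close>; the other faces are
  simplices and ranked as such.\<close>

definition polygon_rank :: "nat \<Rightarrow> nat set \<Rightarrow> int" where
  "polygon_rank m S = (if S = {..<m} then 2 else int (card S) - 1)"

lemma polygon_faces_cases:
  assumes "3 \<le> m" "S \<in> polygon_faces m"
  shows "S \<subseteq> {..<m} \<and> (S \<noteq> {..<m} \<longrightarrow> card S \<le> 2)"
proof -
  have "card {a, b} \<le> 2" for a b :: nat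
    by (cases "a = b") auto
  then show ?thesis
    using assms by (auto simp: polygon_faces_def)
qed

lemma polygon_rank_strict:
  assumes "3 \<le> m" "S \<in> polygon_faces m" "T \<in> polygon_faces m" "S < T"
  shows "polygon_rank m S < polygon_rank m T"
proof -
  have T: "T \<subseteq> {..<m}"
    using polygon_faces_cases[OF assms(1,3)] by blast
  have S: "S \<noteq> {..<m}" "card S \<le> 2"
    using polygon_faces_cases[OF assms(1,2)] assms(4) T by auto
  have "card S < card T"
    using assms(4) finite_subset[OF T] by (intro psubset_card_mono) auto
  then show ?thesis
    using S by (simp add: polygon_rank_def)
qed

lemma polygon_rank_range:
  assumes "3 \<le> m" "S \<in> polygon_faces m"
  shows "-1 \<le> polygon_rank m S \<and> polygon_rank m S \<le> 2"
  using polygon_faces_cases[OF assms] by (auto simp: polygon_rank_def)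

lemma polygon_rank_0:
  assumes "3 \<le> m"
  shows "{S \<in> polygon_faces m. polygon_rank m S = 0} = (\<lambda>i. {i}) ` {..<m}"
proof (intro equalityI subsetI)
  fix S assume S: "S \<in> {S \<in> polygon_faces m. polygon_rank m S = 0}"
  then have "card S = 1" "S \<subseteq> {..<m}"
    using polygon_faces_cases[OF assms] by (auto simp: polygon_rank_def split: if_splits)
  then show "S \<in> (\<lambda>i. {i}) ` {..<m}"
    by (auto simp: card_1_singleton_iff)
next
  fix S assume "S \<in> (\<lambda>i. {i}) ` {..<m}"
  then obtain i where i: "i < m" "S = {i}"
    by auto
  moreover have "{i} \<noteq> {..<m}"
  proof
    assume "{i} = {..<m}"
    then have "card {i} = card {..<m}" by (rule arg_cong)
    then show False using assms by simp
  qed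
  ultimately show "S \<in> {S \<in> polygon_faces m. polygon_rank m S = 0}"
    by (auto simp: polygon_faces_def polygon_rank_def)
qed

lemma polygon_rank_1:
  assumes "3 \<le> m" "S \<in> polygon_faces m" "polygon_rank m S = 1"
  obtains i where "i < m" "S = {i, (i + 1) mod m}" "i \<noteq> (i + 1) mod m"
proof -
  have S: "card S = 2"
    using assms(3) by (auto simp: polygon_rank_def split: if_splits)
  then have "S \<noteq> {}" "S \<noteq> {..<m}" "\<And>i. S \<noteq> {i}"
    using assms(1) by auto
  then obtain i where i: "i < m" "S = {i, (i + 1) mod m}"
    using assms(2) by (auto simp: polygon_faces_def)
  then show ?thesis
    using that S by (metis \<open>\<And>i. S \<noteq> {i}\<close> insert_absorb2)
qed

context dposet
begin

lemma cube_iso: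
  assumes "is_cube_complex X" "z \<in> cells X k" "0 \<le> k"
  obtains \<phi> where "poset_iso \<phi> {y \<in> faces X. y \<le> z} (cube_faces (nat k))"
  using assms cells_faces cells_gdim unfolding is_cube_complex_def by metis

lemma cube_rank_is_rank:
  assumes "z \<in> cells X k" "0 \<le> k"
  shows "\<forall>S \<in> cube_faces (nat k). \<forall>T \<in> cube_faces (nat k). S < T \<longrightarrow> cube_rank S < cube_rank T"
    "\<forall>S \<in> cube_faces (nat k). -1 \<le> cube_rank S \<and> cube_rank S \<le> gdim X z"
  using cube_rank_strict[of _ "nat k"] cube_rank_range[of _ "nat k"] assms cells_gdim[OF assms(1)] by auto

lemma cube_subfaces:
  assumes "is_cube_complex X" "z \<in> cells X k" "0 \<le> k"
  shows "card (subfaces X z j) = card {S \<in> cube_faces (nat k). cube_rank S = j}"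
proof -
  obtain \<phi> where "poset_iso \<phi> {y \<in> faces X. y \<le> z} (cube_faces (nat k))"
    using cube_iso[OF assms] .
  then show ?thesis
    using poset_iso_cells(2)[where r = cube_rank, OF cells_faces[OF assms(2)] _ cube_rank_is_rank[OF assms(2,3)]]
    by blast
qed

text \<open>Above a nonempty face the interval in a cube is a Boolean lattice, hence the binomial
  coefficient. Above the empty face it is not, and \<open>cube_subfaces\<close> takes over.\<close>

lemma cube_count:
  assumes "is_cube_complex X" and z: "z \<in> cells X k" and u: "u \<in> cells X i" "u \<le> z"
    and i: "0 \<le> i" "i \<le> j"
  shows "card {y \<in> cells X j. u \<le> y \<and> y \<le> z} = nat (k - i) choose nat (j - i)"
proof -
  have k: "0 \<le> k"
    using gdim_mono[OF cells_faces[OF u(1)] cells_faces[OF z] u(2)] cells_gdim[OF u(1)] cells_gdim[OF z] i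
    by simp
  obtain \<phi> where iso: "poset_iso \<phi> {y \<in> faces X. y \<le> z} (cube_faces (nat k))"
    using cube_iso[OF assms(1) z k] .
  note cells = poset_iso_cells[where r = cube_rank, OF cells_faces[OF z] iso cube_rank_is_rank[OF z k]]
  have u': "\<phi> u \<in> cube_faces (nat k)" "cube_rank (\<phi> u) = i"
    using cells(1)[OF cells_faces[OF u(1)] u(2)] cells_gdim[OF u(1)] by auto
  then have ne: "\<phi> u \<noteq> {}"
    using i(1) by (auto simp: cube_rank_def)
  obtain A B where AB: "\<phi> u = {A..B}" "A \<subseteq> B" "B \<subseteq> {..<nat k}" "\<Union>(\<phi> u) = B" "\<Inter>(\<phi> u) = A"
    using cube_faces_cases[OF u'(1) ne] .
  have card: "int (card (B - A)) = i"
    using u'(2) ne AB(4,5) by (simp add: cube_rank_def)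
  have "card {y \<in> cells X j. u \<le> y \<and> y \<le> z}
      = card {S \<in> cube_faces (nat k). cube_rank S = j \<and> \<phi> u \<le> S}"
    using cells(3)[OF cells_faces[OF u(1)] u(2)] by blast
  also have "\<dots> = card {S \<in> cube_faces (nat k). cube_rank S = int (nat j) \<and> {A..B} \<subseteq> S}"
    using i AB(1) by simp
  also have "\<dots> = (nat k - card (B - A)) choose (nat j - card (B - A))"
    using u'(1) AB(1,2) card i by (intro card_cube_faces_above) auto
  also have "\<dots> = nat (k - i) choose nat (j - i)"
    using card i k by (metis nat_diff_distrib' nat_int order_trans of_nat_0_le_iff)
  finally show ?thesis .
qed

lemma cube_lower_regular:
  assumes cube: "is_cube_complex X"
  shows "lower_regular d X"
proof (rule lower_regularI)
  fix i j k x z x' z'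
  assume ij: "-1 \<le> i" "i \<le> j" "j \<le> k" and x: "x \<in> cells X i" "x' \<in> cells X i"
    and z: "z \<in> cells X k" "z' \<in> cells X k" and le: "x \<le> z" "x' \<le> z'"
  show "card {y \<in> cells X j. x \<le> y \<and> y \<le> z} = card {y \<in> cells X j. x' \<le> y \<and> y \<le> z'}"
  proof (cases "0 \<le> i")
    case True
    then show ?thesis
      using cube_count[OF cube z(1) x(1) le(1)] cube_count[OF cube z(2) x(2) le(2)] ij by simp
  next
    case False
    then have i: "i = -1"
      using ij by simp
    have x_eq: "x = empty_face X" "x' = empty_face X"
      using x by (simp_all add: i cells_minus_one)
    have sub: "{y \<in> cells X j. empty_face X \<le> y \<and> y \<le> z} = subfaces X z j" if "z \<in> cells X k" for z
      using subfaces_eq[OF cells_faces[OF that]] by simp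
    show ?thesis
    proof (cases "0 \<le> k")
      case True
      show ?thesis
        using cube_subfaces[OF cube z(1) True] cube_subfaces[OF cube z(2) True] x_eq sub z by simp
    next
      case False
      then have "k = -1"
        using ij by simp
      then have "z = z'"
        using z by (simp add: cells_minus_one)
      then show ?thesis
        using x_eq by simp
    qed
  qed
qed

text \<open>The hypothesis concerns the 2-skeleton, but faces below a 2-face have dimension at most
  2, so the order ideals are the same in \<open>X\<close>.\<close>

lemma polygon_iso:
  assumes "is_polygon_complex m (skeleton2 X)" "z \<in> cells X 2"
  obtains \<phi> where "3 \<le> m" "poset_iso \<phi> {y \<in> faces X. y \<le> z} (polygon_faces m)"
proof -
  have "z \<in> cells (skeleton2 X) 2"
    using assms(2) by (auto simp: skeleton2_def cells_def)
  then obtain \<phi> where "3 \<le> m" "poset_iso \<phi> {y \<in> faces (skeleton2 X). y \<le> z} (polygon_faces m)"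
    using assms(1) unfolding is_polygon_complex_def by blast
  moreover have "{y \<in> faces (skeleton2 X). y \<le> z} = {y \<in> faces X. y \<le> z}"
  proof -
    have "y \<in> cells X (-1) \<union> cells X 0 \<union> cells X 1 \<union> cells X 2" if "y \<in> faces X" "y \<le> z" for y
    proof -
      have "-1 \<le> gdim X y" "gdim X y \<le> 2"
        using gdim_ge[OF that(1)] gdim_mono[OF that(1) cells_faces[OF assms(2)] that(2)]
          cells_gdim[OF assms(2)] by auto
      then have "gdim X y = -1 \<or> gdim X y = 0 \<or> gdim X y = 1 \<or> gdim X y = 2"
        by arith
      then show ?thesis
        using that by (auto simp: cells_def)
    qed
    then show ?thesis
      by (auto simp: skeleton2_def cells_def)
  qed
  ultimately show ?thesis
    using that by simp
qed

lemma polygon_counts: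
  assumes poly: "is_polygon_complex m (skeleton2 X)" and z: "z \<in> cells X 2"
  shows "3 \<le> m" "card (subfaces X z 0) = m"
    "e \<in> cells X 1 \<Longrightarrow> e \<le> z \<Longrightarrow> card (subfaces X e 0) = 2"
    "v \<in> cells X 0 \<Longrightarrow> v \<le> z \<Longrightarrow> card {e \<in> cells X 1. v \<le> e \<and> e \<le> z} \<le> 2"
proof -
  obtain \<phi> where m: "3 \<le> m" and iso: "poset_iso \<phi> {y \<in> faces X. y \<le> z} (polygon_faces m)"
    using polygon_iso[OF poly z] .
  have mono: "\<forall>S \<in> polygon_faces m. \<forall>T \<in> polygon_faces m. S < T \<longrightarrow> polygon_rank m S < polygon_rank m T"
    using polygon_rank_strict[OF m] by blast
  have range: "\<forall>S \<in> polygon_faces m. -1 \<le> polygon_rank m S \<and> polygon_rank m S \<le> gdim X z"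
    using polygon_rank_range[OF m] cells_gdim[OF z] by simp
  note cells = poset_iso_cells[where r = "polygon_rank m", OF cells_faces[OF z] iso mono range]
  show "3 \<le> m" by fact
  have "card (subfaces X z 0) = card {S \<in> polygon_faces m. polygon_rank m S = 0}"
    using cells(2) by blast
  also have "\<dots> = m"
    unfolding polygon_rank_0[OF m] by (simp add: card_image)
  finally show "card (subfaces X z 0) = m" .
  show "card (subfaces X e 0) = 2" if e: "e \<in> cells X 1" "e \<le> z"
  proof -
    have e': "\<phi> e \<in> polygon_faces m" "polygon_rank m (\<phi> e) = 1"
      using cells(1)[OF cells_faces[OF e(1)] e(2)] cells_gdim[OF e(1)] by auto
    obtain i where i: "i < m" "\<phi> e = {i, (i + 1) mod m}" "i \<noteq> (i + 1) mod m"
      using polygon_rank_1[OF m e'] .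
    have "card (subfaces X e 0) = card {S \<in> polygon_faces m. polygon_rank m S = 0 \<and> S \<le> \<phi> e}"
      using cells(4)[OF cells_faces[OF e(1)] e(2)] by blast
    also have "{S \<in> polygon_faces m. polygon_rank m S = 0 \<and> S \<le> \<phi> e}
        = {S \<in> {S \<in> polygon_faces m. polygon_rank m S = 0}. S \<subseteq> \<phi> e}"
      by auto
    also have "\<dots> = {{i}, {(i + 1) mod m}}"
      unfolding polygon_rank_0[OF m] i(2) using i(1) by auto
    also have "card \<dots> = 2"
      using i(3) by simp
    finally show ?thesis .
  qed
  show "card {e \<in> cells X 1. v \<le> e \<and> e \<le> z} \<le> 2" if v: "v \<in> cells X 0" "v \<le> z"
  proof -
    have v': "\<phi> v \<in> polygon_faces m" "polygon_rank m (\<phi> v) = 0"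
      using cells(1)[OF cells_faces[OF v(1)] v(2)] cells_gdim[OF v(1)] by auto
    then have "\<phi> v \<in> (\<lambda>i. {i}) ` {..<m}"
      using polygon_rank_0[OF m] by blast
    then obtain i where i: "i < m" "\<phi> v = {i}"
      by auto
    \<comment> \<open>The edges through \<open>i\<close> lead to its two cyclic neighbours. Adding
      \<open>m\<close> before subtracting 1 keeps the predecessor of 0 correct in natural
      numbers.\<close>
    have "{S \<in> polygon_faces m. polygon_rank m S = 1 \<and> \<phi> v \<le> S}
        \<subseteq> {{i, (i + 1) mod m}, {(i + m - 1) mod m, i}}"
    proof
      fix S assume S: "S \<in> {S \<in> polygon_faces m. polygon_rank m S = 1 \<and> \<phi> v \<le> S}"
      then have S': "S \<in> polygon_faces m" "polygon_rank m S = 1" and iS: "i \<in> S"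
        using i(2) by auto
      obtain l where l: "l < m" "S = {l, (l + 1) mod m}"
        using polygon_rank_1[OF m S'] by metis
      show "S \<in> {{i, (i + 1) mod m}, {(i + m - 1) mod m, i}}"
      proof (cases "i = l")
        case False
        then have il: "i = (l + 1) mod m"
          using iS l(2) by auto
        have "(i + m - 1) mod m = l"
        proof (cases "l + 1 = m")
          case True
          then have "i = 0" using il by simp
          then show ?thesis using True l(1) by simp
        next
          case False
          then have "i = l + 1" using il l(1) by simp
          then show ?thesis using l(1) by simp
        qed
        then show ?thesis
          using l(2) il by auto
      qed (use l(2) in auto)
    qed
    then have "card {S \<in> polygon_faces m. polygon_rank m S = 1 \<and> \<phi> v \<le> S}
        \<le> card {{i, (i + 1) mod m}, {(i + m - 1) mod m, i}}"
      by (intro card_mono) auto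
    also have "\<dots> \<le> 2"
      by (simp add: card_insert_if)
    finally show ?thesis
      using cells(3)[OF cells_faces[OF v(1)] v(2), of 1] by simp
  qed
qed

section \<open>Extremal counts from pointwise bounds, and counts in polygons\<close>

lemma F_max_leI:
  assumes "-1 \<le> i" "i \<le> k" "k \<le> int d"
    and "\<And>x z. x \<in> cells X i \<Longrightarrow> z \<in> cells X k \<Longrightarrow> x \<le> z \<Longrightarrow> card {y \<in> cells X j. x \<le> y \<and> y \<le> z} \<le> b"
  shows "F_max X i j k \<le> b"
proof -
  have "F_max X i j k \<in> between_counts X i j k"
    unfolding F_max_def using assms(1-3) by (intro Max_in between_counts_finite between_counts_nonempty)
  then show ?thesis
    using assms(4) by (auto simp: between_counts_def)
qed

lemma F_min_geI:
  assumes "-1 \<le> i" "i \<le> k" "k \<le> int d"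
    and "\<And>x z. x \<in> cells X i \<Longrightarrow> z \<in> cells X k \<Longrightarrow> x \<le> z \<Longrightarrow> b \<le> card {y \<in> cells X j. x \<le> y \<and> y \<le> z}"
  shows "b \<le> F_min X i j k"
proof -
  have "F_min X i j k \<in> between_counts X i j k"
    unfolding F_min_def using assms(1-3) by (intro Min_in between_counts_finite between_counts_nonempty)
  then show ?thesis
    using assms(4) by (auto simp: between_counts_def)
qed

lemma F_max_bottom_le:
  assumes "-1 \<le> k" "k \<le> int d" "\<And>z. z \<in> cells X k \<Longrightarrow> card (subfaces X z j) \<le> b"
  shows "F_max X (-1) j k \<le> b"
  using assms by (intro F_max_leI) (auto simp: cells_minus_one subfaces_eq[symmetric] cells_faces)

lemma F_min_bottom_ge:
  assumes "-1 \<le> k" "k \<le> int d" "\<And>z. z \<in> cells X k \<Longrightarrow> b \<le> card (subfaces X z j)"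
  shows "b \<le> F_min X (-1) j k"
  using assms by (intro F_min_geI) (auto simp: cells_minus_one subfaces_eq[symmetric] cells_faces)

lemma edge_in_triangle:
  assumes "2 \<le> d" "e \<in> cells X 1"
  obtains z where "z \<in> cells X 2" "e \<le> z"
proof -
  obtain y where y: "y \<in> cells X (int d)" "e \<le> y"
    using ex_top_face[OF cells_faces[OF assms(2)]] by blast
  show ?thesis
    using exists_between[OF cells_faces[OF assms(2)] cells_faces[OF y(1)] y(2), of 2]
      cells_gdim[OF assms(2)] cells_gdim[OF y(1)] assms(1) that by auto
qed

text \<open>An edge avoiding \<open>H\<close> has two vertices, both outside \<open>H\<close>, and a
  vertex lies on at most two edges of \<open>z\<close>. So these edges are no more numerous than the
  vertices of \<open>z\<close> outside \<open>H\<close>, which gives \<open>M = m\<close> for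
  \<open>m\<close>-gons.\<close>

lemma triangle_edge_bound:
  assumes z: "z \<in> cells X 2" and H: "H \<subseteq> cells X 0"
    and edge: "\<And>e. e \<in> cells X 1 \<Longrightarrow> e \<le> z \<Longrightarrow> card (subfaces X e 0) = 2"
    and vertex: "\<And>v. v \<in> cells X 0 \<Longrightarrow> v \<le> z \<Longrightarrow> card {e \<in> cells X 1. v \<le> e \<and> e \<le> z} \<le> 2"
  shows "card {v \<in> H. v \<le> z} + card {e \<in> cells X 1. e \<le> z \<and> \<not> (\<exists>v \<in> H. v \<le> e)} \<le> card (subfaces X z 0)"
proof -
  let ?E = "{e \<in> cells X 1. e \<le> z \<and> \<not> (\<exists>v \<in> H. v \<le> e)}"
  let ?V = "subfaces X z 0 - {v \<in> H. v \<le> z}"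
  have fin: "finite ?E" "finite ?V" "finite (subfaces X z 0)"
    by (auto simp: subfaces_def)
  have "2 * card ?E = (\<Sum>e \<in> ?E. card (subfaces X e 0))"
    using edge by simp
  also have "\<dots> = (\<Sum>e \<in> ?E. \<Sum>v \<in> {v \<in> ?V. v \<le> e}. 1)"
  proof (intro sum.cong refl)
    fix e assume "e \<in> ?E"
    then have "subfaces X e 0 = {v \<in> ?V. v \<le> e}"
      by (auto simp: subfaces_def intro: order_trans)
    then show "card (subfaces X e 0) = (\<Sum>v \<in> {v \<in> ?V. v \<le> e}. 1)"
      by simp
  qed
  also have "\<dots> = (\<Sum>v \<in> ?V. \<Sum>e \<in> {e \<in> ?E. v \<le> e}. 1)"
    by (rule sum.swap_restrict[OF fin(1,2)])
  also have "\<dots> \<le> (\<Sum>v \<in> ?V. (2 :: nat))"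
  proof (rule sum_mono)
    fix v assume v: "v \<in> ?V"
    have "card {e \<in> ?E. v \<le> e} \<le> card {e \<in> cells X 1. v \<le> e \<and> e \<le> z}"
      by (intro card_mono) auto
    then show "(\<Sum>e \<in> {e \<in> ?E. v \<le> e}. 1) \<le> (2 :: nat)"
      using vertex[of v] v by (simp add: subfaces_def)
  qed
  finally have "card ?E \<le> card ?V"
    by simp
  also have "card ?V = card (subfaces X z 0) - card {v \<in> H. v \<le> z}"
    using fin(3) H finite_subset[of "{v \<in> H. v \<le> z}" "subfaces X z 0"]
    by (intro card_Diff_subset) (auto simp: subfaces_def)
  finally have le: "card ?E \<le> card (subfaces X z 0) - card {v \<in> H. v \<le> z}" .
  have "card {v \<in> H. v \<le> z} \<le> card (subfaces X z 0)"
    using H by (intro card_mono fin(3)) (auto simp: subfaces_def)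
  then show ?thesis
    using le by simp
qed

text \<open>Each vertex of \<open>z\<close> lies on an edge of \<open>z\<close>, and each edge has
  two vertices. This allows \<open>\<rho> = m / 2\<close>.\<close>

lemma triangle_edges_ge:
  assumes z: "z \<in> cells X 2"
    and edge: "\<And>e. e \<in> cells X 1 \<Longrightarrow> e \<le> z \<Longrightarrow> card (subfaces X e 0) = 2"
  shows "card (subfaces X z 0) \<le> 2 * card (subfaces X z 1)"
proof -
  have "card (subfaces X z 0) = (\<Sum>v \<in> subfaces X z 0. 1)"
    by simp
  also have "\<dots> \<le> (\<Sum>v \<in> subfaces X z 0. card {e \<in> cells X 1. v \<le> e \<and> e \<le> z})"
  proof (rule sum_mono)
    fix v assume "v \<in> subfaces X z 0"
    then have v: "v \<in> cells X 0" "v \<le> z"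
      by (auto simp: subfaces_def)
    have "\<exists>e \<in> cells X 1. v \<le> e \<and> e \<le> z"
      using exists_between[OF cells_faces[OF v(1)] cells_faces[OF z] v(2), of 1]
        cells_gdim[OF v(1)] cells_gdim[OF z] by simp
    then have "0 < card {e \<in> cells X 1. v \<le> e \<and> e \<le> z}"
      by (auto simp: card_gt_0_iff)
    then show "1 \<le> card {e \<in> cells X 1. v \<le> e \<and> e \<le> z}"
      by simp
  qed
  also have "\<dots> = (\<Sum>e \<in> subfaces X z 1. card (subfaces X e 0))"
    using double_count_subfaces[OF cells_faces[OF z], of 0 1] by simp
  also have "\<dots> = 2 * card (subfaces X z 1)"
    using edge by (simp add: subfaces_def)
  finally show ?thesis .
qed

end

section \<open>Explicit constants for the classes of complexes\<close>

text \<open>\<open>L\<close> is any upper bound of the irregularity, so it may be lowered to 1 for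
  lower-regular posets.\<close>

lemma sheaf_dposet_change_L:
  assumes "sheaf_dposet d X w L R \<sigma> \<F>" "lower_irregularity d X \<le> L'"
  shows "sheaf_dposet d X w L' R \<sigma> \<F>"
  using assms by (simp add: sheaf_dposet_def weighted_dposet_def weighted_dposet_axioms_def)

context sheaf_dposet
begin

text \<open>Stated through face numbers, the lemma serves simplicial complexes with
  \<open>m = 3\<close> and cube complexes with \<open>m = 4\<close> as well, there with
  \<open>L = 1\<close>. For \<open>K = M = m\<close> and \<open>\<rho> = m / 2\<close> the condition
  on \<open>E'\<close> is \<open>E' \<le> 1 / (4 * m * L ^ 16)\<close>, the origin of 1/12 and
  1/16.\<close>

lemma polygon_criterion:
  assumes m: "1 \<le> m" and tri: "\<And>z. z \<in> cells X 2 \<Longrightarrow> card (subfaces X z 0) = m"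
    and edge: "\<And>e. e \<in> cells X 1 \<Longrightarrow> card (subfaces X e 0) = 2"
    and vertex: "\<And>v z. v \<in> cells X 0 \<Longrightarrow> z \<in> cells X 2 \<Longrightarrow> v \<le> z \<Longrightarrow>
      card {e \<in> cells X 1. v \<le> e \<and> e \<le> z} \<le> 2"
  shows "criterion (1 / L ^ 8) (1 / (4 * real m * L ^ 18)) (1 / (2 * L ^ 13)) (1 / L ^ 3)
    (1 / (2 * L ^ 15)) (1 / (4 * L ^ 12)) (1 / (8 * L ^ 16)) d X w \<sigma> \<F>"
proof -
  have F01: "F_max X (-1) 0 1 \<le> 2"
    using edge d_ge_2 by (intro F_max_bottom_le) auto
  have F02: "F_max X (-1) 0 2 \<le> m" "m \<le> F_min X (-1) 0 2"
    using tri d_ge_2 by (auto intro!: F_max_bottom_le F_min_bottom_ge)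
  have bound: "card {v \<in> H. v \<le> z} + card {e \<in> cells X 1. e \<le> z \<and> \<not> (\<exists>v \<in> H. v \<le> e)} \<le> m"
    if "z \<in> cells X 2" "H \<subseteq> cells X 0" for z H
    using triangle_edge_bound[OF that] edge vertex that(1) tri by simp
  have "card (subfaces X z 1) \<le> m" if "z \<in> cells X 2" for z
    using bound[OF that, of "{}"] by (simp add: subfaces_def)
  then have F12: "F_max X (-1) 1 2 \<le> m"
    using d_ge_2 by (intro F_max_bottom_le) auto
  \<comment> \<open>The half is rounded up, so that \<open>m \<le> 2 * F_min X (-1) 1 2\<close> can
    be recovered from an integer bound.\<close>
  have "(m + 1) div 2 \<le> card (subfaces X z 1)" if "z \<in> cells X 2" for z
    using triangle_edges_ge[OF that] edge tri[OF that] by simp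
  then have "(m + 1) div 2 \<le> F_min X (-1) 1 2"
    using d_ge_2 by (intro F_min_bottom_ge) auto
  then have F12': "m \<le> 2 * F_min X (-1) 1 2"
    by linarith
  interpret face_bounds d X w L R \<sigma> \<F> "real m" "real m" "real m / 2"
  proof
    show "real (F_max X (-1) 0 2) \<le> real m" "real (F_max X (-1) 1 2) \<le> real m" "1 \<le> real m" "0 < real m / 2"
      using F02 F12 m by auto
    show "real m / 2 \<le> real (F_min X (-1) 1 2)"
      using F12' by linarith
    have "real m / 2 * real (F_max X (-1) 0 1) \<le> real m / 2 * 2"
      using F01 by (intro mult_left_mono) auto
    then show "real m / 2 * real (F_max X (-1) 0 1) \<le> real (F_min X (-1) 0 2)"
      using F02(2) by simp
    show "real (card {v \<in> H. v \<le> z} + card {e \<in> cells X 1. e \<le> z \<and> \<not> (\<exists>v \<in> H. v \<le> e)}) \<le> real m"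
      if "z \<in> cells X 2" "H \<subseteq> cells X 0" for z H
      using bound[OF that] by (simp only: of_nat_le_iff)
  qed
  have L: "0 < L" "1 \<le> L"
    using L_ge_1 by auto
  have pow: "L ^ i \<le> L ^ j" if "i \<le> j" for i j
    using L that by (intro power_increasing) auto
  have pow1: "1 \<le> L ^ i" for i
    using L by simp
  show ?thesis
  proof (rule criterionI)
    show "1 / L ^ 8 \<le> 1 / L ^ 4"
      using pow[of 4 8] L by (intro divide_left_mono) auto
    have "2 * real m * real m * L ^ 16 * (1 / (4 * real m * L ^ 18)) = real m / 2 * (1 / L ^ 2)"
      using m L by (simp add: field_simps eval_nat_numeral)
    also have "\<dots> \<le> real m / 2 * 1"
      using pow1[of 2] by (intro mult_left_mono) (auto simp: divide_le_eq)
    finally show "2 * real m * real m * L ^ 16 * (1 / (4 * real m * L ^ 18)) \<le> real m / 2"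
      by simp
    show "2 * (1 / (2 * L ^ 13)) * L ^ 4 \<le> 1"
      using pow[of 4 13] L by (simp add: divide_le_eq)
    have "1 / (2 * L ^ 15) * real (F_max X (-1) 0 1) * L ^ 7 \<le> 1 / (2 * L ^ 15) * 2 * L ^ 7"
      using F01 L by (intro mult_right_mono mult_left_mono) auto
    also have "\<dots> \<le> 1"
      using pow[of 7 15] L by (simp add: divide_le_eq)
    finally show "1 / (2 * L ^ 15) * real (F_max X (-1) 0 1) * L ^ 7 \<le> 1" .
    show "4 * (1 / (4 * L ^ 12)) * L ^ 3 \<le> 1"
      using pow[of 3 12] L by (simp add: divide_le_eq)
    have "1 / (8 * L ^ 16) * real (F_max X (-1) 0 1) * L ^ 3 \<le> 1 / (8 * L ^ 16) * 2 * L ^ 3"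
      using F01 L by (intro mult_right_mono mult_left_mono) auto
    also have "\<dots> = 1 / (4 * L ^ 12) * (1 / L)"
      using L by (simp add: field_simps eval_nat_numeral)
    also have "\<dots> \<le> 1 / (4 * L ^ 12) * 1"
      using L by (intro mult_left_mono) auto
    finally show "1 / (8 * L ^ 16) * real (F_max X (-1) 0 1) * L ^ 3 \<le> 1 / (4 * L ^ 12)"
      by simp
    show "1 / L ^ 3 \<le> 1"
      using pow1[of 3] L(1) by (simp add: divide_le_eq)
  qed (use L in auto)
qed

text \<open>Every edge lies in a triangle, which has at least as many vertices; this bounds the
  vertices of an edge by \<open>F\<close>. For \<open>\<rho> = 1 / L\<close>, the maximal number of
  vertices of an edge is at most \<open>L\<close> times the minimal one, and the latter is at most
  the number of vertices of any triangle.\<close>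

lemma general_face_bounds:
  assumes F: "F_max X (-1) 0 2 \<le> F" "F_max X (-1) 1 2 \<le> F"
  shows "1 \<le> F" "F_max X (-1) 0 1 \<le> F"
    "face_bounds d X w L R \<sigma> \<F> (real F) (2 * real F) (1 / L)"
proof -
  have L: "0 < L" "1 \<le> L"
    using L_ge_1 by auto
  have Fpos: "0 < F_min X (-1) 0 2" "0 < F_min X (-1) 1 2"
    using F_min_pos d_ge_2 by auto
  show F1: "1 \<le> F"
    using F Fpos F_min_le_F_max[of "-1" 0 2] d_ge_2 by simp
  have sub: "card (subfaces X e 0) \<le> card (subfaces X z 0)" if "e \<le> z" for e z
    using that by (intro card_mono) (auto simp: subfaces_def)
  show F01: "F_max X (-1) 0 1 \<le> F"
  proof (rule F_max_bottom_le)
    fix e assume "e \<in> cells X 1"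
    then obtain z where z: "z \<in> cells X 2" "e \<le> z"
      using edge_in_triangle[OF d_ge_2] by blast
    then show "card (subfaces X e 0) \<le> F"
      using sub[OF z(2)] card_subfaces_le[OF z(1), of 0] F(1) by simp
  qed (use d_ge_2 in auto)
  have "F_min X (-1) 0 1 \<le> F_min X (-1) 0 2"
  proof (rule F_min_bottom_ge)
    fix z assume z: "z \<in> cells X 2"
    obtain e where e: "e \<in> cells X 1" "e \<le> z"
      using exists_between[OF empty_face_in_faces cells_faces[OF z] empty_face_props(2)[OF cells_faces[OF z]], of 1]
        cells_gdim[OF empty_face_props(1)] cells_gdim[OF z] by auto
    then show "F_min X (-1) 0 1 \<le> card (subfaces X z 0)"
      using card_subfaces_ge[OF e(1), of 0] sub[OF e(2)] by simp
  qed (use d_ge_2 in auto)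
  then have "real (F_max X (-1) 0 1) \<le> L * real (F_min X (-1) 0 2)"
    using F_max_le[of "-1" 0 1] d_ge_2 L by (auto intro: order_trans mult_left_mono)
  then have \<rho>: "1 / L * real (F_max X (-1) 0 1) \<le> real (F_min X (-1) 0 2)"
    using L by (simp add: divide_le_eq mult.commute)
  show "face_bounds d X w L R \<sigma> \<F> (real F) (2 * real F) (1 / L)"
  proof
    show "1 / L \<le> real (F_min X (-1) 1 2)"
      using L Fpos(2) order_trans[of "1 / L" 1] by (simp add: divide_le_eq)
    fix z H assume z: "z \<in> cells X 2" and H: "H \<subseteq> cells X 0"
    have "card {v \<in> H. v \<le> z} \<le> card (subfaces X z 0)"
      using H by (intro card_mono) (auto simp: subfaces_def)
    moreover have "card {e \<in> cells X 1. e \<le> z \<and> \<not> (\<exists>v \<in> H. v \<le> e)} \<le> card (subfaces X z 1)"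
      by (intro card_mono) (auto simp: subfaces_def)
    ultimately show "real (card {v \<in> H. v \<le> z} + card {e \<in> cells X 1. e \<le> z \<and> \<not> (\<exists>v \<in> H. v \<le> e)}) \<le> 2 * real F"
      using card_subfaces_le[OF z, of 0] card_subfaces_le[OF z, of 1] F by linarith
  qed (use F F1 L \<rho> in auto)
qed

text \<open>With \<open>K = F\<close>, \<open>M = 2 * F\<close> and \<open>\<rho> = 1 / L\<close>
  the condition on \<open>E'\<close> becomes \<open>E' \<le> 1 / (4 * L ^ 17 * F ^ 2)\<close>, which
  the assumption implies. Inequalities for the constants let the general and the lower-regular
  values share one proof.\<close>

lemma general_criterion:
  assumes F: "F_max X (-1) 0 2 \<le> F" "F_max X (-1) 1 2 \<le> F"
    and E: "E \<le> 1 / L ^ 4" and E': "E' \<le> 1 / (4 * L ^ 18 * real F ^ 2)"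
    and E'': "0 \<le> E''" "E'' \<le> 1 / (2 * L ^ 4)" and E''': "0 \<le> E'''" "E''' \<le> 1"
    and D: "D \<le> 1 / (L ^ 7 * real F)"
    and D': "0 < D'" "D' \<le> 1 / (4 * L ^ 3)" and D'': "0 < D''" "D'' \<le> D' / (L ^ 3 * real F)"
  shows "criterion E E' E'' E''' D D' D'' d X w \<sigma> \<F>"
proof -
  interpret face_bounds d X w L R \<sigma> \<F> "real F" "2 * real F" "1 / L"
    using general_face_bounds(3)[OF F] .
  have F1: "1 \<le> real F" and F01: "real (F_max X (-1) 0 1) \<le> real F"
    using general_face_bounds[OF F] by auto
  have L: "0 < L" "1 \<le> L"
    using L_ge_1 by auto
  show ?thesis
  proof (rule criterionI[OF E _ E''(1) _ E''' _ D'(1) _ D''(1)])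
    have "2 * (2 * real F) * real F * L ^ 16 * E'
        \<le> 2 * (2 * real F) * real F * L ^ 16 * (1 / (4 * L ^ 18 * real F ^ 2))"
      using E' L F1 by (intro mult_left_mono) auto
    also have "\<dots> = 1 / L * (1 / L)"
      using L F1 by (simp add: field_simps eval_nat_numeral)
    also have "\<dots> \<le> 1 / L * 1"
      using L by (intro mult_left_mono) auto
    finally show "2 * (2 * real F) * real F * L ^ 16 * E' \<le> 1 / L"
      by simp
    show "2 * E'' * L ^ 4 \<le> 1"
      using E''(2) L by (simp add: field_simps)
    show "4 * D' * L ^ 3 \<le> 1"
      using D'(2) L by (simp add: field_simps)
    show "D * real (F_max X (-1) 0 1) * L ^ 7 \<le> 1"
    proof (cases "0 \<le> D")
      case True
      then have "D * real (F_max X (-1) 0 1) * L ^ 7 \<le> D * real F * L ^ 7"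
        using F01 L by (intro mult_right_mono mult_left_mono) auto
      also have "\<dots> \<le> 1"
        using D L F1 by (simp add: field_simps)
      finally show ?thesis .
    next
      case False
      then have "D * (real (F_max X (-1) 0 1) * L ^ 7) \<le> 0"
        using L by (intro mult_nonpos_nonneg) auto
      then show ?thesis
        by (simp add: mult.assoc)
    qed
    have "D'' * real (F_max X (-1) 0 1) * L ^ 3 \<le> D'' * real F * L ^ 3"
      using F01 L D''(1) by (intro mult_right_mono mult_left_mono) auto
    also have "\<dots> \<le> D'"
      using D''(2) L F1 by (simp add: field_simps)
    finally show "D'' * real (F_max X (-1) 0 1) * L ^ 3 \<le> D'" .
  qed
qed

end

lemma admissible_sheaf_dposet:
  "admissible F L R d X w \<sigma> \<F> \<Longrightarrow> sheaf_dposet d X w L R \<sigma> \<F>"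
  by (simp add: admissible_def sheaf_dposet_def sheaf_dposet_axioms_def weighted_dposet_def
      weighted_dposet_axioms_def dposet_def)

text \<open>The stated constants are smaller than the estimates require, and
  \<open>1 \<le> L\<close>, \<open>1 \<le> F\<close> reduce the claim to comparing
  exponents.\<close>

lemma admissible_general_criterion:
  assumes "admissible F L R d X w \<sigma> \<F>"
  shows "criterion (1 / L ^ 8) (1 / (4 * L ^ 18 * real F ^ 5)) (1 / (2 * L ^ 13 * real F ^ 2))
    (1 / L ^ 3) (1 / (L ^ 15 * real F)) (1 / (4 * L ^ 12 * real F ^ 2))
    (1 / (4 * L ^ 16 * real F ^ 3)) d X w \<sigma> \<F>"
proof -
  interpret sheaf_dposet d X w L R \<sigma> \<F>
    using admissible_sheaf_dposet[OF assms] .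
  have F: "F_max X (-1) 0 2 \<le> F" "F_max X (-1) 1 2 \<le> F"
    using assms by (auto simp: admissible_def)
  have F1: "1 \<le> real F"
    using general_face_bounds(1)[OF F] by simp
  have L: "0 < L" "1 \<le> L"
    using L_ge_1 by auto
  have powL: "L ^ i \<le> L ^ j" if "i \<le> j" for i j
    using L that by (intro power_increasing) auto
  have powF: "real F ^ i \<le> real F ^ j" if "i \<le> j" for i j
    using F1 that by (intro power_increasing) auto
  have pow1: "1 \<le> L ^ i" "1 \<le> real F ^ i" for i
    using L F1 by (simp_all only: one_le_power)
  have F0: "0 < real F"
    using F1 by linarith
  have inv: "1 / a \<le> 1 / b" if "0 < b" "b \<le> a" for a b :: real
    using that by (intro divide_left_mono) auto
  show ?thesis
  proof (rule general_criterion[OF F])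
    show "1 / L ^ 8 \<le> 1 / L ^ 4"
      using powL[of 4 8] L F0 by (intro inv) auto
    show "1 / (4 * L ^ 18 * real F ^ 5) \<le> 1 / (4 * L ^ 18 * real F ^ 2)"
      using powF[of 2 5] L F0 by (intro inv mult_left_mono) auto
    show "1 / (2 * L ^ 13 * real F ^ 2) \<le> 1 / (2 * L ^ 4)"
      using powL[of 4 13] pow1(2)[of 2] L F0 mult_mono[of "2 * L ^ 4" "2 * L ^ 13" 1 "real F ^ 2"]
      by (intro inv) auto
    show "1 / L ^ 3 \<le> 1"
      using pow1[of 3] L(1) by (simp add: divide_le_eq)
    show "1 / (L ^ 15 * real F) \<le> 1 / (L ^ 7 * real F)"
      using powL[of 7 15] L F0 by (intro inv mult_right_mono) auto
    show "1 / (4 * L ^ 12 * real F ^ 2) \<le> 1 / (4 * L ^ 3)"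
      using powL[of 3 12] pow1(2)[of 2] L F0 mult_mono[of "4 * L ^ 3" "4 * L ^ 12" 1 "real F ^ 2"]
      by (intro inv) auto
    have "1 / (4 * L ^ 16 * real F ^ 3) \<le> 1 / (4 * L ^ 15 * real F ^ 3)"
      using powL[of 15 16] L F0 by (intro inv mult_right_mono mult_left_mono) auto
    also have "\<dots> = 1 / (4 * L ^ 12 * real F ^ 2) / (L ^ 3 * real F)"
      by (simp add: eval_nat_numeral)
    finally show "1 / (4 * L ^ 16 * real F ^ 3) \<le> 1 / (4 * L ^ 12 * real F ^ 2) / (L ^ 3 * real F)" .
  qed (use L F0 in auto)
qed

lemma admissible_lower_regular_criterion:
  assumes adm: "admissible F L R d X w \<sigma> \<F>" and reg: "lower_regular d X"
  shows "criterion 1 (1 / (4 * real F ^ 2)) (1 / (2 * real F)) 1 (1 / real F)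
    (1 / (4 * real F)) (1 / (4 * real F ^ 2)) d X w \<sigma> \<F>"
proof -
  interpret sheaf_dposet d X w 1 R \<sigma> \<F>
    using sheaf_dposet_change_L[OF admissible_sheaf_dposet[OF adm]] reg by (simp add: lower_regular_def)
  have F: "F_max X (-1) 0 2 \<le> F" "F_max X (-1) 1 2 \<le> F"
    using adm by (auto simp: admissible_def)
  have F1: "1 \<le> real F"
    using general_face_bounds(1)[OF F] by simp
  show ?thesis
    by (rule general_criterion[OF F]) (use F1 in \<open>auto simp: field_simps power2_eq_square\<close>)
qed

lemma admissible_simplicial_criterion:
  fixes X :: "('a::order) gposet"
  assumes adm: "admissible F L R d X w \<sigma> \<F>" and simp: "is_simplicial_complex X"
  shows "criterion 1 (1 / 12) (1 / 2) 1 (1 / 2) (1 / 4) (1 / 8) d X w \<sigma> \<F>"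
proof -
  interpret P: dposet d X
    using admissible_sheaf_dposet[OF adm] by (simp add: sheaf_dposet_def weighted_dposet_def)
  have "lower_regular d X"
    using P.simplicial_count[OF simp] by (intro P.lower_regularI) simp
  then interpret sheaf_dposet d X w 1 R \<sigma> \<F>
    using sheaf_dposet_change_L[OF admissible_sheaf_dposet[OF adm]] by (simp add: lower_regular_def)
  have sub: "card (subfaces X z 0) = nat (k + 1)" if "z \<in> cells X k" for z k
    using P.simplicial_count[OF simp P.empty_face_props(1) that P.empty_face_props(2)[OF P.cells_faces[OF that]], of 0]
      P.subfaces_eq[OF P.cells_faces[OF that], of 0] by simp
  show ?thesis
    using polygon_criterion[of 3] sub[of _ 2] sub[of _ 1] P.simplicial_count[OF simp, of _ 0 _ 2 1] by simp
qed

lemma admissible_cube_criterion: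
  fixes X :: "('a::order) gposet"
  assumes adm: "admissible F L R d X w \<sigma> \<F>" and cube: "is_cube_complex X"
  shows "criterion 1 (1 / 16) (1 / 2) 1 (1 / 2) (1 / 4) (1 / 8) d X w \<sigma> \<F>"
proof -
  interpret P: dposet d X
    using admissible_sheaf_dposet[OF adm] by (simp add: sheaf_dposet_def weighted_dposet_def)
  have "lower_regular d X"
    using P.cube_lower_regular[OF cube] .
  then interpret sheaf_dposet d X w 1 R \<sigma> \<F>
    using sheaf_dposet_change_L[OF admissible_sheaf_dposet[OF adm]] by (simp add: lower_regular_def)
  have sub: "card (subfaces X z 0) = 2 ^ nat k" if "z \<in> cells X k" "0 \<le> k" for z k
    using P.cube_subfaces[OF cube that, of 0] card_cube_vertices[of "nat k"] by simp
  show ?thesis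
    using polygon_criterion[of 4] sub[of _ 2] sub[of _ 1] P.cube_count[OF cube, of _ 2 _ 0 1] by simp
qed

lemma admissible_polygon_criterion:
  fixes X :: "('a::order) gposet"
  assumes adm: "admissible F L R d X w \<sigma> \<F>" and poly: "is_polygon_complex m (skeleton2 X)"
  shows "criterion (1 / L ^ 8) (1 / (4 * real m * L ^ 18)) (1 / (2 * L ^ 13)) (1 / L ^ 3)
    (1 / (2 * L ^ 15)) (1 / (4 * L ^ 12)) (1 / (8 * L ^ 16)) d X w \<sigma> \<F>"
proof -
  interpret sheaf_dposet d X w L R \<sigma> \<F>
    using admissible_sheaf_dposet[OF adm] .
  show ?thesis
  proof (rule polygon_criterion)
    show "1 \<le> m"
      using poly by (simp add: is_polygon_complex_def)
    show "card (subfaces X e 0) = 2" if e: "e \<in> cells X 1" for e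
    proof -
      obtain z where "z \<in> cells X 2" "e \<le> z"
        using edge_in_triangle[OF d_ge_2 e] .
      then show ?thesis
        using polygon_counts(3)[OF poly] e by blast
    qed
  qed (use polygon_counts(2,4)[OF poly] in auto)
qed

theorem theorem8p10:
  fixes F :: nat and L :: real
  assumes "1 \<le> L"
  shows "(\<exists>E E' E'' E''' D D' D''.
      0 < E \<and> 0 < E' \<and> 0 < E'' \<and> 0 < E''' \<and> 0 < D \<and> 0 < D' \<and> 0 < D''
      \<and> (\<forall>(R :: 'r ring) d (X :: ('a::order) gposet) w \<sigma> (\<F> :: ('a, 'r, 'm) sheaf).
            admissible F L R d X w \<sigma> \<F> \<longrightarrow> criterion E E' E'' E''' D D' D'' d X w \<sigma> \<F>))
    \<and> (\<forall>(R :: 'r ring) d (X :: ('a::order) gposet) w \<sigma> (\<F> :: ('a, 'r, 'm) sheaf).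
        admissible F L R d X w \<sigma> \<F> \<longrightarrow>
          criterion (1 / L ^ 8) (1 / (4 * L ^ 18 * real F ^ 5)) (1 / (2 * L ^ 13 * real F ^ 2))
            (1 / L ^ 3) (1 / (L ^ 15 * real F)) (1 / (4 * L ^ 12 * real F ^ 2))
            (1 / (4 * L ^ 16 * real F ^ 3)) d X w \<sigma> \<F>
          \<and> (lower_regular d X \<longrightarrow>
              criterion 1 (1 / (4 * real F ^ 2)) (1 / (2 * real F)) 1 (1 / real F)
                (1 / (4 * real F)) (1 / (4 * real F ^ 2)) d X w \<sigma> \<F>)
          \<and> (is_simplicial_complex X \<longrightarrow>
              criterion 1 (1 / 12) (1 / 2) 1 (1 / 2) (1 / 4) (1 / 8) d X w \<sigma> \<F>)
          \<and> (is_cube_complex X \<longrightarrow>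
              criterion 1 (1 / 16) (1 / 2) 1 (1 / 2) (1 / 4) (1 / 8) d X w \<sigma> \<F>)
          \<and> (\<forall>m. is_polygon_complex m (skeleton2 X) \<longrightarrow>
              criterion (1 / L ^ 8) (1 / (4 * real m * L ^ 18)) (1 / (2 * L ^ 13)) (1 / L ^ 3)
                (1 / (2 * L ^ 15)) (1 / (4 * L ^ 12)) (1 / (8 * L ^ 16)) d X w \<sigma> \<F>))"
  (is "?ex \<and> ?explicit")
proof
  show ?ex
  \<comment> \<open>For \<open>F = 0\<close> the explicit constants would be quotients by zero and
    not positive. But a 2-face has a vertex, so nothing is admissible and any positive constants
    serve.\<close>
  proof (cases "F = 0")
    case True
    have "\<not> admissible F L R d X w \<sigma> \<F>"
      for R :: "'r ring" and d and X :: "'a gposet" and w \<sigma> and \<F> :: "('a, 'r, 'm) sheaf"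
    proof
      assume adm: "admissible F L R d X w \<sigma> \<F>"
      then interpret sheaf_dposet d X w L R \<sigma> \<F>
        by (rule admissible_sheaf_dposet)
      show False
        using general_face_bounds(1)[of F] adm True by (simp add: admissible_def)
    qed
    then show ?thesis
      by (intro exI[of _ 1]) simp
  next
    case False
    then have F: "0 < real F" by simp
    \<comment> \<open>The constants stay schematic until the eighth goal, the criterion itself, is
      resolved with the general case; the seven positivity goals are settled afterwards.\<close>
    show ?thesis
      by (intro exI conjI allI impI, rule_tac [8] admissible_general_criterion) (use assms F in auto)
  qed
  show ?explicit
    by (intro allI impI conjI admissible_general_criterion admissible_lower_regular_criterion
        admissible_simplicial_criterion admissible_cube_criterion admissible_polygon_criterion)
qed

end
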